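(* Let $G_{\mathbf z}=G_\Gamma\rtimes_{\delta_{\mathbf z}}\Delta$ be a $\Delta$-RAAG, let $n$ be a positive integer, and let $\Gamma^c$ be the complete graph on $n$ vertices, so that $G_{\Gamma^c}\simeq\mathbb Z_2^n$. Then the pro-$2$ group $G:=G_{\Gamma^c}\rtimes_{i_n}G_{\mathbf z}$ is a $\Delta$-RAAG. Precisely, $$G\simeq G_{\Gamma\nabla\Gamma^c}\rtimes_{\delta_{\mathbf z'}}\Delta,\qquad \mathbf z':=(\mathbf z,1,\dots,1)\in G_{\Gamma\nabla\Gamma^c}^{\,d_\Gamma+n},$$ where $\nabla$ denotes the join of graphs.
   Context: $\Delta:=\mathbb{Z}/2\mathbb{Z}$ is written multiplicatively with generator $x_0$. For a finite undirected graph $\Gamma=(\mathbf{X},\mathbf{E})$ with vertex set $\{1,\dots,d_\Gamma\}$, $G_\Gamma$ is the pro-$2$ group with generators $x_1,\dots,x_{d_\Gamma}$ and relations $[x_i,x_j]:=x_i^{-1}x_j^{-1}x_ix_j=1$ for $\{i,j\}\in\mathbf{E}$. If $\mathbf{z}=(z_1,\dots,z_{d_\Gamma})\in G_\Gamma^{d_\Gamma}$ is such that there is a well-defined action $\delta_{\mathbf z}:\Delta\to\mathrm{Aut}(G_\Gamma)$ with $\delta_{\mathbf z}(x_0)(x_i)=z_i^{-1}x_i^{-1}z_i$ for all $i$, then $G_{\mathbf z}:=G_\Gamma\rtimes_{\delta_{\mathbf z}}\Delta$ is called a $\Delta$-RAAG. The semi-trivial action $i_n$ of a semi-direct product $H\rtimes\Delta$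 on $\mathbb Z_2^n$ (written multiplicatively, $\mathbb Z_2$ the $2$-adic integers) is: $H$ acts trivially and $x_0$ acts by $v\mapsto v^{-1}$; here $H=G_\Gamma$. In $\Gamma\nabla\Gamma^c$ the vertices are ordered with those of $\Gamma$ first, then those of $\Gamma^c$. *)

theory Defs
  imports "HOL-Analysis.Analysis" "HOL-Algebra.Algebra"
begin

section \<open>Topological groups\<close>

record 'a tgroup = "'a monoid" +
  topo :: "'a topology"

definition with_topology :: "('a, 'b) monoid_scheme \<Rightarrow> 'a topology \<Rightarrow> 'a tgroup" where
  "with_topology G T = \<lparr>carrier = carrier G, monoid.mult = monoid.mult G, one = one G, topo = T\<rparr>"

locale topological_group = group G for G :: "'a tgroup" (structure) +
  assumes topspace_topo: "topspace (topo G) = carrier G"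
    and continuous_mult:
      "continuous_map (prod_topology (topo G) (topo G)) (topo G) (\<lambda>(x, y). x \<otimes> y)"
    and continuous_inv: "continuous_map (topo G) (topo G) (\<lambda>x. inv x)"

locale pro2_group = topological_group +
  assumes compact: "compact_space (topo G)"
    and Hausdorff: "Hausdorff_space (topo G)"
    and open_subgroups_base:
      "\<And>U. openin (topo G) U \<Longrightarrow> \<one> \<in> U \<Longrightarrow>
         \<exists>H. subgroup H G \<and> openin (topo G) H \<and> H \<subseteq> U"
    and open_normal_index:
      "\<And>N. N \<lhd> G \<Longrightarrow> openin (topo G) N \<Longrightarrow> \<exists>k. card (rcosets N) = 2 ^ k"

definition continuous_hom :: "'a tgroup \<Rightarrow> 'b tgroup \<Rightarrow> ('a \<Rightarrow> 'b) set" where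
  "continuous_hom G H = {f \<in> hom G H. continuous_map (topo G) (topo H) f}"

definition tgroup_iso :: "'a tgroup \<Rightarrow> 'b tgroup \<Rightarrow> bool"  (infix \<open>\<simeq>\<^sub>t\<close> 50) where
  "G \<simeq>\<^sub>t H \<longleftrightarrow> (\<exists>f \<in> iso G H. homeomorphic_map (topo G) (topo H) f)"

text \<open>The factor group \<open>G Mod N\<close> with the quotient topology: a set of cosets is open iff
  its preimage in \<open>G\<close> is.\<close>

definition quotient_tgroup :: "'a tgroup \<Rightarrow> 'a set \<Rightarrow> 'a set tgroup" where
  "quotient_tgroup G N = with_topology (G Mod N)
     (topology (\<lambda>U. U \<subseteq> rcosets\<^bsub>G\<^esub> N \<and> openin (topo G) {x \<in> topspace (topo G). N #>\<^bsub>G\<^esub> x \<in> U}))"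

lemma istopology_quotient:
  "istopology (\<lambda>U. U \<subseteq> C \<and> openin T {x \<in> topspace T. q x \<in> U})"
proof -
  have "{x \<in> topspace T. q x \<in> U \<inter> V} = {x \<in> topspace T. q x \<in> U} \<inter> {x \<in> topspace T. q x \<in> V}"
    for U V by auto
  moreover have "{x \<in> topspace T. q x \<in> \<Union>\<K>} = (\<Union>U\<in>\<K>. {x \<in> topspace T. q x \<in> U})" for \<K>
    by auto
  ultimately show ?thesis
    unfolding istopology_def by (auto intro!: openin_Union)
qed

definition closed_normal_closure :: "'a tgroup \<Rightarrow> 'a set \<Rightarrow> 'a set" where
  "closed_normal_closure G R = \<Inter>{N. N \<lhd> G \<and> closedin (topo G) N \<and> R \<subseteq> N}"

definition comm :: "('a, 'b) monoid_scheme \<Rightarrow> 'a \<Rightarrow> 'a \<Rightarrow> 'a" where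
  "comm G x y = inv\<^bsub>G\<^esub> x \<otimes>\<^bsub>G\<^esub> inv\<^bsub>G\<^esub> y \<otimes>\<^bsub>G\<^esub> x \<otimes>\<^bsub>G\<^esub> y"


section \<open>Continuous actions and semidirect products\<close>

text \<open>Actions are by topological automorphisms: each \<open>\<phi> h\<close> lies in \<open>AutoGroup N\<close>, and it is
  continuous by joint continuity, as is its inverse \<open>\<phi> (inv h)\<close>.\<close>

definition continuous_action :: "'h tgroup \<Rightarrow> 'n tgroup \<Rightarrow> ('h \<Rightarrow> 'n \<Rightarrow> 'n) \<Rightarrow> bool" where
  "continuous_action H N \<phi> \<longleftrightarrow>
     \<phi> \<in> hom H (AutoGroup N) \<and>
     continuous_map (prod_topology (topo H) (topo N)) (topo N) (\<lambda>(h, v). \<phi> h v)"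

definition semidirect :: "'n tgroup \<Rightarrow> 'h tgroup \<Rightarrow> ('h \<Rightarrow> 'n \<Rightarrow> 'n) \<Rightarrow> ('n \<times> 'h) tgroup" where
  "semidirect N H \<phi> =
     \<lparr>carrier = carrier N \<times> carrier H,
      monoid.mult = (\<lambda>(v, g) (w, h). (v \<otimes>\<^bsub>N\<^esub> \<phi> g w, g \<otimes>\<^bsub>H\<^esub> h)),
      one = (\<one>\<^bsub>N\<^esub>, \<one>\<^bsub>H\<^esub>),
      topo = prod_topology (topo N) (topo H)\<rparr>"


section \<open>Free groups and free pro-2 groups\<close>

text \<open>The letter \<open>(i, True)\<close> stands for the generator \<open>x\<^sub>i\<close>, and \<open>(i, False)\<close> for its inverse.
  The elements of the free group are the reduced words.\<close>

type_synonym letter = "nat \<times> bool"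
type_synonym word = "letter list"

fun opp :: "letter \<Rightarrow> letter" where
  "opp (i, b) = (i, \<not> b)"

fun cancel_cons :: "letter \<Rightarrow> word \<Rightarrow> word" where
  "cancel_cons a [] = [a]"
| "cancel_cons a (b # w) = (if b = opp a then w else a # b # w)"

definition free_group :: "nat \<Rightarrow> word monoid" where
  "free_group d =
     \<lparr>carrier = {w. fst ` set w \<subseteq> {1..d} \<and> successively (\<lambda>a b. b \<noteq> opp a) w},
      monoid.mult = (\<lambda>u v. foldr cancel_cons u v),
      one = []\<rparr>"

definition normal_2power :: "('a, 'b) monoid_scheme \<Rightarrow> 'a set set" where
  "normal_2power G = {N. N \<lhd> G \<and> (\<exists>k. card (rcosets\<^bsub>G\<^esub> N) = 2 ^ k)}"

text \<open>The pro-2 completion is the inverse limit of the finite quotients \<open>G Mod N\<close> of 2-power order.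
  For \<open>N \<subseteq> M\<close>, the projection \<open>G Mod N \<rightarrow> G Mod M\<close> sends a coset of \<open>N\<close> to the coset of \<open>M\<close>
  containing it.\<close>

definition pro2_completion :: "('a, 'b) monoid_scheme \<Rightarrow> ('a set \<Rightarrow> 'a set) tgroup" where
  "pro2_completion G =
     (let I = normal_2power G;
          P = product_group I (\<lambda>N. G Mod N);
          L = {f \<in> carrier P. \<forall>N\<in>I. \<forall>M\<in>I. N \<subseteq> M \<longrightarrow> f N \<subseteq> f M}
      in with_topology (P\<lparr>carrier := L\<rparr>)
           (subtopology (product_topology (\<lambda>N. discrete_topology (carrier (G Mod N))) I) L))"

definition completion_map :: "('a, 'b) monoid_scheme \<Rightarrow> 'a \<Rightarrow> ('a set \<Rightarrow> 'a set)" where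
  "completion_map G x = (\<lambda>N \<in> normal_2power G. N #>\<^bsub>G\<^esub> x)"

definition free_pro2 :: "nat \<Rightarrow> (word set \<Rightarrow> word set) tgroup" where
  "free_pro2 d = pro2_completion (free_group d)"

definition free_pro2_gen :: "nat \<Rightarrow> nat \<Rightarrow> (word set \<Rightarrow> word set)" where
  "free_pro2_gen d i = completion_map (free_group d) [(i, True)]"


section \<open>Graphs and pro-2 right-angled Artin groups\<close>

text \<open>The vertex set of a graph is \<open>{1..nverts \<Gamma>}\<close>; an edge is a two-element set of vertices.\<close>

record graph =
  nverts :: nat
  edges :: "nat set set"

definition pairs :: "nat \<Rightarrow> nat set set" where
  "pairs d = {{i, j} | i j. i \<in> {1..d} \<and> j \<in> {1..d} \<and> i \<noteq> j}"

definition is_graph :: "graph \<Rightarrow> bool" where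
  "is_graph \<Gamma> \<longleftrightarrow> edges \<Gamma> \<subseteq> pairs (nverts \<Gamma>)"

definition complete_graph :: "nat \<Rightarrow> graph" where
  "complete_graph n = \<lparr>nverts = n, edges = pairs n\<rparr>"

text \<open>In the join, vertex \<open>j\<close> of the second graph becomes vertex \<open>nverts \<Gamma> + j\<close>.\<close>

definition join :: "graph \<Rightarrow> graph \<Rightarrow> graph"  (infixl \<open>\<nabla>\<close> 65) where
  "\<Gamma> \<nabla> \<Gamma>' =
     \<lparr>nverts = nverts \<Gamma> + nverts \<Gamma>',
      edges = edges \<Gamma> \<union> (\<lambda>e. (\<lambda>j. nverts \<Gamma> + j) ` e) ` edges \<Gamma>' \<union>
        {{i, nverts \<Gamma> + j} | i j. i \<in> {1..nverts \<Gamma>} \<and> j \<in> {1..nverts \<Gamma>'}}\<rparr>"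

type_synonym raag_elem = "(word set \<Rightarrow> word set) set"

definition raag_relations :: "graph \<Rightarrow> (word set \<Rightarrow> word set) set" where
  "raag_relations \<Gamma> =
     {comm (free_pro2 (nverts \<Gamma>)) (free_pro2_gen (nverts \<Gamma>) i) (free_pro2_gen (nverts \<Gamma>) j)
       | i j. {i, j} \<in> edges \<Gamma>}"

definition raag :: "graph \<Rightarrow> raag_elem tgroup" where
  "raag \<Gamma> = quotient_tgroup (free_pro2 (nverts \<Gamma>))
     (closed_normal_closure (free_pro2 (nverts \<Gamma>)) (raag_relations \<Gamma>))"

definition raag_gen :: "graph \<Rightarrow> nat \<Rightarrow> raag_elem" where
  "raag_gen \<Gamma> i =
     closed_normal_closure (free_pro2 (nverts \<Gamma>)) (raag_relations \<Gamma>)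
       #>\<^bsub>free_pro2 (nverts \<Gamma>)\<^esub> free_pro2_gen (nverts \<Gamma>) i"


section \<open>Delta-RAAGs\<close>

definition Delta :: "int tgroup" where
  "Delta = with_topology (integer_mod_group 2) (discrete_topology (carrier (integer_mod_group 2)))"

definition x0 :: int where
  "x0 = 1"

text \<open>\<open>Delta_action \<Gamma> z \<delta>\<close>: there is a well-defined action \<open>\<delta>\<^sub>z\<close>, and it is \<open>\<delta>\<close>. The values of \<open>\<delta>\<close> on
  \<open>carrier Delta\<close> are determined by \<open>\<Gamma>\<close> and \<open>z\<close>, as the generators generate \<open>raag \<Gamma>\<close>
  topologically.\<close>

definition Delta_action :: "graph \<Rightarrow> (nat \<Rightarrow> raag_elem) \<Rightarrow> (int \<Rightarrow> raag_elem \<Rightarrow> raag_elem) \<Rightarrow> bool" where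
  "Delta_action \<Gamma> z \<delta> \<longleftrightarrow>
     z \<in> {1..nverts \<Gamma>} \<rightarrow> carrier (raag \<Gamma>) \<and>
     continuous_action Delta (raag \<Gamma>) \<delta> \<and>
     (\<forall>i\<in>{1..nverts \<Gamma>}. \<delta> x0 (raag_gen \<Gamma> i) =
        inv\<^bsub>raag \<Gamma>\<^esub> z i \<otimes>\<^bsub>raag \<Gamma>\<^esub> inv\<^bsub>raag \<Gamma>\<^esub> raag_gen \<Gamma> i \<otimes>\<^bsub>raag \<Gamma>\<^esub> z i)"

definition is_Delta_RAAG :: "'a tgroup \<Rightarrow> bool" where
  "is_Delta_RAAG G \<longleftrightarrow>
     (\<exists>\<Gamma> z \<delta>. is_graph \<Gamma> \<and> Delta_action \<Gamma> z \<delta> \<and> G \<simeq>\<^sub>t semidirect (raag \<Gamma>) Delta \<delta>)"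

text \<open>The embedding of \<open>raag \<Gamma>\<close> into \<open>raag \<Gamma>'\<close> for \<open>\<Gamma>\<close> a subgraph on the first vertices of \<open>\<Gamma>'\<close>;
  again it is determined by its values on the generators.\<close>

definition raag_embedding :: "graph \<Rightarrow> graph \<Rightarrow> (raag_elem \<Rightarrow> raag_elem) \<Rightarrow> bool" where
  "raag_embedding \<Gamma> \<Gamma>' \<iota> \<longleftrightarrow>
     \<iota> \<in> continuous_hom (raag \<Gamma>) (raag \<Gamma>') \<and> inj_on \<iota> (carrier (raag \<Gamma>)) \<and>
     (\<forall>i\<in>{1..nverts \<Gamma>}. \<iota> (raag_gen \<Gamma> i) = raag_gen \<Gamma>' i)"


section \<open>The 2-adic integers and the semi-trivial action\<close>

text \<open>The additive group of 2-adic integers, as the inverse limit of the groups of integers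
  modulo \<open>2 ^ k\<close>; the group operation is written multiplicatively.\<close>

definition Z2 :: "(nat \<Rightarrow> int) tgroup" where
  "Z2 =
     (let P = product_group UNIV (\<lambda>k. integer_mod_group (2 ^ k));
          L = {a \<in> carrier P. \<forall>k. a (Suc k) mod 2 ^ k = a k}
      in with_topology (P\<lparr>carrier := L\<rparr>)
           (subtopology
             (product_topology (\<lambda>k. discrete_topology (carrier (integer_mod_group (2 ^ k)))) UNIV) L))"

definition Z2_power :: "nat \<Rightarrow> (nat \<Rightarrow> nat \<Rightarrow> int) tgroup" where
  "Z2_power n = with_topology (product_group {1..n} (\<lambda>_. Z2)) (product_topology (\<lambda>_. topo Z2) {1..n})"

text \<open>The semi-trivial action of a semidirect product of some group with \<open>Delta\<close>, given as \<open>P\<close>, on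
  an abelian group \<open>A\<close>. Every isomorphism of abelian groups is equivariant for it, so the
  action on \<open>Z2_power n\<close> carries over to any copy of that group.\<close>

definition semi_trivial :: "('h \<times> int) tgroup \<Rightarrow> 'a tgroup \<Rightarrow> 'h \<times> int \<Rightarrow> 'a \<Rightarrow> 'a" where
  "semi_trivial P A = (\<lambda>g\<in>carrier P. \<lambda>v\<in>carrier A. if snd g = x0 then inv\<^bsub>A\<^esub> v else v)"

end

theory Submission
  imports Defs
begin

text \<open>
  The group \<open>raag \<Gamma>\<close> is a pro-2 group, topologically generated by its generators, and universal among
  the pro-2 groups with elements that commute along the edges of \<open>\<Gamma>\<close>. By this universal property
  alone, the group of a join is the direct product of the groups of the two graphs: the inclusions
  and projections are defined on generators, and the identities between them hold because they hold
  on generators. For the complete graph \<open>K\<close> on \<open>n\<close> vertices, an element \<open>(c, (a, t))\<close> of the iterated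
  semidirect product corresponds to \<open>(a c, t)\<close> in the product of \<open>raag (\<Gamma> \<nabla> K)\<close> and \<open>\<Delta>\<close>, where \<open>x0\<close>
  acts by the given action on the first factor and by inversion on the second; inversion is the
  action for \<open>z = 1\<close>.
\<close>

text \<open>No normal form for elements of \<open>raag \<Gamma>\<close> is used. The injectivity of
  the embedding into the group of the join, usually read off from normal forms, comes from the
  projection that retracts it. The comparison of \<open>raag (complete_graph n)\<close> with
  \<open>Z2_power n\<close> is the part that generators alone do not settle. The universal property
  supplies the \<open>n\<close> coordinate maps to \<open>Z2\<close>; that they are jointly
  injective and surjective takes a computation modulo 2^k and compactness. The targets of the
  universal property are themselves infinite pro-2 groups, so a homomorphism from a free group has
  to be extended over the completion with an arbitrary pro-2 target, again by compactness. Indices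
  of open normal subgroups are awkward to follow through limits, quotients and semidirect products.
  In a compact group finiteness of the index is automatic, and then the index is a power of 2 as
  soon as each element has some 2^k-th power in the subgroup. The pro-2 property is always checked
  in that form.\<close>

lemma with_topology_simps [simp]:
  "carrier (with_topology G T) = carrier G"
  "monoid.mult (with_topology G T) = monoid.mult G"
  "one (with_topology G T) = one G"
  "topo (with_topology G T) = T"
  by (simp_all add: with_topology_def)

lemma m_inv_with_topology [simp]: "m_inv (with_topology G T) = m_inv G"
  by (simp add: m_inv_def fun_eq_iff)

lemma group_with_topology:
  assumes "group G"
  shows "group (with_topology G T)"
proof -
  interpret group G by fact
  show ?thesis
    by (rule groupI) (auto simp: m_assoc intro: l_inv_ex)
qed

section \<open>Topological groups and pro-2 groups\<close>

text \<open>Cauchy's theorem gives the converse: for a prime \<open>p\<close> dividing the order, an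
  element of order \<open>p\<close> has order dividing a power of 2, so \<open>p = 2\<close>. The
  right-hand side can be checked one element at a time.\<close>

lemma order_two_power_iff:
  fixes G (structure)
  assumes "group G"
  shows "(\<exists>k. order G = 2 ^ k) \<longleftrightarrow>
    finite (carrier G) \<and> (\<forall>x\<in>carrier G. \<exists>k. x [^]\<^bsub>G\<^esub> ((2::nat) ^ k) = \<one>\<^bsub>G\<^esub>)"
proof -
  interpret group G by fact
  show ?thesis
  proof safe
    fix k assume k: "order G = 2 ^ k"
    then show "finite (carrier G)"
      using order_gt_0_iff_finite by (metis zero_less_numeral zero_less_power)
    show "\<exists>k. x [^] ((2::nat) ^ k) = \<one>" if "x \<in> carrier G" for x
      using pow_order_eq_1[OF that] k by metis
  next
    assume fin: "finite (carrier G)" and pow: "\<forall>x\<in>carrier G. \<exists>k. x [^] ((2::nat) ^ k) = \<one>"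
    have "p = 2" if p: "Factorial_Ring.prime p" "p dvd order G" for p :: nat
    proof -
      \<comment> \<open>Cauchy's theorem is obtained as Sylow's theorem with exponent 1;
        \<open>m\<close> may still be divisible by \<open>p\<close>.\<close>
      obtain m where m: "order G = p ^ 1 * m"
        using p by auto
      obtain H where H: "subgroup H G" "card H = p"
        using sylow_thm[OF p(1) assms m fin] by auto
      have "\<not> H \<subseteq> {\<one>}"
        using H(2) prime_gt_1_nat[OF p(1)] card_mono[of "{\<one>}" H] by auto
      then obtain x where x: "x \<in> H" "x \<noteq> \<one>"
        by auto
      then have xG: "x \<in> carrier G"
        using H subgroup.subset by blast
      interpret K: group "G\<lparr>carrier := H\<rparr>"
        using H subgroup_imp_group by blast
      have "x [^]\<^bsub>G\<lparr>carrier := H\<rparr>\<^esub> p = \<one>"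
        using K.pow_order_eq_1[of x] x H by (simp add: order_def)
      then have "x [^] p = \<one>"
        by (simp add: nat_pow_def)
      moreover obtain k where "x [^] ((2::nat) ^ k) = \<one>"
        using pow xG by auto
      ultimately have "ord x dvd p" "ord x dvd 2 ^ k"
        using xG pow_eq_id by auto
      moreover have "ord x \<noteq> 1"
        using x xG ord_eq_1 by auto
      ultimately have "ord x = p"
        using p(1) by (metis prime_nat_iff)
      then have "p dvd 2"
        using \<open>ord x dvd 2 ^ k\<close> p(1) prime_dvd_power by blast
      then show "p = 2"
        using p(1) primes_dvd_imp_eq two_is_prime_nat by blast
    qed
    moreover have "order G > 0"
      using fin by (simp add: order_gt_0_iff_finite)
    ultimately have "prime_factorization (order G) = replicate_mset (size (prime_factorization (order G))) 2"
      by (intro set_mset_subset_singletonD) (auto simp: prime_factors_dvd)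
    then have "order G = 2 ^ size (prime_factorization (order G))"
      using \<open>order G > 0\<close>
      by (metis prod_mset_prime_factorization_nat prod_mset_replicate_mset)
    then show "\<exists>k. order G = 2 ^ k" ..
  qed
qed

text \<open>This is the criterion for orders applied to \<open>G Mod N\<close>: a power of the coset
  of \<open>x\<close> is trivial exactly when that power of \<open>x\<close> lies in
  \<open>N\<close>.\<close>

lemma normal_index_two_power_iff:
  fixes G (structure)
  assumes "N \<lhd> G"
  shows "(\<exists>k. card (rcosets\<^bsub>G\<^esub> N) = 2 ^ k) \<longleftrightarrow>
    finite (rcosets\<^bsub>G\<^esub> N) \<and> (\<forall>x\<in>carrier G. \<exists>k. x [^]\<^bsub>G\<^esub> ((2::nat) ^ k) \<in> N)"
proof -
  interpret normal N G by fact
  have "N #> y = N \<longleftrightarrow> y \<in> N" if "y \<in> carrier G" for y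
    using that coset_join1 coset_join2 subgroup_axioms by blast
  then have "(\<forall>x\<in>carrier (G Mod N). \<exists>k. x [^]\<^bsub>G Mod N\<^esub> ((2::nat) ^ k) = \<one>\<^bsub>G Mod N\<^esub>)
    \<longleftrightarrow> (\<forall>x\<in>carrier G. \<exists>k. x [^] ((2::nat) ^ k) \<in> N)"
    by (simp add: carrier_FactGroup FactGroup_pow)
  moreover have "carrier (G Mod N) = rcosets N"
    by (simp add: FactGroup_def)
  ultimately show ?thesis
    using order_two_power_iff[OF factorgroup_is_group] by (simp add: order_def)
qed

lemma in_normal_2power_iff:
  "N \<in> normal_2power G \<longleftrightarrow> N \<lhd> G \<and> finite (rcosets\<^bsub>G\<^esub> N) \<and>
    (\<forall>x\<in>carrier G. \<exists>k. x [^]\<^bsub>G\<^esub> ((2::nat) ^ k) \<in> N)"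
  using normal_index_two_power_iff[of N G] by (auto simp: normal_2power_def)

text \<open>Exponents found separately for finitely many subgroups can thus be raised to a common
  one.\<close>

lemma (in group) subgroup_pow_two_mono:
  assumes "subgroup H G" "x [^] ((2::nat) ^ k) \<in> H" "x \<in> carrier G" "k \<le> l"
  shows "x [^] ((2::nat) ^ l) \<in> H"
proof -
  have "x [^] ((2::nat) ^ l) = (x [^] ((2::nat) ^ k)) [^] ((2::nat) ^ (l - k))"
    using assms by (simp add: nat_pow_pow flip: power_add)
  moreover have "y [^] (n::nat) \<in> H" if "y \<in> H" for y n
    using that assms(1) by (induction n) (auto simp: subgroup.one_closed subgroup.m_closed)
  ultimately show ?thesis
    using assms(2) by simp
qed

context topological_group
begin

lemma openin_subset_carrier: "openin (topo G) U \<Longrightarrow> U \<subseteq> carrier G"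
  using openin_subset topspace_topo by metis

lemma closedin_subset_carrier: "closedin (topo G) U \<Longrightarrow> U \<subseteq> carrier G"
  using closedin_subset topspace_topo by metis

lemma continuous_map_mult:
  assumes "continuous_map T (topo G) f" "continuous_map T (topo G) g"
  shows "continuous_map T (topo G) (\<lambda>x. f x \<otimes> g x)"
  using continuous_map_compose[OF continuous_map_pairedI[OF assms] continuous_mult]
  by (simp add: o_def)

lemma continuous_map_m_inv:
  assumes "continuous_map T (topo G) f"
  shows "continuous_map T (topo G) (\<lambda>x. inv f x)"
  using continuous_map_compose[OF assms continuous_inv] by (simp add: o_def)

lemma continuous_map_const_carrier:
  "a \<in> carrier G \<Longrightarrow> continuous_map T (topo G) (\<lambda>x. a)"
  by (simp add: topspace_topo)

lemma openin_r_coset: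
  assumes "openin (topo G) U" "a \<in> carrier G"
  shows "openin (topo G) (U #> a)"
proof -
  have "U #> a = {x \<in> topspace (topo G). x \<otimes> inv a \<in> U}"
  proof safe
    fix x assume "x \<in> U #> a"
    then obtain u where "u \<in> U" "x = u \<otimes> a"
      by (auto simp: r_coset_def)
    moreover have "u \<in> carrier G"
      using \<open>u \<in> U\<close> assms openin_subset_carrier by blast
    ultimately show "x \<in> topspace (topo G)" "x \<otimes> inv a \<in> U"
      using assms(2) by (auto simp: topspace_topo m_assoc)
  next
    fix x assume "x \<in> topspace (topo G)" "x \<otimes> inv a \<in> U"
    then show "x \<in> U #> a"
      using assms(2) by (auto simp: topspace_topo r_coset_def m_assoc intro!: bexI[of _ "x \<otimes> inv a"])
  qed
  moreover have "openin (topo G) {x \<in> topspace (topo G). x \<otimes> inv a \<in> U}"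
    using assms
    by (intro openin_continuous_map_preimage[of _ "topo G"] continuous_map_mult
        continuous_map_const_carrier continuous_map_id[unfolded id_def]) auto
  ultimately show ?thesis by simp
qed

text \<open>The complement is a union of right cosets, and translates of an open set are
  open.\<close>

lemma closedin_open_subgroup:
  assumes "openin (topo G) H" "subgroup H G"
  shows "closedin (topo G) H"
proof -
  interpret H: subgroup H G by fact
  have "carrier G - H = (\<Union>a\<in>carrier G - H. H #> a)"
  proof safe
    fix x assume "x \<in> carrier G" "x \<notin> H"
    then show "x \<in> (\<Union>a\<in>carrier G - H. H #> a)"
      using rcos_self[OF _ assms(2)] by blast
  next
    fix x a assume a: "a \<in> carrier G" "a \<notin> H" "x \<in> H #> a"
    then show "x \<in> carrier G"
      using r_coset_subset_G H.subset by blast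
    assume "x \<in> H"
    obtain h where h: "h \<in> H" "x = h \<otimes> a"
      using a by (auto simp: r_coset_def)
    then have "a = inv h \<otimes> x"
      using a by (simp add: inv_solve_left)
    then have "a \<in> H"
      using h(1) \<open>x \<in> H\<close> H.m_closed[of "inv h" x] by simp
    then show False using a by simp
  qed
  moreover have "openin (topo G) (\<Union>a\<in>carrier G - H. H #> a)"
    using assms openin_r_coset by blast
  ultimately show ?thesis
    using H.subset by (simp add: closedin_def topspace_topo)
qed

text \<open>The cosets are a cover by disjoint nonempty open sets, so a finite subcover has to
  contain all of them.\<close>

lemma finite_rcosets_open_subgroup:
  assumes "compact_space (topo G)" "openin (topo G) H" "subgroup H G"
  shows "finite (rcosets H)"
proof -
  have "\<forall>U\<in>rcosets H. openin (topo G) U"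
    using assms openin_r_coset by (auto simp: RCOSETS_def)
  moreover have "\<Union>(rcosets H) = topspace (topo G)"
    using rcosets_part_G assms topspace_topo by simp
  ultimately obtain F where F: "finite F" "F \<subseteq> rcosets H" "topspace (topo G) \<subseteq> \<Union>F"
    using assms(1)[unfolded compact_space_alt, rule_format, of "rcosets H"] by auto
  have "rcosets H \<subseteq> F"
  proof
    fix C assume C: "C \<in> rcosets H"
    then obtain c where c: "c \<in> C" "c \<in> carrier G"
      using subgroup.rcosets_non_empty[OF assms(3) C] rcosets_part_G[OF assms(3)] by blast
    then obtain D where "D \<in> F" "c \<in> D"
      using F topspace_topo by blast
    then show "C \<in> F"
      using C c F rcos_disjoint[OF assms(3)] by (metis disjnt_iff pairwiseD subsetD)
  qed
  then show ?thesis
    using F finite_subset by blast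
qed

text \<open>\<open>N\<close> is the intersection of all conjugates of \<open>H\<close>. A conjugate
  depends only on the coset of the conjugating element, and there are finitely many cosets, so
  finitely many open conditions suffice.\<close>

lemma open_normal_core:
  assumes "compact_space (topo G)" "openin (topo G) H" "subgroup H G"
  shows "\<exists>N. N \<lhd> G \<and> openin (topo G) N \<and> N \<subseteq> H"
proof -
  interpret H: subgroup H G by fact
  define N where "N = {x \<in> carrier G. \<forall>g\<in>carrier G. g \<otimes> x \<otimes> inv g \<in> H}"
  have "N \<subseteq> H"
  proof
    fix x assume "x \<in> N"
    then have "\<one> \<otimes> x \<otimes> inv \<one> \<in> H" "x \<in> carrier G"
      unfolding N_def by blast+
    then show "x \<in> H" by simp
  qed
  have sub: "subgroup N G"
  proof
    show "N \<subseteq> carrier G" by (auto simp: N_def)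
    show "\<one> \<in> N" by (simp add: N_def)
    fix x assume x: "x \<in> N"
    then have xc: "x \<in> carrier G" by (simp add: N_def)
    show "inv x \<in> N"
    proof -
      have "g \<otimes> inv x \<otimes> inv g = inv (g \<otimes> x \<otimes> inv g)" if "g \<in> carrier G" for g
        using that xc by (simp add: inv_mult_group m_assoc)
      then show ?thesis using x by (simp add: N_def)
    qed
    fix y assume y: "y \<in> N"
    then have yc: "y \<in> carrier G" by (simp add: N_def)
    have "g \<otimes> (x \<otimes> y) \<otimes> inv g = (g \<otimes> x \<otimes> inv g) \<otimes> (g \<otimes> y \<otimes> inv g)" if "g \<in> carrier G" for g
      using that xc yc by (simp add: m_assoc) (simp flip: m_assoc)
    then show "x \<otimes> y \<in> N"
      using x y by (simp add: N_def)
  qed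
  have "x \<otimes> h \<otimes> inv x \<in> N" if "x \<in> carrier G" "h \<in> N" for x h
  proof -
    have "h \<in> carrier G" using that by (simp add: N_def)
    then have "g \<otimes> (x \<otimes> h \<otimes> inv x) \<otimes> inv g = (g \<otimes> x) \<otimes> h \<otimes> inv (g \<otimes> x)" if "g \<in> carrier G" for g
      using that \<open>x \<in> carrier G\<close> by (simp add: inv_mult_group m_assoc)
    then show ?thesis
      using that by (simp add: N_def)
  qed
  then have normal: "N \<lhd> G"
    using sub normal_inv_iff by blast
  have "finite (rcosets H)"
    by (rule finite_rcosets_open_subgroup) fact+
  moreover have "rcosets H = (\<lambda>a. H #> a) ` carrier G"
    by (auto simp: RCOSETS_def)
  ultimately obtain T where T: "T \<subseteq> carrier G" "finite T" "rcosets H = (\<lambda>a. H #> a) ` T"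
    using finite_subset_image[of "rcosets H" "\<lambda>a. H #> a" "carrier G"] by blast
  have "N = carrier G \<inter> (\<Inter>t\<in>T. {x \<in> topspace (topo G). t \<otimes> x \<otimes> inv t \<in> H})"
  proof (intro equalityI subsetI)
    fix x assume x: "x \<in> carrier G \<inter> (\<Inter>t\<in>T. {x \<in> topspace (topo G). t \<otimes> x \<otimes> inv t \<in> H})"
    have "g \<otimes> x \<otimes> inv g \<in> H" if g: "g \<in> carrier G" for g
    proof -
      obtain t where t: "t \<in> T" "H #> g = H #> t"
        using T(3) g rcosetsI[OF H.subset] by (metis imageE)
      then have "g \<in> H #> t"
        using rcos_self[OF g assms(3)] by simp
      then obtain h where h: "h \<in> H" "g = h \<otimes> t"
        by (auto simp: r_coset_def)
      have tc: "t \<in> carrier G" using t T by blast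
      have "g \<otimes> x \<otimes> inv g = h \<otimes> (t \<otimes> x \<otimes> inv t) \<otimes> inv h"
        using h tc x by (simp add: inv_mult_group m_assoc)
      then show ?thesis
        using h x t by simp
    qed
    then show "x \<in> N"
      using x by (simp add: N_def)
  qed (use T in \<open>auto simp: N_def topspace_topo\<close>)
  also have "\<dots> = topspace (topo G) \<inter> (\<Inter>t\<in>T. {x \<in> topspace (topo G). t \<otimes> x \<otimes> inv t \<in> H})"
    by (simp add: topspace_topo)
  also have "openin (topo G) \<dots>"
  proof -
    have "openin (topo G) {x \<in> topspace (topo G). t \<otimes> x \<otimes> inv t \<in> H}" if "t \<in> T" for t
      using assms(2) that T
      by (intro openin_continuous_map_preimage[of _ "topo G"] continuous_map_mult
        continuous_map_const_carrier continuous_map_id[unfolded id_def]) auto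
    then show ?thesis
      using T(2) by (cases "T = {}") (auto intro!: openin_Int openin_INT)
  qed
  finally show ?thesis
    using normal \<open>N \<subseteq> H\<close> by blast
qed

text \<open>Compactness makes the index of an open subgroup finite, so only powers of single
  elements remain to be checked.\<close>

lemma pro2_groupI:
  assumes "compact_space (topo G)" "Hausdorff_space (topo G)"
    and "\<And>U. openin (topo G) U \<Longrightarrow> \<one> \<in> U \<Longrightarrow> \<exists>H. subgroup H G \<and> openin (topo G) H \<and> H \<subseteq> U"
    and "\<And>N x. N \<lhd> G \<Longrightarrow> openin (topo G) N \<Longrightarrow> x \<in> carrier G \<Longrightarrow> \<exists>k. x [^] ((2::nat) ^ k) \<in> N"
  shows "pro2_group G"
proof
  fix N assume "N \<lhd> G" "openin (topo G) N"
  then show "\<exists>k. card (rcosets N) = 2 ^ k"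
    using assms(1,4) finite_rcosets_open_subgroup normal_imp_subgroup
    by (subst normal_index_two_power_iff) blast+
qed (use assms in blast)+

end

context pro2_group
begin

text \<open>\<open>H\<close> need not be normal; the index condition is applied to an open normal
  subgroup inside it.\<close>

lemma open_subgroup_two_power:
  assumes "subgroup H G" "openin (topo G) H" "x \<in> carrier G"
  shows "\<exists>k. x [^] ((2::nat) ^ k) \<in> H"
proof -
  obtain N where N: "N \<lhd> G" "openin (topo G) N" "N \<subseteq> H"
    using open_normal_core[OF compact assms(2,1)] by blast
  then show ?thesis
    using open_normal_index[OF N(1,2)] assms(3) normal_index_two_power_iff[OF N(1)] by blast
qed

lemma open_normal_base:
  assumes "openin (topo G) U" "\<one> \<in> U"
  shows "\<exists>N. N \<lhd> G \<and> openin (topo G) N \<and> N \<subseteq> U"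
  using open_subgroups_base[OF assms] open_normal_core[OF compact] by (meson order_trans)

lemma open_normal_in_normal_2power:
  "N \<lhd> G \<Longrightarrow> openin (topo G) N \<Longrightarrow> N \<in> normal_2power G"
  using open_normal_index by (auto simp: normal_2power_def)

text \<open>If \<open>x \<noteq> \<one>\<close>, the complement of \<open>x\<close> is a
  neighbourhood of \<open>\<one>\<close> and contains an open normal subgroup. Equality in a pro-2
  group can therefore be tested modulo open normal subgroups.\<close>

lemma in_all_open_normal:
  assumes "x \<in> carrier G" "\<And>N. N \<lhd> G \<Longrightarrow> openin (topo G) N \<Longrightarrow> x \<in> N"
  shows "x = \<one>"
proof (rule ccontr)
  assume "x \<noteq> \<one>"
  moreover have "closedin (topo G) {x}"
    using Hausdorff assms(1) topspace_topo closedin_Hausdorff_singleton by metis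
  then have "openin (topo G) (topspace (topo G) - {x})"
    by blast
  ultimately obtain N where "N \<lhd> G" "openin (topo G) N" "N \<subseteq> topspace (topo G) - {x}"
    using open_normal_base[of "topspace (topo G) - {x}"] by (auto simp: topspace_topo)
  then show False
    using assms(2)[of N] by blast
qed

end

text \<open>Continuity at the identity spreads by translation, and in a pro-2 target the open normal
  subgroups are a base there.\<close>

lemma continuous_homI:
  assumes "topological_group G" "pro2_group H" "f \<in> hom G H"
    and nbhd: "\<And>N. N \<lhd> H \<Longrightarrow> openin (topo H) N \<Longrightarrow>
      \<exists>V. openin (topo G) V \<and> \<one>\<^bsub>G\<^esub> \<in> V \<and> f ` V \<subseteq> N"
  shows "f \<in> continuous_hom G H"
proof -
  interpret G: topological_group G by fact
  interpret H: pro2_group H by fact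
  interpret f: group_hom G H f
    using assms(3) by unfold_locales
  have "continuous_map (topo G) (topo H) f"
    unfolding continuous_map_eq_topcontinuous_at
  proof
    fix a assume "a \<in> topspace (topo G)"
    then have a: "a \<in> carrier G" by (simp add: G.topspace_topo)
    show "topcontinuous_at (topo G) (topo H) f a"
      unfolding topcontinuous_at_def
    proof safe
      fix U assume U: "openin (topo H) U" "f a \<in> U"
      \<comment> \<open>The neighbourhood \<open>U\<close> of \<open>f a\<close> is translated back
        to the identity.\<close>
      define W where "W = {y \<in> topspace (topo H). y \<otimes>\<^bsub>H\<^esub> f a \<in> U}"
      have "openin (topo H) W"
        unfolding W_def using U a
        by (intro openin_continuous_map_preimage[of _ "topo H"] H.continuous_map_mult
            H.continuous_map_const_carrier continuous_map_id[unfolded id_def]) auto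
      moreover have "\<one>\<^bsub>H\<^esub> \<in> W"
        using U a by (simp add: W_def H.topspace_topo)
      ultimately obtain N where N: "N \<lhd> H" "openin (topo H) N" "N \<subseteq> W"
        using H.open_normal_base by blast
      obtain V where V: "openin (topo G) V" "\<one>\<^bsub>G\<^esub> \<in> V" "f ` V \<subseteq> N"
        using nbhd N by blast
      have "V \<subseteq> carrier G" using V G.openin_subset_carrier by blast
      show "\<exists>V. openin (topo G) V \<and> a \<in> V \<and> (\<forall>y\<in>V. f y \<in> U)"
      proof (intro exI conjI ballI)
        show "openin (topo G) (V #>\<^bsub>G\<^esub> a)"
          using V a G.openin_r_coset by blast
        show "a \<in> V #>\<^bsub>G\<^esub> a"
          using V(2) a by (auto simp: r_coset_def intro!: bexI[of _ "\<one>\<^bsub>G\<^esub>"])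
        fix y assume "y \<in> V #>\<^bsub>G\<^esub> a"
        then obtain v where "v \<in> V" "y = v \<otimes>\<^bsub>G\<^esub> a"
          by (auto simp: r_coset_def)
        moreover have "f v \<in> W"
          using V N \<open>v \<in> V\<close> by blast
        ultimately show "f y \<in> U"
          using a \<open>V \<subseteq> carrier G\<close> by (auto simp: W_def)
      qed
    qed (use a in \<open>auto simp: G.topspace_topo H.topspace_topo\<close>)
  qed
  then show ?thesis
    using assms(3) by (simp add: continuous_hom_def)
qed

section \<open>Inverse limits of finite 2-groups\<close>

text \<open>A basic open set of a product restricts only finitely many coordinates, so a point stays
  in \<open>U\<close> as long as it keeps the values of \<open>f\<close> at those.\<close>

lemma openin_subtopology_product_discrete:
  assumes "openin (subtopology (product_topology (\<lambda>i. discrete_topology (C i)) I) L) U" "f \<in> U"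
  shows "\<exists>J. finite J \<and> J \<subseteq> I \<and> (\<forall>g\<in>L \<inter> (\<Pi>\<^sub>E i\<in>I. C i). (\<forall>i\<in>J. g i = f i) \<longrightarrow> g \<in> U)"
proof -
  obtain V where V: "openin (product_topology (\<lambda>i. discrete_topology (C i)) I) V" "U = V \<inter> L"
    using assms(1) by (auto simp: openin_subtopology)
  then have "f \<in> V" using assms(2) by blast
  then obtain W where W: "finite {i \<in> I. W i \<noteq> C i}" "f \<in> Pi\<^sub>E I W" "Pi\<^sub>E I W \<subseteq> V"
    using V(1) unfolding openin_product_topology_alt by auto
  have "g \<in> Pi\<^sub>E I W" if "g \<in> L \<inter> (\<Pi>\<^sub>E i\<in>I. C i)" "\<forall>i\<in>{i \<in> I. W i \<noteq> C i}. g i = f i" for g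
  proof (rule PiE_I)
    fix i assume "i \<in> I"
    then show "g i \<in> W i"
      using that W(2) by (cases "W i = C i") (auto simp: PiE_iff)
  qed (use that in \<open>auto simp: PiE_iff extensional_def\<close>)
  then show ?thesis
    using W(1,3) V(2) by (intro exI[of _ "{i \<in> I. W i \<noteq> C i}"]) blast
qed

lemma openin_coordinate:
  assumes "i \<in> I"
  shows "openin (subtopology (product_topology (\<lambda>i. discrete_topology (C i)) I) L)
    {f \<in> (\<Pi>\<^sub>E i\<in>I. C i) \<inter> L. f i \<in> B}"
proof -
  have "openin (subtopology (product_topology (\<lambda>i. discrete_topology (C i)) I) L)
    {f \<in> topspace (subtopology (product_topology (\<lambda>i. discrete_topology (C i)) I) L). f i \<in> B \<inter> C i}"
    by (rule openin_continuous_map_preimage[of _ "discrete_topology (C i)"])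
      (auto intro!: continuous_map_from_subtopology continuous_map_product_projection assms)
  also have "{f \<in> topspace (subtopology (product_topology (\<lambda>i. discrete_topology (C i)) I) L). f i \<in> B \<inter> C i}
      = {f \<in> (\<Pi>\<^sub>E i\<in>I. C i) \<inter> L. f i \<in> B}"
    using assms by (auto simp: PiE_iff)
  finally show ?thesis .
qed

text \<open>The condition is pulled back from a discrete space. The compatibility conditions of an
  inverse system are intersections of such sets.\<close>

lemma closedin_coordinates:
  assumes "i \<in> I" "j \<in> I"
  shows "closedin (product_topology (\<lambda>i. discrete_topology (C i)) I) {f \<in> (\<Pi>\<^sub>E i\<in>I. C i). P (f i) (f j)}"
proof -
  let ?T = "product_topology (\<lambda>i. discrete_topology (C i)) I"
  have "continuous_map ?T (prod_topology (discrete_topology (C i)) (discrete_topology (C j))) (\<lambda>f. (f i, f j))"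
    by (intro continuous_map_pairedI continuous_map_product_projection assms)
  then have "closedin ?T {f \<in> topspace ?T. (f i, f j) \<in> {(a, b) \<in> C i \<times> C j. P a b}}"
    by (rule closedin_continuous_map_preimage) (auto simp flip: prod_topology_discrete_topology)
  also have "{f \<in> topspace ?T. (f i, f j) \<in> {(a, b) \<in> C i \<times> C j. P a b}} = {f \<in> (\<Pi>\<^sub>E i\<in>I. C i). P (f i) (f j)}"
    using assms by (auto simp: PiE_iff)
  finally show ?thesis .
qed

text \<open>This is the common shape of the pro-2 completion and of the 2-adic integers, so that
  both are treated at once.\<close>

definition product_subgroup ::
    "'i set \<Rightarrow> ('i \<Rightarrow> 'a monoid) \<Rightarrow> ('i \<Rightarrow> 'a) set \<Rightarrow> ('i \<Rightarrow> 'a) tgroup" where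
  "product_subgroup I A L = with_topology ((product_group I A)\<lparr>carrier := L\<rparr>)
     (subtopology (product_topology (\<lambda>i. discrete_topology (carrier (A i))) I) L)"

lemma product_subgroup_simps [simp]:
  "carrier (product_subgroup I A L) = L"
  "\<one>\<^bsub>product_subgroup I A L\<^esub> = (\<lambda>i\<in>I. \<one>\<^bsub>A i\<^esub>)"
  "f \<otimes>\<^bsub>product_subgroup I A L\<^esub> g = (\<lambda>i\<in>I. f i \<otimes>\<^bsub>A i\<^esub> g i)"
  "topo (product_subgroup I A L) = subtopology (product_topology (\<lambda>i. discrete_topology (carrier (A i))) I) L"
  by (simp_all add: product_subgroup_def)

text \<open>No transition maps occur: it is enough to have a closed subgroup of a product of finite
  2-groups. The compatibility conditions enter only through \<open>subgroup_limit\<close> and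
  \<open>closedin_limit\<close>.\<close>

locale limit_of_2groups =
  fixes I :: "'i set" and A :: "'i \<Rightarrow> 'a monoid" and L :: "('i \<Rightarrow> 'a) set"
  assumes group_factor: "i \<in> I \<Longrightarrow> group (A i)"
    and finite_factor: "i \<in> I \<Longrightarrow> finite (carrier (A i))"
    and two_power_factor: "i \<in> I \<Longrightarrow> x \<in> carrier (A i) \<Longrightarrow> \<exists>k. x [^]\<^bsub>A i\<^esub> ((2::nat) ^ k) = \<one>\<^bsub>A i\<^esub>"
    and subgroup_limit: "subgroup L (product_group I A)"
    and closedin_limit: "closedin (product_topology (\<lambda>i. discrete_topology (carrier (A i))) I) L"
begin

lemma limit_subset: "L \<subseteq> (\<Pi>\<^sub>E i\<in>I. carrier (A i))"
  using subgroup.subset[OF subgroup_limit] by simp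

lemma group_limit: "group (product_subgroup I A L)"
  unfolding product_subgroup_def
  by (intro group_with_topology group.subgroup_imp_group product_group subgroup_limit group_factor)

lemma coordinate_hom: "i \<in> I \<Longrightarrow> (\<lambda>f. f i) \<in> hom (product_subgroup I A L) (A i)"
  using limit_subset by (auto simp: hom_def PiE_iff)

lemma inv_limit: "f \<in> L \<Longrightarrow> inv\<^bsub>product_subgroup I A L\<^esub> f = (\<lambda>i\<in>I. inv\<^bsub>A i\<^esub> f i)"
  using group.m_inv_consistent[OF product_group subgroup_limit, of f] limit_subset group_factor
  by (auto simp: product_subgroup_def)

lemma topspace_limit: "topspace (topo (product_subgroup I A L)) = L"
  using limit_subset by auto

text \<open>Every map between discrete spaces is continuous, so the group operations are continuous
  in each coordinate.\<close>

lemma topological_group_limit: "topological_group (product_subgroup I A L)"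
proof -
  let ?G = "product_subgroup I A L"
  interpret group ?G by (rule group_limit)
  have proj: "continuous_map (topo ?G) (discrete_topology (carrier (A i))) (\<lambda>f. f i)" if "i \<in> I" for i
    using that by (auto intro!: continuous_map_from_subtopology continuous_map_product_projection)
  show ?thesis
  proof
    show "topspace (topo ?G) = carrier ?G"
      using topspace_limit by simp
    have "continuous_map (prod_topology (topo ?G) (topo ?G)) (discrete_topology (carrier (A i)))
        (\<lambda>z. fst z i \<otimes>\<^bsub>A i\<^esub> snd z i)" if "i \<in> I" for i
    proof -
      interpret Ai: group "A i" using that by (rule group_factor)
      have 1: "continuous_map (prod_topology (topo ?G) (topo ?G))
          (prod_topology (discrete_topology (carrier (A i))) (discrete_topology (carrier (A i))))
          (\<lambda>z. (fst z i, snd z i))"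
        using continuous_map_compose[OF continuous_map_fst proj[OF that]]
          continuous_map_compose[OF continuous_map_snd proj[OF that]]
        by (intro continuous_map_pairedI) (simp_all add: o_def)
      have 2: "continuous_map
          (prod_topology (discrete_topology (carrier (A i))) (discrete_topology (carrier (A i))))
          (discrete_topology (carrier (A i))) (\<lambda>(x, y). x \<otimes>\<^bsub>A i\<^esub> y)"
        by (auto simp flip: prod_topology_discrete_topology)
      show ?thesis
        using continuous_map_compose[OF 1 2] by (simp add: o_def)
    qed
    then have "continuous_map (prod_topology (topo ?G) (topo ?G))
        (product_topology (\<lambda>i. discrete_topology (carrier (A i))) I) (\<lambda>(x, y). x \<otimes>\<^bsub>?G\<^esub> y)"
      unfolding continuous_map_componentwise by (auto simp: case_prod_unfold)
    moreover have "(\<lambda>(x, y). x \<otimes>\<^bsub>?G\<^esub> y) \<in> topspace (prod_topology (topo ?G) (topo ?G)) \<rightarrow> L"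
      using topspace_limit m_closed by (simp del: product_subgroup_simps(3,4)) (auto simp del: product_subgroup_simps(3,4))
    ultimately show "continuous_map (prod_topology (topo ?G) (topo ?G)) (topo ?G) (\<lambda>(x, y). x \<otimes>\<^bsub>?G\<^esub> y)"
      by (simp only: product_subgroup_simps(4) continuous_map_in_subtopology)
    have "continuous_map (topo ?G) (discrete_topology (carrier (A i))) (\<lambda>f. inv\<^bsub>A i\<^esub> f i)" if "i \<in> I" for i
    proof -
      interpret Ai: group "A i" using that by (rule group_factor)
      have "continuous_map (discrete_topology (carrier (A i))) (discrete_topology (carrier (A i))) (\<lambda>x. inv\<^bsub>A i\<^esub> x)"
        by simp
      from continuous_map_compose[OF proj[OF that] this] show ?thesis
        by (simp add: o_def)
    qed
    then have "continuous_map (topo ?G)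
        (product_topology (\<lambda>i. discrete_topology (carrier (A i))) I) (\<lambda>f. \<lambda>i\<in>I. inv\<^bsub>A i\<^esub> f i)"
      unfolding continuous_map_componentwise by auto
    then have "continuous_map (topo ?G)
        (product_topology (\<lambda>i. discrete_topology (carrier (A i))) I) (\<lambda>f. inv\<^bsub>?G\<^esub> f)"
      by (rule continuous_map_eq) (use topspace_limit inv_limit in auto)
    moreover have "(\<lambda>f. inv\<^bsub>?G\<^esub> f) \<in> topspace (topo ?G) \<rightarrow> L"
      using topspace_limit inv_closed by (simp del: product_subgroup_simps(4))
    ultimately show "continuous_map (topo ?G) (topo ?G) (\<lambda>f. inv\<^bsub>?G\<^esub> f)"
      by (simp only: product_subgroup_simps(4) continuous_map_in_subtopology)
  qed
qed

text \<open>Compactness is Tychonoff's theorem. The subgroups \<open>K J\<close> of elements trivial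
  on a finite set \<open>J\<close> of coordinates are a base at the identity, and modulo
  \<open>K J\<close> only finitely many finite 2-groups are involved.\<close>

theorem pro2_group_limit: "pro2_group (product_subgroup I A L)"
proof -
  let ?G = "product_subgroup I A L"
  interpret topological_group ?G by (rule topological_group_limit)
  define K where "K J = {f \<in> L. \<forall>i\<in>J. f i = \<one>\<^bsub>A i\<^esub>}" for J
  have base: "\<exists>J. finite J \<and> J \<subseteq> I \<and> K J \<subseteq> U"
    if U: "openin (topo ?G) U" "\<one>\<^bsub>?G\<^esub> \<in> U" for U
  proof -
    obtain J where "finite J" "J \<subseteq> I"
      "\<forall>g\<in>L \<inter> (\<Pi>\<^sub>E i\<in>I. carrier (A i)). (\<forall>i\<in>J. g i = \<one>\<^bsub>?G\<^esub> i) \<longrightarrow> g \<in> U"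
      using openin_subtopology_product_discrete[OF U(1)[unfolded product_subgroup_simps(4)] U(2)] by metis
    moreover have "\<one>\<^bsub>?G\<^esub> i = \<one>\<^bsub>A i\<^esub>" if "i \<in> J" for i
      using that \<open>J \<subseteq> I\<close> by auto
    ultimately show ?thesis
      using limit_subset by (intro exI[of _ J]) (auto simp: K_def)
  qed
  show ?thesis
  proof (rule pro2_groupI)
    have "compact_space (product_topology (\<lambda>i. discrete_topology (carrier (A i))) I)"
      using finite_factor by (simp add: compact_space_product_topology compact_space_discrete_topology)
    then show "compact_space (topo ?G)"
      using closedin_limit closedin_compact_space compact_space_subtopology by (metis product_subgroup_simps(4))
    show "Hausdorff_space (topo ?G)"
      by (simp add: Hausdorff_space_subtopology Hausdorff_space_product_topology)
  next
    fix U assume U: "openin (topo ?G) U" "\<one>\<^bsub>?G\<^esub> \<in> U"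
    then obtain J where J: "finite J" "J \<subseteq> I" "K J \<subseteq> U"
      using base[OF U] by metis
    have "subgroup (K J) ?G"
    proof (rule subgroupI)
      show "K J \<noteq> {}"
        using one_closed J(2) by (fastforce simp: K_def)
      fix a assume a: "a \<in> K J"
      then have "inv\<^bsub>?G\<^esub> a \<in> L" using inv_closed by (simp add: K_def)
      then show "inv\<^bsub>?G\<^esub> a \<in> K J"
        using a J(2) group_factor by (auto simp: K_def inv_limit subset_iff monoid.inv_one group.is_monoid)
      fix b assume b: "b \<in> K J"
      then have "a \<otimes>\<^bsub>?G\<^esub> b \<in> L" using a m_closed by (simp add: K_def)
      then show "a \<otimes>\<^bsub>?G\<^esub> b \<in> K J"
        using a b J(2) group_factor by (auto simp: K_def subset_iff monoid.l_one monoid.one_closed group.is_monoid)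
    qed (auto simp: K_def)
    moreover have "openin (topo ?G) (K J)"
    proof -
      have "K J =
          (\<Inter>i\<in>J. {f \<in> (\<Pi>\<^sub>E i\<in>I. carrier (A i)) \<inter> L. f i \<in> {\<one>\<^bsub>A i\<^esub>}}) \<inter> topspace (topo ?G)"
        using limit_subset by (auto simp: K_def topspace_limit)
      moreover have "openin (topo ?G) \<dots>"
        unfolding product_subgroup_simps(4) using J(1,2) by (intro openin_INT openin_coordinate) auto
      ultimately show ?thesis by metis
    qed
    ultimately show "\<exists>H. subgroup H ?G \<and> openin (topo ?G) H \<and> H \<subseteq> U"
      using J(3) by blast
  next
    fix N x assume N: "N \<lhd> ?G" "openin (topo ?G) N" and x: "x \<in> carrier ?G"
    have "\<one>\<^bsub>?G\<^esub> \<in> N"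
      using N(1) normal_imp_subgroup subgroup.one_closed by blast
    then obtain J where J: "finite J" "J \<subseteq> I" "K J \<subseteq> N"
      using base[OF N(2)] by metis
    have "\<forall>i\<in>J. \<exists>k. x i [^]\<^bsub>A i\<^esub> ((2::nat) ^ k) = \<one>\<^bsub>A i\<^esub>"
      using J(2) x limit_subset two_power_factor by (auto simp: PiE_iff subset_iff)
    then obtain k where k: "\<And>i. i \<in> J \<Longrightarrow> x i [^]\<^bsub>A i\<^esub> ((2::nat) ^ k i) = \<one>\<^bsub>A i\<^esub>"
      by metis
    \<comment> \<open>One exponent for all coordinates in \<open>J\<close>; the default 0 avoids
      \<open>Max\<close> of the empty set.\<close>
    define m where "m = (if J = {} then 0 else Max (k ` J))"
    have km: "k i \<le> m" if "i \<in> J" for i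
      using that J(1) by (auto simp: m_def)
    have "(x [^]\<^bsub>?G\<^esub> ((2::nat) ^ m)) i = \<one>\<^bsub>A i\<^esub>" if "i \<in> J" for i
    proof -
      have i: "i \<in> I" using that J(2) by blast
      interpret h: group_hom ?G "A i" "\<lambda>f. f i"
        using coordinate_hom[OF i] group_factor[OF i] group_limit
        by (simp add: group_hom_def group_hom_axioms_def)
      have "(x [^]\<^bsub>?G\<^esub> ((2::nat) ^ m)) i = x i [^]\<^bsub>A i\<^esub> ((2::nat) ^ m)"
        using h.hom_nat_pow[OF x] by simp
      moreover have "x i \<in> carrier (A i)"
        using h.hom_closed[OF x] .
      ultimately show ?thesis
        using h.H.subgroup_pow_two_mono[OF h.H.triv_subgroup, of "x i" "k i" m] k[OF that] km[OF that]
        by simp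
    qed
    moreover have "x [^]\<^bsub>?G\<^esub> ((2::nat) ^ m) \<in> L"
      using nat_pow_closed[OF x] by simp
    ultimately show "\<exists>k. x [^]\<^bsub>?G\<^esub> ((2::nat) ^ k) \<in> N"
      using J(3) by (auto simp: K_def)
  qed
qed

end

section \<open>The pro-2 completion as a closed subgroup of a product\<close>

definition completion_carrier :: "('a, 'b) monoid_scheme \<Rightarrow> ('a set \<Rightarrow> 'a set) set" where
  "completion_carrier G = {f \<in> (\<Pi>\<^sub>E N\<in>normal_2power G. carrier (G Mod N)).
     \<forall>N\<in>normal_2power G. \<forall>M\<in>normal_2power G. N \<subseteq> M \<longrightarrow> f N \<subseteq> f M}"

lemma pro2_completion_eq:
  "pro2_completion G = product_subgroup (normal_2power G) (\<lambda>N. G Mod N) (completion_carrier G)"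
  by (simp add: pro2_completion_def product_subgroup_def completion_carrier_def Let_def)

lemma carrier_ModE:
  assumes "C \<in> carrier (G Mod N)"
  obtains x where "x \<in> carrier G" "C = N #>\<^bsub>G\<^esub> x"
  using assms by (auto simp: carrier_FactGroup)

text \<open>The operations of a quotient group are inversion and multiplication of sets, which
  preserve inclusion, so the condition \<open>f N \<subseteq> f M\<close> survives them. It is a
  closed condition because it involves two coordinates.\<close>

lemma limit_of_2groups_completion:
  fixes G (structure)
  assumes "group G"
  shows "limit_of_2groups (normal_2power G) (\<lambda>N. G Mod N) (completion_carrier G)"
proof -
  interpret group G by fact
  have normal: "N \<lhd> G" if "N \<in> normal_2power G" for N
    using that by (simp add: normal_2power_def)
  have grp: "group (G Mod N)" if "N \<in> normal_2power G" for N
    using normal[OF that] normal.factorgroup_is_group by blast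
  show ?thesis
  proof (rule limit_of_2groups.intro)
    fix N assume N: "N \<in> normal_2power G"
    show "group (G Mod N)" by (rule grp[OF N])
    show "finite (carrier (G Mod N))"
      using N unfolding in_normal_2power_iff by (simp add: FactGroup_def)
    show "\<exists>k. x [^]\<^bsub>G Mod N\<^esub> ((2::nat) ^ k) = \<one>\<^bsub>G Mod N\<^esub>" if "x \<in> carrier (G Mod N)" for x
    proof -
      have "\<exists>k. order (G Mod N) = 2 ^ k"
        using N by (simp add: normal_2power_def order_def FactGroup_def)
      then show ?thesis
        using order_two_power_iff[OF grp[OF N]] that by blast
    qed
  next
    have prod: "group (product_group (normal_2power G) (\<lambda>N. G Mod N))"
      using grp by simp
    show "subgroup (completion_carrier G) (product_group (normal_2power G) (\<lambda>N. G Mod N))"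
    proof (rule group.subgroupI[OF prod])
      show "completion_carrier G \<subseteq> carrier (product_group (normal_2power G) (\<lambda>N. G Mod N))"
        by (auto simp: completion_carrier_def)
      have "(\<lambda>N\<in>normal_2power G. N) \<in> completion_carrier G"
        using grp monoid.one_closed[OF group.is_monoid[OF grp]] by (auto simp: completion_carrier_def)
      then show "completion_carrier G \<noteq> {}" by blast
    next
      fix a assume a: "a \<in> completion_carrier G"
      then have aP: "a \<in> (\<Pi>\<^sub>E N\<in>normal_2power G. carrier (G Mod N))"
        by (simp add: completion_carrier_def)
      have set_inv: "inv\<^bsub>G Mod N\<^esub> a N = set_inv (a N)" if "N \<in> normal_2power G" for N
        using normal.inv_FactGroup[OF normal[OF that]] aP that by (auto simp: PiE_iff)
      have closed: "inv\<^bsub>G Mod N\<^esub> a N \<in> carrier (G Mod N)" if "N \<in> normal_2power G" for N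
        using group.inv_closed[OF grp[OF that]] aP that by (auto simp: PiE_iff)
      have "inv\<^bsub>product_group (normal_2power G) (\<lambda>N. G Mod N)\<^esub> a =
          (\<lambda>N\<in>normal_2power G. inv\<^bsub>G Mod N\<^esub> a N)"
        using aP grp by (rule inv_product_group)
      moreover have "(\<lambda>N\<in>normal_2power G. inv\<^bsub>G Mod N\<^esub> a N) \<in> completion_carrier G"
        unfolding completion_carrier_def
      proof (safe intro!: restrict_PiE[THEN iffD2] closed)
        fix N M x assume N: "N \<in> normal_2power G" and M: "M \<in> normal_2power G" and "N \<subseteq> M"
          and x: "x \<in> (\<lambda>N\<in>normal_2power G. inv\<^bsub>G Mod N\<^esub> a N) N"
        have "a N \<subseteq> a M"
          using a N M \<open>N \<subseteq> M\<close> by (simp add: completion_carrier_def)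
        then have "set_inv (a N) \<subseteq> set_inv (a M)"
          by (auto simp: SET_INV_def)
        then show "x \<in> (\<lambda>N\<in>normal_2power G. inv\<^bsub>G Mod N\<^esub> a N) M"
          using x N M set_inv by auto
      qed
      ultimately show "inv\<^bsub>product_group (normal_2power G) (\<lambda>N. G Mod N)\<^esub> a \<in> completion_carrier G"
        by simp
      fix b assume b: "b \<in> completion_carrier G"
      then have bP: "b \<in> (\<Pi>\<^sub>E N\<in>normal_2power G. carrier (G Mod N))"
        by (simp add: completion_carrier_def)
      have "a N <#> b N \<in> carrier (G Mod N)" if "N \<in> normal_2power G" for N
        using monoid.m_closed[OF group.is_monoid[OF grp[OF that]]] aP bP that by (auto simp: PiE_iff)
      moreover have "a N <#> b N \<subseteq> a M <#> b M"
        if "N \<in> normal_2power G" "M \<in> normal_2power G" "N \<subseteq> M" for N M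
        using that a b by (intro mono_set_mult) (simp_all add: completion_carrier_def)
      ultimately show "a \<otimes>\<^bsub>product_group (normal_2power G) (\<lambda>N. G Mod N)\<^esub> b \<in> completion_carrier G"
        by (simp add: completion_carrier_def)
    qed
  next
    let ?T = "product_topology (\<lambda>N. discrete_topology (carrier (G Mod N))) (normal_2power G)"
    let ?I = "normal_2power G"
    show "closedin ?T (completion_carrier G)"
    \<comment> \<open>An intersection over no pairs would be the whole type instead of the product
      space.\<close>
    proof (cases "?I = {}")
      case True
      then have "completion_carrier G = topspace ?T"
        by (auto simp: completion_carrier_def)
      then show ?thesis
        by (metis closedin_topspace)
    next
      case False
      then have "completion_carrier G = (\<Inter>p \<in> ?I \<times> ?I.
          {f \<in> (\<Pi>\<^sub>E N\<in>?I. carrier (G Mod N)). fst p \<subseteq> snd p \<longrightarrow> f (fst p) \<subseteq> f (snd p)})"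
        unfolding completion_carrier_def by auto (metis subsetD)+
      moreover have "closedin ?T \<dots>"
        using False by (intro closedin_INT closedin_coordinates) auto
      ultimately show ?thesis by metis
    qed
  qed
qed

lemma pro2_group_pro2_completion: "group G \<Longrightarrow> pro2_group (pro2_completion G)"
  unfolding pro2_completion_eq by (intro limit_of_2groups.pro2_group_limit limit_of_2groups_completion)

section \<open>The 2-adic integers and \<Delta> as pro-2 groups\<close>

definition Z2_carrier :: "(nat \<Rightarrow> int) set" where
  "Z2_carrier = {a \<in> (\<Pi>\<^sub>E k\<in>UNIV. carrier (integer_mod_group (2 ^ k))). \<forall>k. a (Suc k) mod 2 ^ k = a k}"

lemma Z2_eq: "Z2 = product_subgroup UNIV (\<lambda>k. integer_mod_group (2 ^ k)) Z2_carrier"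
  by (simp add: Z2_def product_subgroup_def Z2_carrier_def Let_def)

lemma carrier_integer_mod_2power: "carrier (integer_mod_group (2 ^ k)) = {0..<2 ^ k}"
  by (simp add: carrier_integer_mod_group)

lemma Z2_carrier_iff:
  "a \<in> Z2_carrier \<longleftrightarrow> (\<forall>k. a k \<in> {0..<2 ^ k}) \<and> (\<forall>k. a (Suc k) mod 2 ^ k = a k)"
  by (auto simp: Z2_carrier_def carrier_integer_mod_2power PiE_iff)

lemma mod_2power_mod: "(x :: int) mod 2 ^ Suc k mod 2 ^ k = x mod 2 ^ k"
  by (rule mod_mod_cancel) (simp add: le_imp_power_dvd)

text \<open>Negation and addition commute with reduction modulo 2^k, so they preserve compatible
  sequences.\<close>

lemma limit_of_2groups_Z2: "limit_of_2groups UNIV (\<lambda>k. integer_mod_group (2 ^ k)) Z2_carrier"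
proof (rule limit_of_2groups.intro)
  fix k :: nat
  show "\<exists>j. x [^]\<^bsub>integer_mod_group (2 ^ k)\<^esub> ((2::nat) ^ j) = \<one>\<^bsub>integer_mod_group (2 ^ k)\<^esub>" for x
    by (intro exI[of _ k]) simp
next
  let ?P = "product_group UNIV (\<lambda>k. integer_mod_group (2 ^ k))"
  show "subgroup Z2_carrier ?P"
  proof (rule group.subgroupI)
    show "Z2_carrier \<subseteq> carrier ?P"
      by (auto simp: Z2_carrier_def)
    have "(\<lambda>k. 0) \<in> Z2_carrier"
      by (simp add: Z2_carrier_iff)
    then show "Z2_carrier \<noteq> {}" by blast
    fix a assume a: "a \<in> Z2_carrier"
    then have aP: "a \<in> (\<Pi>\<^sub>E k\<in>UNIV. carrier (integer_mod_group (2 ^ k)))"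
      by (simp add: Z2_carrier_def)
    have "(- a (Suc k)) mod 2 ^ Suc k mod 2 ^ k = (- a k) mod 2 ^ k" for k
      using a unfolding mod_2power_mod by (metis Z2_carrier_iff mod_minus_eq)
    then show "inv\<^bsub>?P\<^esub> a \<in> Z2_carrier"
      using aP by (subst inv_product_group) (auto simp: Z2_carrier_iff PiE_iff)
    fix b assume b: "b \<in> Z2_carrier"
    have "(a (Suc k) + b (Suc k)) mod 2 ^ Suc k mod 2 ^ k = (a k + b k) mod 2 ^ k" for k
      using a b unfolding mod_2power_mod by (metis Z2_carrier_iff mod_add_eq)
    then show "a \<otimes>\<^bsub>?P\<^esub> b \<in> Z2_carrier"
      by (auto simp: Z2_carrier_iff)
  qed simp
  let ?T = "product_topology (\<lambda>k. discrete_topology (carrier (integer_mod_group (2 ^ k)))) (UNIV :: nat set)"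
  have "Z2_carrier = (\<Inter>k. {a \<in> (\<Pi>\<^sub>E k\<in>UNIV. carrier (integer_mod_group (2 ^ k))). a (Suc k) mod 2 ^ k = a k})"
    by (auto simp: Z2_carrier_def)
  moreover have "closedin ?T \<dots>"
    by (intro closedin_INT closedin_coordinates) auto
  ultimately show "closedin ?T Z2_carrier" by metis
qed (simp_all add: carrier_integer_mod_2power)

lemma pro2_group_Z2: "pro2_group Z2"
  unfolding Z2_eq by (rule limit_of_2groups.pro2_group_limit[OF limit_of_2groups_Z2])

lemma carrier_Delta: "carrier Delta = {0, 1}"
  by (auto simp: Delta_def carrier_integer_mod_group)

lemma Delta_simps [simp]:
  "\<one>\<^bsub>Delta\<^esub> = 0" "s \<otimes>\<^bsub>Delta\<^esub> t = (s + t) mod 2"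
  "topo Delta = discrete_topology {0, 1}"
  using carrier_Delta by (auto simp: Delta_def)

lemma pro2_group_Delta: "pro2_group Delta"
proof -
  interpret group Delta
    by (simp add: Delta_def group_with_topology)
  interpret topological_group Delta
  proof
    have "s \<otimes>\<^bsub>Delta\<^esub> t \<in> {0, 1}" if "s \<in> {0, 1}" "t \<in> {0, 1}" for s t
      using that by auto
    then show "continuous_map (prod_topology (topo Delta) (topo Delta)) (topo Delta) (\<lambda>(x, y). x \<otimes>\<^bsub>Delta\<^esub> y)"
      by (auto simp flip: prod_topology_discrete_topology)
    show "continuous_map (topo Delta) (topo Delta) (\<lambda>x. inv\<^bsub>Delta\<^esub> x)"
      using inv_closed by (auto simp: carrier_Delta)
  qed (simp add: carrier_Delta)
  show ?thesis
  proof (rule pro2_groupI)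
    fix N x assume "N \<lhd> Delta" "x \<in> carrier Delta"
    moreover from this have "x [^]\<^bsub>Delta\<^esub> ((2::nat) ^ 1) = \<one>\<^bsub>Delta\<^esub>"
      by (auto simp: carrier_Delta numeral_2_eq_2)
    ultimately show "\<exists>k. x [^]\<^bsub>Delta\<^esub> ((2::nat) ^ k) \<in> N"
      by (metis normal_imp_subgroup subgroup.one_closed)
  next
    fix U assume "openin (topo Delta) U" "\<one>\<^bsub>Delta\<^esub> \<in> U"
    then show "\<exists>H. subgroup H Delta \<and> openin (topo Delta) H \<and> H \<subseteq> U"
      using triv_subgroup by (intro exI[of _ "{\<one>\<^bsub>Delta\<^esub>}"]) auto
  qed (simp_all add: compact_space_discrete_topology)
qed

lemma (in group_hom) subgroup_vimage:
  assumes "subgroup K H"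
  shows "subgroup {x \<in> carrier G. h x \<in> K} G"
  using assms by (intro G.subgroupI) (auto simp: subgroup.one_closed subgroup.m_closed subgroup.m_inv_closed)

lemma (in group_hom) normal_vimage:
  assumes "K \<lhd> H"
  shows "{x \<in> carrier G. h x \<in> K} \<lhd> G"
  using assms subgroup_vimage[of K] unfolding G.normal_inv_iff H.normal_inv_iff by auto

text \<open>The diagonal is the preimage of the identity under the continuous map taking
  \<open>(x, y)\<close> to \<open>inv x \<otimes> y\<close>.\<close>

lemma (in topological_group) Hausdorff_if_closed_one:
  assumes "closedin (topo G) {\<one>}"
  shows "Hausdorff_space (topo G)"
proof -
  let ?P = "prod_topology (topo G) (topo G)"
  have "continuous_map ?P (topo G) (\<lambda>z. inv fst z \<otimes> snd z)"
    by (intro continuous_map_mult continuous_map_m_inv continuous_map_fst continuous_map_snd)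
  then have "closedin ?P {z \<in> topspace ?P. inv fst z \<otimes> snd z \<in> {\<one>}}"
    using assms by (rule closedin_continuous_map_preimage)
  also have "{z \<in> topspace ?P. inv fst z \<otimes> snd z \<in> {\<one>}} = (\<lambda>x. (x, x)) ` topspace (topo G)"
  proof -
    have "inv x \<otimes> y = \<one> \<longleftrightarrow> y = x" if "x \<in> carrier G" "y \<in> carrier G" for x y
      using that by (metis inv_closed inv_equality inv_inv l_inv)
    then show ?thesis
      by (auto simp: topspace_topo)
  qed
  finally show ?thesis
    by (simp add: Hausdorff_space_closedin_diagonal)
qed

section \<open>Quotients of pro-2 groups\<close>

lemma quotient_tgroup_simps [simp]:
  "carrier (quotient_tgroup G N) = rcosets\<^bsub>G\<^esub> N"
  "monoid.mult (quotient_tgroup G N) = (<#>\<^bsub>G\<^esub>)"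
  "\<one>\<^bsub>quotient_tgroup G N\<^esub> = N"
  by (simp_all add: quotient_tgroup_def FactGroup_def)

locale pro2_quotient = pro2_group +
  fixes N
  assumes normal: "N \<lhd> G" and closed: "closedin (topo G) N"
begin

sublocale N: normal N G by (rule normal)

abbreviation "Q \<equiv> quotient_tgroup G N"

sublocale Q: group Q
  unfolding quotient_tgroup_def by (intro group_with_topology N.factorgroup_is_group)

lemma openin_quotient:
  "openin (topo Q) U \<longleftrightarrow> U \<subseteq> rcosets N \<and> openin (topo G) {x \<in> carrier G. N #> x \<in> U}"
  unfolding quotient_tgroup_def
  using topology_inverse'[OF istopology_quotient[of "rcosets N" "topo G" "\<lambda>x. N #> x"]]
  by (simp add: topspace_topo)

lemma topspace_quotient: "topspace (topo Q) = rcosets N"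
proof -
  have "{x \<in> carrier G. N #> x \<in> rcosets N} = topspace (topo G)"
    by (auto simp: RCOSETS_def topspace_topo)
  then have "openin (topo Q) (rcosets N)"
    unfolding openin_quotient by simp
  then show ?thesis
    unfolding topspace_def using openin_quotient by blast
qed

lemma proj_hom: "group_hom G Q (\<lambda>x. N #> x)"
  by unfold_locales (auto simp: hom_def RCOSETS_def N.rcos_sum)

sublocale q: group_hom G Q "\<lambda>x. N #> x"
  by (rule proj_hom)

lemma rcosetsE:
  assumes "C \<in> rcosets N"
  obtains x where "x \<in> carrier G" "C = N #> x"
  using assms by (auto simp: RCOSETS_def)

lemma proj_continuous: "continuous_map (topo G) (topo Q) (\<lambda>x. N #> x)"
  using openin_quotient q.hom_closed
  by (auto simp: continuous_map topspace_quotient topspace_topo)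

text \<open>The preimage of the image of \<open>U\<close> is the union of the translates of
  \<open>U\<close> by elements of \<open>N\<close>, hence open.\<close>

lemma open_map_proj:
  assumes "openin (topo G) U"
  shows "openin (topo Q) ((\<lambda>x. N #> x) ` U)"
proof -
  have "{x \<in> carrier G. N #> x \<in> (\<lambda>x. N #> x) ` U} = (\<Union>n\<in>N. {x \<in> topspace (topo G). n \<otimes> x \<in> U})"
  proof (intro equalityI subsetI)
    fix x assume x: "x \<in> {x \<in> carrier G. N #> x \<in> (\<lambda>x. N #> x) ` U}"
    then obtain u where u: "u \<in> U" "N #> x = N #> u"
      by auto
    then have "u \<in> N #> x"
      using rcos_self[OF _ N.subgroup_axioms] openin_subset_carrier[OF assms] by auto
    then show "x \<in> (\<Union>n\<in>N. {x \<in> topspace (topo G). n \<otimes> x \<in> U})"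
      using u(1) x by (auto simp: r_coset_def topspace_topo)
  next
    fix x assume "x \<in> (\<Union>n\<in>N. {x \<in> topspace (topo G). n \<otimes> x \<in> U})"
    then obtain n where n: "n \<in> N" "x \<in> carrier G" "n \<otimes> x \<in> U"
      by (auto simp: topspace_topo)
    then have "N #> x = N #> (n \<otimes> x)"
      by (metis N.mem_carrier N.rcos_const N.subset coset_mult_assoc group_axioms)
    then show "x \<in> {x \<in> carrier G. N #> x \<in> (\<lambda>x. N #> x) ` U}"
      using n(2,3) by blast
  qed
  moreover have "openin (topo G) {x \<in> topspace (topo G). n \<otimes> x \<in> U}" if "n \<in> N" for n
    using assms that N.subset
    by (intro openin_continuous_map_preimage[of _ "topo G"] continuous_map_mult
        continuous_map_const_carrier continuous_map_id[unfolded id_def]) auto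
  ultimately show ?thesis
    unfolding openin_quotient using openin_subset_carrier[OF assms] by (auto simp: RCOSETS_def)
qed

sublocale Q: topological_group Q
proof
  show "topspace (topo Q) = carrier Q"
    by (simp add: topspace_quotient)
  show "continuous_map (prod_topology (topo Q) (topo Q)) (topo Q) (\<lambda>(x, y). x \<otimes>\<^bsub>Q\<^esub> y)"
    unfolding continuous_map
  proof (intro conjI allI impI)
    show "(\<lambda>(x, y). x \<otimes>\<^bsub>Q\<^esub> y) ` topspace (prod_topology (topo Q) (topo Q)) \<subseteq> topspace (topo Q)"
      using Q.m_closed by (auto simp: topspace_quotient)
    fix U assume U: "openin (topo Q) U"
    show "openin (prod_topology (topo Q) (topo Q))
        {z \<in> topspace (prod_topology (topo Q) (topo Q)). (case z of (x, y) \<Rightarrow> x \<otimes>\<^bsub>Q\<^esub> y) \<in> U}" (is "openin _ ?S")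
      \<comment> \<open>A product of quotient maps need not be a quotient map. Here a product
        neighbourhood in \<open>G\<close> is pushed down, which the openness of the projection
        allows.\<close>
      unfolding openin_prod_topology_alt
    proof (intro allI impI)
      fix A B assume AB: "(A, B) \<in> ?S"
      then obtain a b where a: "a \<in> carrier G" "A = N #> a" and b: "b \<in> carrier G" "B = N #> b"
        by (auto simp: topspace_quotient elim!: rcosetsE)
      let ?P = "{z \<in> topspace (prod_topology (topo G) (topo G)). N #> (fst z \<otimes> snd z) \<in> U}"
      have "continuous_map (prod_topology (topo G) (topo G)) (topo Q) (\<lambda>z. N #> (fst z \<otimes> snd z))"
        using continuous_map_compose[OF continuous_mult proj_continuous] by (simp add: o_def case_prod_unfold)
      then have "openin (prod_topology (topo G) (topo G)) ?P"
        using U by (rule openin_continuous_map_preimage)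
      moreover have "(a, b) \<in> ?P"
      proof -
        have "A <#> B \<in> U" using AB by simp
        then show ?thesis
          using a b by (simp add: topspace_topo)
      qed
      ultimately obtain V W where VW: "openin (topo G) V" "openin (topo G) W" "a \<in> V" "b \<in> W" "V \<times> W \<subseteq> ?P"
        unfolding openin_prod_topology_alt by meson
      have VWc: "V \<subseteq> carrier G" "W \<subseteq> carrier G"
        using VW openin_subset_carrier by auto
      have "(\<lambda>x. N #> x) ` V \<times> (\<lambda>x. N #> x) ` W \<subseteq> ?S"
      proof
        fix p assume "p \<in> (\<lambda>x. N #> x) ` V \<times> (\<lambda>x. N #> x) ` W"
        then obtain v w where vw: "v \<in> V" "w \<in> W" "p = (N #> v, N #> w)"
          by auto
        then have "(v, w) \<in> ?P" using VW(5) by blast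
        then have "(N #> v) <#> (N #> w) \<in> U"
          using vw VWc by (simp add: subset_iff)
        moreover have "N #> v \<in> rcosets N" "N #> w \<in> rcosets N"
          using vw VWc by (auto simp: RCOSETS_def)
        ultimately show "p \<in> ?S"
          using vw(3) by (simp add: topspace_quotient)
      qed
      then show "\<exists>V W. openin (topo Q) V \<and> openin (topo Q) W \<and> A \<in> V \<and> B \<in> W \<and> V \<times> W \<subseteq> ?S"
        using open_map_proj[OF VW(1)] open_map_proj[OF VW(2)] VW(3,4) a b by blast
    qed
  qed
  show "continuous_map (topo Q) (topo Q) (\<lambda>x. inv\<^bsub>Q\<^esub> x)"
    unfolding continuous_map
  proof (intro conjI allI impI)
    show "(\<lambda>x. inv\<^bsub>Q\<^esub> x) ` topspace (topo Q) \<subseteq> topspace (topo Q)"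
      using Q.inv_closed by (auto simp: topspace_quotient)
    fix U assume U: "openin (topo Q) U"
    have "{x \<in> carrier G. N #> x \<in> {y \<in> topspace (topo Q). inv\<^bsub>Q\<^esub> y \<in> U}} =
        {x \<in> topspace (topo G). N #> (inv x) \<in> U}"
      using q.hom_closed q.hom_inv by (auto simp: topspace_quotient topspace_topo)
    moreover have "openin (topo G) \<dots>"
      using continuous_map_compose[OF continuous_inv proj_continuous] U
      by (intro openin_continuous_map_preimage[of _ "topo Q"]) (auto simp: o_def)
    ultimately show "openin (topo Q) {y \<in> topspace (topo Q). inv\<^bsub>Q\<^esub> y \<in> U}"
      unfolding openin_quotient[of "{y \<in> topspace (topo Q). inv\<^bsub>Q\<^esub> y \<in> U}"] by (auto simp: topspace_quotient)
  qed
qed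

text \<open>Compactness, the base of open subgroups and the 2-powers pass along the open continuous
  projection. Closedness of \<open>N\<close> gives the Hausdorff property: it makes the identity of
  the quotient a closed point.\<close>

lemma pro2_group_quotient: "pro2_group Q"
proof (rule Q.pro2_groupI)
  have "(\<lambda>x. N #> x) ` topspace (topo G) = topspace (topo Q)"
    by (auto simp: topspace_topo topspace_quotient RCOSETS_def)
  then show "compact_space (topo Q)"
    using image_compactin[OF _ proj_continuous] compact by (metis compact_space_def)
  have "{x \<in> carrier G. N #> x \<in> rcosets N - {N}} = topspace (topo G) - N"
  proof -
    have "N #> x = N \<longleftrightarrow> x \<in> N" if "x \<in> carrier G" for x
      using that coset_join1 coset_join2 N.subgroup_axioms by blast
    then show ?thesis
      using q.hom_closed by (auto simp: topspace_topo)
  qed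
  then have "openin (topo Q) (rcosets N - {N})"
    unfolding openin_quotient using closed by (auto simp: closedin_def)
  then have "closedin (topo Q) {\<one>\<^bsub>Q\<^esub>}"
    using Q.one_closed by (auto simp: closedin_def topspace_quotient)
  then show "Hausdorff_space (topo Q)"
    by (rule Q.Hausdorff_if_closed_one)
next
  fix U assume U: "openin (topo Q) U" "\<one>\<^bsub>Q\<^esub> \<in> U"
  then have "openin (topo G) {x \<in> carrier G. N #> x \<in> U}" "\<one> \<in> {x \<in> carrier G. N #> x \<in> U}"
    by (auto simp: openin_quotient N.subset)
  then obtain H where H: "subgroup H G" "openin (topo G) H" "H \<subseteq> {x \<in> carrier G. N #> x \<in> U}"
    using open_subgroups_base by blast
  then show "\<exists>H. subgroup H Q \<and> openin (topo Q) H \<and> H \<subseteq> U"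
    using open_map_proj q.subgroup_img_is_subgroup[OF H(1)]
    by (intro exI[of _ "(\<lambda>x. N #> x) ` H"]) auto
next
  fix M C assume M: "M \<lhd> Q" "openin (topo Q) M" and "C \<in> carrier Q"
  then obtain x where x: "x \<in> carrier G" "C = N #> x"
    by (auto elim: rcosetsE)
  have "subgroup {x \<in> carrier G. N #> x \<in> M} G"
    using q.subgroup_vimage M(1) normal_imp_subgroup by blast
  moreover have "openin (topo G) {x \<in> carrier G. N #> x \<in> M}"
    using M(2) by (simp add: openin_quotient)
  ultimately obtain k where "x [^] ((2::nat) ^ k) \<in> {x \<in> carrier G. N #> x \<in> M}"
    using open_subgroup_two_power x(1) by blast
  then have "C [^]\<^bsub>Q\<^esub> ((2::nat) ^ k) \<in> M"
    using x q.hom_nat_pow by auto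
  then show "\<exists>k. C [^]\<^bsub>Q\<^esub> ((2::nat) ^ k) \<in> M" ..
qed

text \<open>The factorization \<open>g\<close> exists by the universal property of
  \<open>G Mod N\<close>. It is continuous because the quotient topology tests openness on preimages
  in \<open>G\<close>, where \<open>g\<close> becomes \<open>f\<close>.\<close>

lemma quotient_universal:
  assumes "f \<in> continuous_hom G H" "group H" "\<And>x. x \<in> N \<Longrightarrow> f x = \<one>\<^bsub>H\<^esub>"
  shows "\<exists>g\<in>continuous_hom Q H. \<forall>x\<in>carrier G. g (N #> x) = f x"
proof -
  interpret f: group_hom G H f
    using assms(1,2) by (simp add: group_hom_def group_hom_axioms_def continuous_hom_def)
  have "f x = f y" if "x \<in> carrier G" "y \<in> carrier G" "N #> x = N #> y" for x y
  proof -
    have "x \<in> N #> y"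
      using that rcos_self[OF _ N.subgroup_axioms] by blast
    then obtain n where "n \<in> N" "x = n \<otimes> y"
      by (auto simp: r_coset_def)
    then show ?thesis
      using that assms(3) by simp
  qed
  then obtain g where g: "g \<in> hom (G Mod N) H" "\<And>x. x \<in> carrier G \<Longrightarrow> g (N #> x) = f x"
    using FactGroup_universal[OF f.homh normal] by metis
  have "continuous_map (topo Q) (topo H) g"
    unfolding continuous_map
  proof (intro conjI allI impI)
    have cf: "continuous_map (topo G) (topo H) f"
      using assms(1) by (simp add: continuous_hom_def)
    then show "g ` topspace (topo Q) \<subseteq> topspace (topo H)"
      using g(2) by (auto simp: topspace_quotient topspace_topo continuous_map elim!: rcosetsE)
    fix U assume "openin (topo H) U"
    then have "openin (topo G) {x \<in> topspace (topo G). f x \<in> U}"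
      using cf by (simp add: continuous_map)
    also have "{x \<in> topspace (topo G). f x \<in> U} = {x \<in> carrier G. N #> x \<in> {y \<in> topspace (topo Q). g y \<in> U}}"
      using g(2) q.hom_closed by (auto simp: topspace_quotient topspace_topo)
    finally show "openin (topo Q) {y \<in> topspace (topo Q). g y \<in> U}"
      unfolding openin_quotient[of "{y \<in> topspace (topo Q). g y \<in> U}"] by (auto simp: topspace_quotient)
  qed
  moreover have "g \<in> hom Q H"
    using g(1) by (simp add: quotient_tgroup_def hom_def)
  ultimately show ?thesis
    using g(2) by (auto simp: continuous_hom_def)
qed

end

lemma closed_normal_closure_subset:
  "N \<lhd> G \<Longrightarrow> closedin (topo G) N \<Longrightarrow> R \<subseteq> N \<Longrightarrow> closed_normal_closure G R \<subseteq> N"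
  by (auto simp: closed_normal_closure_def)

lemma closed_normal_closure_supset: "R \<subseteq> closed_normal_closure G R"
  by (auto simp: closed_normal_closure_def)

lemma (in topological_group) closed_normal_closure:
  assumes "R \<subseteq> carrier G"
  shows "closed_normal_closure G R \<lhd> G" "closedin (topo G) (closed_normal_closure G R)"
proof -
  let ?F = "{N. N \<lhd> G \<and> closedin (topo G) N \<and> R \<subseteq> N}"
  have "carrier G \<lhd> G"
    unfolding normal_inv_iff using subgroup_self by auto
  moreover have "closedin (topo G) (carrier G)"
    using topspace_topo closedin_topspace by metis
  \<comment> \<open>The whole group belongs to the family; the intersection of an empty family would
    be the whole type.\<close>
  ultimately have ne: "carrier G \<in> ?F"
    using assms by blast
  have "subgroup (\<Inter>?F) G"
    using ne by (intro subgroups_Inter) (auto dest: normal_imp_subgroup)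
  moreover have "x \<otimes> h \<otimes> inv x \<in> \<Inter>?F" if "x \<in> carrier G" "h \<in> \<Inter>?F" for x h
    using that by (auto simp: normal_inv_iff)
  ultimately show "closed_normal_closure G R \<lhd> G"
    unfolding closed_normal_closure_def normal_inv_iff by blast
  show "closedin (topo G) (closed_normal_closure G R)"
    unfolding closed_normal_closure_def using ne by (intro closedin_Inter) auto
qed

section \<open>Free groups and the pro-2 completion\<close>

abbreviation reduced :: "word \<Rightarrow> bool" where
  "reduced \<equiv> successively (\<lambda>a b. b \<noteq> opp a)"

lemma opp_opp [simp]: "opp (opp a) = a"
  by (cases a) simp

lemma fst_opp [simp]: "fst (opp a) = fst a"
  by (cases a) simp

lemma opp_eq_iff: "opp a = b \<longleftrightarrow> a = opp b"
  by auto

lemma reduced_cancel_cons: "reduced w \<Longrightarrow> reduced (cancel_cons a w)"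
  by (cases w rule: remdups_adj.cases) auto

lemma set_cancel_cons: "set (cancel_cons a w) \<subseteq> insert a (set w)"
  by (cases w) auto

lemma cancel_cons_reduced: "reduced (a # w) \<Longrightarrow> cancel_cons a w = a # w"
  by (cases w) auto

text \<open>A letter acts on reduced words by prepending and cancelling, and the opposite letter
  acts as its inverse. As in van der Waerden's argument, a product is the action of the letters of
  the first word on the second, and associativity follows without comparing orders of
  cancellation.\<close>

lemma cancel_cons_opp: "reduced w \<Longrightarrow> cancel_cons a (cancel_cons (opp a) w) = w"
  by (cases w) (auto simp: cancel_cons_reduced)

lemma reduced_foldr: "reduced w \<Longrightarrow> reduced (foldr cancel_cons u w)"
  by (induction u) (auto intro: reduced_cancel_cons)

lemma set_foldr_cancel_cons: "set (foldr cancel_cons u w) \<subseteq> set u \<union> set w"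
  by (induction u) (use set_cancel_cons in fastforce)+

lemma fst_set_foldr_cancel_cons:
  "fst ` set u \<subseteq> A \<Longrightarrow> fst ` set v \<subseteq> A \<Longrightarrow> fst ` set (foldr cancel_cons u v) \<subseteq> A"
  using set_foldr_cancel_cons[of u v] by blast

text \<open>A cancellation in the acting word removes a letter followed by its opposite, whose
  composite acts as the identity.\<close>

lemma foldr_cancel_cons_cancel_cons:
  "reduced w \<Longrightarrow> foldr cancel_cons (cancel_cons a v) w = cancel_cons a (foldr cancel_cons v w)"
  by (cases v) (auto simp: cancel_cons_opp reduced_foldr)

lemma foldr_cancel_cons_assoc:
  "reduced w \<Longrightarrow> foldr cancel_cons (foldr cancel_cons u v) w = foldr cancel_cons u (foldr cancel_cons v w)"
  by (induction u) (auto simp: foldr_cancel_cons_cancel_cons)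

lemma foldr_cancel_cons_inverse: "foldr cancel_cons (map opp (rev w)) w = []"
  by (induction w) auto

lemma reduced_inverse: "reduced w \<Longrightarrow> reduced (map opp (rev w))"
  unfolding successively_map successively_rev by (auto elim: successively_mono simp: opp_eq_iff)

lemma free_group_simps [simp]:
  "carrier (free_group d) = {w. fst ` set w \<subseteq> {1..d} \<and> reduced w}"
  "u \<otimes>\<^bsub>free_group d\<^esub> v = foldr cancel_cons u v"
  "\<one>\<^bsub>free_group d\<^esub> = []"
  by (simp_all add: free_group_def)

lemma group_free_group: "group (free_group d)"
proof (rule groupI)
  fix u v assume "u \<in> carrier (free_group d)" "v \<in> carrier (free_group d)"
  then show "u \<otimes>\<^bsub>free_group d\<^esub> v \<in> carrier (free_group d)"
    using fst_set_foldr_cancel_cons[of u _ v] by (simp add: reduced_foldr)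
next
  fix w assume w: "w \<in> carrier (free_group d)"
  then have "map opp (rev w) \<in> carrier (free_group d)"
    by (simp add: reduced_inverse image_image)
  moreover have "map opp (rev w) \<otimes>\<^bsub>free_group d\<^esub> w = \<one>\<^bsub>free_group d\<^esub>"
    by (simp only: free_group_simps foldr_cancel_cons_inverse)
  ultimately show "\<exists>u\<in>carrier (free_group d). u \<otimes>\<^bsub>free_group d\<^esub> w = \<one>\<^bsub>free_group d\<^esub>"
    by blast
qed (auto simp: foldr_cancel_cons_assoc)

lemma inv_free_group_gen:
  assumes "i \<in> {1..d}"
  shows "inv\<^bsub>free_group d\<^esub> [(i, True)] = [(i, False)]"
  using assms by (intro group.inv_equality group_free_group) auto

lemma free_group_generated:
  assumes S: "subgroup S (free_group d)" and gen: "\<And>i. i \<in> {1..d} \<Longrightarrow> [(i, True)] \<in> S"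
    and w: "w \<in> carrier (free_group d)"
  shows "w \<in> S"
  using w
proof (induction w)
  case Nil
  then show ?case using subgroup.one_closed[OF S] by simp
next
  case (Cons a w)
  then have w: "w \<in> carrier (free_group d)"
    by (cases w) auto
  obtain i b where a: "a = (i, b)" "i \<in> {1..d}"
    using Cons.prems by (cases a) auto
  have "[a] \<in> S"
    using gen[OF a(2)] subgroup.m_inv_closed[OF S gen[OF a(2)]] a inv_free_group_gen[OF a(2)] by (cases b) auto
  moreover have "[a] \<otimes>\<^bsub>free_group d\<^esub> w = a # w"
    using Cons.prems by (simp add: cancel_cons_reduced)
  ultimately show ?case
    using Cons.IH[OF w] subgroup.m_closed[OF S] by metis
qed

text \<open>The product of the images of the letters makes sense for every word, and a cancellation
  does not change it, since opposite letters have inverse images. Multiplicativity is therefore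
  proved for all words over \<open>{1..d}\<close>.\<close>

lemma free_group_hom:
  fixes Q (structure)
  assumes "group Q" and q: "q \<in> {1..d} \<rightarrow> carrier Q"
  shows "\<exists>h\<in>hom (free_group d) Q. \<forall>i\<in>{1..d}. h [(i, True)] = q i"
proof -
  interpret group Q by fact
  define letter where "letter = (\<lambda>(i, b). if b then q i else inv q i)"
  define h where "h = (\<lambda>w. foldr (\<lambda>a x. letter a \<otimes> x) w \<one>)"
  have letter: "letter a \<in> carrier Q" if "fst a \<in> {1..d}" for a
    using q that by (cases a) (auto simp: letter_def)
  have h: "h w \<in> carrier Q" if "fst ` set w \<subseteq> {1..d}" for w
    using that by (induction w) (auto simp: h_def letter)
  have opp: "letter a \<otimes> letter (opp a) = \<one>" if "fst a \<in> {1..d}" for a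
    using q that by (cases a) (auto simp: letter_def Pi_iff)
  have cancel: "h (cancel_cons a w) = letter a \<otimes> h w" if "fst a \<in> {1..d}" "fst ` set w \<subseteq> {1..d}" for a w
  proof (cases w)
    case (Cons b v)
    have "letter a \<otimes> (letter (opp a) \<otimes> h v) = h v"
      using that Cons letter h opp by (simp flip: m_assoc)
    then show ?thesis
      using Cons by (auto simp: h_def)
  qed (simp add: h_def)
  have mult: "h (foldr cancel_cons u v) = h u \<otimes> h v" if "fst ` set u \<subseteq> {1..d}" "fst ` set v \<subseteq> {1..d}" for u v
    using that(1)
  proof (induction u)
    case Nil
    then show ?case using h[OF that(2)] by (simp add: h_def)
  next
    case (Cons a u)
    have "fst ` set (foldr cancel_cons u v) \<subseteq> {1..d}"
      using Cons.prems that(2) by (intro fst_set_foldr_cancel_cons) auto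
    then have "h (foldr cancel_cons (a # u) v) = letter a \<otimes> (h u \<otimes> h v)"
      using Cons cancel by simp
    also have "\<dots> = h (a # u) \<otimes> h v"
      using Cons.prems letter h[of u] h[OF that(2)] by (simp add: h_def m_assoc)
    finally show ?case .
  qed
  have "h \<in> hom (free_group d) Q"
    using h mult by (auto simp: hom_def)
  moreover have "h [(i, True)] = q i" if "i \<in> {1..d}" for i
    using q that by (auto simp: h_def letter_def Pi_iff)
  ultimately show ?thesis by blast
qed

section \<open>Finite 2-quotients and the universal property of the completion\<close>

text \<open>A coset of \<open>N \<inter> M\<close> is the intersection of a coset of
  \<open>N\<close> with a coset of \<open>M\<close>, so the index is finite; the exponents for
  \<open>N\<close> and \<open>M\<close> are raised to their maximum.\<close>

lemma normal_2power_inter: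
  fixes G (structure)
  assumes "group G" "N \<in> normal_2power G" "M \<in> normal_2power G"
  shows "N \<inter> M \<in> normal_2power G"
proof -
  interpret group G by fact
  have N: "N \<lhd> G" "finite (rcosets N)" "\<forall>x\<in>carrier G. \<exists>k. x [^] ((2::nat) ^ k) \<in> N"
    using assms(2) unfolding in_normal_2power_iff by auto
  have M: "M \<lhd> G" "finite (rcosets M)" "\<forall>x\<in>carrier G. \<exists>k. x [^] ((2::nat) ^ k) \<in> M"
    using assms(3) unfolding in_normal_2power_iff by auto
  have coset: "(N \<inter> M) #> x = (N #> x) \<inter> (M #> x)" if x: "x \<in> carrier G" for x
  proof (intro equalityI subsetI)
    fix y assume "y \<in> (N #> x) \<inter> (M #> x)"
    then obtain n m where nm: "n \<in> N" "y = n \<otimes> x" "m \<in> M" "y = m \<otimes> x"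
      by (auto simp: r_coset_def)
    have "n \<in> carrier G" "m \<in> carrier G"
      using nm N(1) M(1) normal_imp_subgroup subgroup.mem_carrier by metis+
    then have "n = m"
      using nm x by simp
    then show "y \<in> (N \<inter> M) #> x"
      using nm unfolding r_coset_def by blast
  qed (auto simp: r_coset_def)
  have "rcosets (N \<inter> M) \<subseteq> (\<lambda>(A, B). A \<inter> B) ` ((rcosets N) \<times> (rcosets M))"
  proof
    fix C assume "C \<in> rcosets (N \<inter> M)"
    then obtain x where "x \<in> carrier G" "C = (N #> x) \<inter> (M #> x)"
      using coset by (auto simp: RCOSETS_def)
    then show "C \<in> (\<lambda>(A, B). A \<inter> B) ` ((rcosets N) \<times> (rcosets M))"
      by (intro image_eqI[of _ _ "(N #> x, M #> x)"]) (auto simp: RCOSETS_def)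
  qed
  then have "finite (rcosets (N \<inter> M))"
    using N(2) M(2) by (meson finite_SigmaI finite_imageI finite_subset)
  moreover have "\<exists>k. x [^] ((2::nat) ^ k) \<in> N \<inter> M" if x: "x \<in> carrier G" for x
  proof -
    obtain k l where "x [^] ((2::nat) ^ k) \<in> N" "x [^] ((2::nat) ^ l) \<in> M"
      using N M x by blast
    then have "x [^] ((2::nat) ^ max k l) \<in> N \<inter> M"
      using subgroup_pow_two_mono[OF normal_imp_subgroup[OF N(1)] _ x, of k "max k l"]
        subgroup_pow_two_mono[OF normal_imp_subgroup[OF M(1)] _ x, of l "max k l"] by simp
    then show ?thesis by blast
  qed
  ultimately show ?thesis
    unfolding in_normal_2power_iff using normal_subgroup_intersect[OF N(1) M(1)] by blast
qed

lemma carrier_in_normal_2power: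
  assumes "group G"
  shows "carrier G \<in> normal_2power G"
proof -
  interpret group G by fact
  have "carrier G #>\<^bsub>G\<^esub> x = carrier G" if "x \<in> carrier G" for x
    using that coset_join2[OF that subgroup_self] by simp
  then have "rcosets\<^bsub>G\<^esub> (carrier G) = {carrier G}"
    by (auto simp: RCOSETS_def)
  then show ?thesis
    unfolding in_normal_2power_iff normal_inv_iff using subgroup_self by auto
qed

text \<open>The index set of the completion is directed downwards, so finitely many coordinates of a
  point are all determined by a single one.\<close>

lemma normal_2power_finite_Inter:
  assumes "group G" "finite J" "J \<subseteq> normal_2power G"
  shows "\<exists>M\<in>normal_2power G. \<forall>N\<in>J. M \<subseteq> N"
  using assms(2,3)
proof (induction J)
  case empty
  then show ?case using carrier_in_normal_2power[OF assms(1)] by blast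
next
  case (insert N J)
  then obtain M where "M \<in> normal_2power G" "\<forall>N\<in>J. M \<subseteq> N"
    by auto
  then show ?case
    using normal_2power_inter[OF assms(1), of N M] insert.prems by blast
qed

lemma carrier_pro2_completion: "carrier (pro2_completion G) = completion_carrier G"
  by (simp add: pro2_completion_eq)

lemma completion_carrier_mono:
  assumes "f \<in> completion_carrier G" "N \<in> normal_2power G" "M \<in> normal_2power G" "N \<subseteq> M"
  shows "f N \<subseteq> f M"
  using assms by (simp add: completion_carrier_def)

lemma completion_map_hom:
  fixes G (structure)
  assumes "group G"
  shows "completion_map G \<in> hom G (pro2_completion G)"
proof -
  interpret group G by fact
  have normal: "N \<lhd> G" if "N \<in> normal_2power G" for N
    using that by (simp add: normal_2power_def)
  have "completion_map G x \<in> completion_carrier G" if "x \<in> carrier G" for x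
    using that by (auto simp: completion_map_def completion_carrier_def carrier_FactGroup r_coset_def)
  moreover have "completion_map G (x \<otimes> y) = completion_map G x \<otimes>\<^bsub>pro2_completion G\<^esub> completion_map G y"
    if "x \<in> carrier G" "y \<in> carrier G" for x y
    using that normal.rcos_sum[OF normal]
    by (auto simp: completion_map_def pro2_completion_eq intro!: restrict_ext)
  ultimately show ?thesis
    by (simp add: hom_def carrier_pro2_completion)
qed

text \<open>A neighbourhood of \<open>f\<close> constrains finitely many coordinates, all determined
  by the one at a common smaller \<open>M\<close>. If \<open>x\<close> represents the coset
  \<open>f M\<close>, the image of \<open>x\<close> agrees with \<open>f\<close> in all of
  them.\<close>

lemma completion_map_dense:
  fixes G (structure)
  assumes "group G" and S: "closedin (topo (pro2_completion G)) S"
    and sub: "completion_map G ` carrier G \<subseteq> S"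
  shows "S = carrier (pro2_completion G)"
proof -
  let ?C = "pro2_completion G"
  interpret group G by fact
  interpret C: pro2_group ?C
    by (rule pro2_group_pro2_completion) fact
  have "f \<in> S" if f: "f \<in> carrier ?C" for f
  proof (rule ccontr)
    assume "f \<notin> S"
    then have "f \<in> topspace (topo ?C) - S"
      using f C.topspace_topo by blast
    moreover have "openin (topo ?C) (topspace (topo ?C) - S)"
      using S by blast
    ultimately obtain J where J: "finite J" "J \<subseteq> normal_2power G"
      "\<forall>g\<in>completion_carrier G \<inter> (\<Pi>\<^sub>E N\<in>normal_2power G. carrier (G Mod N)).
        (\<forall>N\<in>J. g N = f N) \<longrightarrow> g \<in> topspace (topo ?C) - S"
      using openin_subtopology_product_discrete[of "\<lambda>N. carrier (G Mod N)" "normal_2power G"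
          "completion_carrier G" "topspace (topo ?C) - S" f]
      unfolding pro2_completion_eq product_subgroup_simps by metis
    obtain M where M: "M \<in> normal_2power G" "\<forall>N\<in>J. M \<subseteq> N"
      using normal_2power_finite_Inter[OF assms(1) J(1,2)] by blast
    have fc: "f \<in> completion_carrier G"
      using f by (simp add: carrier_pro2_completion)
    then obtain x where x: "x \<in> carrier G" "f M = M #> x"
      using M(1) by (auto simp: completion_carrier_def PiE_iff elim!: carrier_ModE)
    have "completion_map G x N = f N" if "N \<in> J" for N
    proof -
      have N: "N \<in> normal_2power G" "M \<subseteq> N"
        using that J(2) M(2) by auto
      have "x \<in> f M"
        using x M(1) rcos_self normal_imp_subgroup by (metis in_normal_2power_iff)
      then have "x \<in> f N"
        using completion_carrier_mono[OF fc M(1) N] by blast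
      obtain y where y: "y \<in> carrier G" "f N = N #> y"
        using fc N(1) by (auto simp: completion_carrier_def PiE_iff elim!: carrier_ModE)
      then have "N #> y = N #> x"
        using \<open>x \<in> f N\<close> repr_independence N(1) normal_imp_subgroup
        by (metis in_normal_2power_iff)
      then show ?thesis
        using y N(1) by (simp add: completion_map_def)
    qed
    moreover have "completion_map G x \<in> completion_carrier G"
      using completion_map_hom[OF assms(1)] x(1) by (auto simp: hom_def carrier_pro2_completion)
    ultimately have "completion_map G x \<notin> S"
      using J(3) by (auto simp: completion_carrier_def)
    then show False
      using sub x(1) by blast
  qed
  then show ?thesis
    using C.closedin_subset_carrier[OF S] by blast
qed

text \<open>The image of a point \<open>f\<close> of the completion is the unique point of the cosets \<open>N \<phi>(w)\<close>, for \<open>N\<close>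
  open normal in \<open>Q\<close> and \<open>w\<close> in the coset that \<open>f\<close> assigns to the preimage of \<open>N\<close>; it exists by
  compactness.\<close>

lemma completion_universal:
  fixes G (structure) and Q :: "'q tgroup"
  assumes "group G" "pro2_group Q" and \<phi>: "\<phi> \<in> hom G Q"
  shows "\<exists>\<Phi>\<in>continuous_hom (pro2_completion G) Q. \<forall>x\<in>carrier G. \<Phi> (completion_map G x) = \<phi> x"
proof -
  let ?C = "pro2_completion G"
  interpret group G by fact
  interpret Q: pro2_group Q by fact
  interpret \<phi>: group_hom G Q \<phi>
    using \<phi> by unfold_locales
  interpret C: pro2_group ?C
    by (rule pro2_group_pro2_completion) fact
  define I where "I = {N. N \<lhd> Q \<and> openin (topo Q) N}"
  \<comment> \<open>\<open>\<phi>\<close> embeds the quotient by \<open>K N\<close> into the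
    quotient of \<open>Q\<close> by \<open>N\<close>, so \<open>K N\<close> is among the subgroups
    that index the completion.\<close>
  define K where "K N = {x \<in> carrier G. \<phi> x \<in> N}" for N
  have K: "K N \<in> normal_2power G" if "N \<in> I" for N
  proof -
    have N: "N \<lhd> Q" "finite (rcosets\<^bsub>Q\<^esub> N)" "\<forall>x\<in>carrier Q. \<exists>k. x [^]\<^bsub>Q\<^esub> ((2::nat) ^ k) \<in> N"
      using that Q.open_normal_in_normal_2power unfolding I_def in_normal_2power_iff by auto
    interpret N: normal N Q by fact
    have coset: "K N #> x = {y \<in> carrier G. \<phi> y \<in> N #>\<^bsub>Q\<^esub> \<phi> x}" if x: "x \<in> carrier G" for x
    proof (intro equalityI subsetI)
      fix y assume "y \<in> K N #> x"
      then show "y \<in> {y \<in> carrier G. \<phi> y \<in> N #>\<^bsub>Q\<^esub> \<phi> x}"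
        using x by (auto simp: r_coset_def K_def)
    next
      fix y assume y: "y \<in> {y \<in> carrier G. \<phi> y \<in> N #>\<^bsub>Q\<^esub> \<phi> x}"
      then have "\<phi> y \<otimes>\<^bsub>Q\<^esub> inv\<^bsub>Q\<^esub> \<phi> x \<in> N"
        using x N.rcos_module_imp Q.group_axioms by simp
      then have "y \<otimes> inv x \<in> K N" "y = (y \<otimes> inv x) \<otimes> x"
        using x y by (auto simp: K_def m_assoc)
      then show "y \<in> K N #> x"
        by (auto simp: r_coset_def)
    qed
    have "rcosets (K N) \<subseteq> (\<lambda>C. {y \<in> carrier G. \<phi> y \<in> C}) ` (rcosets\<^bsub>Q\<^esub> N)"
    proof
      fix C assume "C \<in> rcosets (K N)"
      then obtain x where "x \<in> carrier G" "C = {y \<in> carrier G. \<phi> y \<in> N #>\<^bsub>Q\<^esub> \<phi> x}"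
        using coset by (auto simp: RCOSETS_def)
      then show "C \<in> (\<lambda>C. {y \<in> carrier G. \<phi> y \<in> C}) ` (rcosets\<^bsub>Q\<^esub> N)"
        by (intro image_eqI[of _ _ "N #>\<^bsub>Q\<^esub> \<phi> x"]) (auto simp: RCOSETS_def)
    qed
    then have "finite (rcosets (K N))"
      using N(2) finite_surj by blast
    moreover have "\<exists>k. x [^] ((2::nat) ^ k) \<in> K N" if x: "x \<in> carrier G" for x
    proof -
      obtain k where "\<phi> x [^]\<^bsub>Q\<^esub> ((2::nat) ^ k) \<in> N"
        using bspec[OF N(3) \<phi>.hom_closed[OF x]] by (elim exE)
      then have "x [^] ((2::nat) ^ k) \<in> K N"
        using x by (simp add: K_def \<phi>.hom_nat_pow)
      then show ?thesis ..
    qed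
    ultimately show ?thesis
      unfolding in_normal_2power_iff K_def using \<phi>.normal_vimage[OF N(1)] by blast
  qed
  have Inter: "\<exists>M\<in>I. \<forall>N\<in>J. M \<subseteq> N" if "finite J" "J \<subseteq> I" for J
    using that
  proof (induction J)
    case empty
    have "carrier Q \<in> I"
      using Q.subgroup_self Q.topspace_topo openin_topspace[of "topo Q"]
      by (auto simp: I_def Q.normal_inv_iff)
    then show ?case by blast
  next
    case (insert N J)
    then obtain M where "M \<in> I" "\<forall>N\<in>J. M \<subseteq> N" by auto
    moreover have "N \<inter> M \<in> I"
      using insert.prems \<open>M \<in> I\<close> Q.normal_subgroup_intersect by (auto simp: I_def)
    ultimately show ?case by blast
  qed
  have coset: "\<exists>w\<in>carrier G. f (K N) = K N #> w \<and> w \<in> f (K N)"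
    if fN: "f \<in> completion_carrier G" "N \<in> I" for f N
  proof -
    obtain w where w: "w \<in> carrier G" "f (K N) = K N #> w"
      using fN K[OF fN(2)] by (auto simp: completion_carrier_def PiE_iff elim!: carrier_ModE)
    moreover have "w \<in> K N #> w"
      using w K[OF fN(2)] rcos_self normal_imp_subgroup by (metis in_normal_2power_iff)
    ultimately show ?thesis by auto
  qed
  have f_carrier: "w \<in> carrier G" if "f \<in> completion_carrier G" "N \<in> I" "w \<in> f (K N)" for f N w
    using coset[OF that(1,2)] that(3) K[OF that(2)] normal_imp_subgroup r_coset_subset_G subgroup.subset
    by (metis in_normal_2power_iff subsetD)
  define R where "R f y \<longleftrightarrow> y \<in> carrier Q \<and>
    (\<forall>N\<in>I. \<forall>w\<in>f (K N). y \<otimes>\<^bsub>Q\<^esub> inv\<^bsub>Q\<^esub> \<phi> w \<in> N)" for f y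
  have ex: "\<exists>y. R f y" if f: "f \<in> completion_carrier G" for f
  proof -
    \<comment> \<open>\<open>T N\<close> is a coset of \<open>N\<close>, and it is closed because
      open subgroups are. Quantifying over all \<open>w\<close> in \<open>f (K N)\<close> avoids
      choosing a representative.\<close>
    define T where "T N = {y \<in> topspace (topo Q). \<forall>w\<in>f (K N). y \<otimes>\<^bsub>Q\<^esub> inv\<^bsub>Q\<^esub> \<phi> w \<in> N}" for N
    have closed: "closedin (topo Q) (T N)" if N: "N \<in> I" for N
    proof -
      have "closedin (topo Q) N"
        using N Q.closedin_open_subgroup normal_imp_subgroup by (auto simp: I_def)
      then have "closedin (topo Q) {y \<in> topspace (topo Q). y \<otimes>\<^bsub>Q\<^esub> inv\<^bsub>Q\<^esub> \<phi> w \<in> N}" if "w \<in> f (K N)" for w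
        using f_carrier[OF f N that]
        by (intro closedin_continuous_map_preimage[of _ "topo Q"] Q.continuous_map_mult
            Q.continuous_map_const_carrier continuous_map_id[unfolded id_def]) auto
      moreover have "T N = (\<Inter>w\<in>f (K N). {y \<in> topspace (topo Q). y \<otimes>\<^bsub>Q\<^esub> inv\<^bsub>Q\<^esub> \<phi> w \<in> N})"
        using coset[OF f N] by (auto simp: T_def)
      ultimately show ?thesis
        using coset[OF f N] by (auto intro!: closedin_INT)
    qed
    have fip: "\<Inter>F \<noteq> {}" if F: "finite F" "F \<subseteq> T ` I" for F
    proof -
      obtain J where J: "finite J" "J \<subseteq> I" "F = T ` J"
        using finite_subset_image[OF F] by auto
      obtain M where M: "M \<in> I" "\<forall>N\<in>J. M \<subseteq> N"
        using Inter[OF J(1,2)] by blast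
      obtain w where w: "w \<in> carrier G" "w \<in> f (K M)"
        using coset[OF f M(1)] by blast
      \<comment> \<open>A representative at the smaller group \<open>M\<close> serves every
        \<open>N\<close> in \<open>J\<close>: it lies in \<open>f (K N)\<close>, and two elements of
        that coset have the same image modulo \<open>N\<close>.\<close>
      have "\<phi> w \<in> T N" if N: "N \<in> J" for N
      proof -
        have NI: "N \<in> I" using N J(2) by blast
        have "K M \<subseteq> K N" using M(2) N by (auto simp: K_def)
        then have "w \<in> f (K N)"
          using completion_carrier_mono[OF f K[OF M(1)] K[OF NI]] w(2) by blast
        obtain v where v: "v \<in> carrier G" "f (K N) = K N #> v"
          using coset[OF f NI] by blast
        have "\<phi> w \<otimes>\<^bsub>Q\<^esub> inv\<^bsub>Q\<^esub> \<phi> u \<in> N" if u: "u \<in> f (K N)" for u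
        proof -
          obtain m n where mn: "m \<in> K N" "w = m \<otimes> v" "n \<in> K N" "u = n \<otimes> v"
            using u \<open>w \<in> f (K N)\<close> v by (auto simp: r_coset_def)
          then have "m \<in> carrier G" "n \<in> carrier G" "\<phi> m \<in> N" "\<phi> n \<in> N"
            by (auto simp: K_def)
          moreover from this have "\<phi> w \<otimes>\<^bsub>Q\<^esub> inv\<^bsub>Q\<^esub> \<phi> u = \<phi> m \<otimes>\<^bsub>Q\<^esub> inv\<^bsub>Q\<^esub> \<phi> n"
            using mn v(1) by (simp add: Q.inv_mult_group Q.m_assoc) (simp flip: Q.m_assoc)
          moreover have "subgroup N Q"
            using NI normal_imp_subgroup by (auto simp: I_def)
          ultimately show ?thesis
            by (simp add: subgroup.m_closed subgroup.m_inv_closed)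
        qed
        then show ?thesis
          using w(1) by (simp add: T_def Q.topspace_topo)
      qed
      then show ?thesis
        using J(3) by blast
    qed
    have "\<Inter>(T ` I) \<noteq> {}"
    proof (rule Q.compact[unfolded compact_space_fip, rule_format], intro conjI ballI allI impI)
      fix C assume "C \<in> T ` I"
      then show "closedin (topo Q) C" using closed by auto
    qed (use fip in simp)
    then obtain y where y: "y \<in> \<Inter>(T ` I)" by blast
    have "carrier Q \<in> I"
      using Q.subgroup_self Q.topspace_topo openin_topspace[of "topo Q"]
      by (auto simp: I_def Q.normal_inv_iff)
    then have "y \<in> carrier Q"
      using y by (auto simp: T_def Q.topspace_topo)
    then show ?thesis
      using y by (auto simp: R_def T_def)
  qed
  have uniq: "y = z" if f: "f \<in> completion_carrier G" and y: "R f y" and z: "R f z" for f y z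
  proof -
    have c: "y \<in> carrier Q" "z \<in> carrier Q" using y z by (auto simp: R_def)
    have "y \<otimes>\<^bsub>Q\<^esub> inv\<^bsub>Q\<^esub> z \<in> N" if N: "N \<lhd> Q" "openin (topo Q) N" for N
    proof -
      have NI: "N \<in> I" using N by (simp add: I_def)
      obtain w where w: "w \<in> carrier G" "w \<in> f (K N)"
        using coset[OF f NI] by blast
      have "y \<otimes>\<^bsub>Q\<^esub> inv\<^bsub>Q\<^esub> z = (y \<otimes>\<^bsub>Q\<^esub> inv\<^bsub>Q\<^esub> \<phi> w) \<otimes>\<^bsub>Q\<^esub> inv\<^bsub>Q\<^esub> (z \<otimes>\<^bsub>Q\<^esub> inv\<^bsub>Q\<^esub> \<phi> w)"
        using c w(1) by (simp add: Q.inv_mult_group Q.m_assoc) (simp flip: Q.m_assoc)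
      then show ?thesis
        using y z NI w(2) normal_imp_subgroup[OF N(1)]
        by (simp add: R_def subgroup.m_closed subgroup.m_inv_closed)
    qed
    then have "y \<otimes>\<^bsub>Q\<^esub> inv\<^bsub>Q\<^esub> z = \<one>\<^bsub>Q\<^esub>"
      using c by (intro Q.in_all_open_normal) auto
    then show ?thesis
      using c by (metis Q.inv_closed Q.inv_equality Q.inv_inv)
  qed
  define \<Phi> where "\<Phi> f = (SOME y. R f y)" for f
  have \<Phi>: "R f (\<Phi> f)" if "f \<in> completion_carrier G" for f
    unfolding \<Phi>_def using ex[OF that] by (rule someI_ex)
  have \<Phi>_eq: "\<Phi> f = y" if "f \<in> completion_carrier G" "R f y" for f y
    using uniq[OF that(1) \<Phi>[OF that(1)] that(2)] .
  have hom: "\<Phi> \<in> hom ?C Q"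
  proof (rule homI)
    fix f assume f: "f \<in> carrier ?C"
    then show "\<Phi> f \<in> carrier Q"
      using \<Phi>[of f] by (simp add: R_def carrier_pro2_completion)
    fix g assume g: "g \<in> carrier ?C"
    have fg: "f \<in> completion_carrier G" "g \<in> completion_carrier G" "f \<otimes>\<^bsub>?C\<^esub> g \<in> completion_carrier G"
      using f g C.m_closed[OF f g] by (auto simp: carrier_pro2_completion)
    have c: "\<Phi> f \<in> carrier Q" "\<Phi> g \<in> carrier Q"
      using \<Phi> fg by (auto simp: R_def)
    have "R (f \<otimes>\<^bsub>?C\<^esub> g) (\<Phi> f \<otimes>\<^bsub>Q\<^esub> \<Phi> g)"
      unfolding R_def
    proof (intro conjI ballI)
      fix N w assume N: "N \<in> I" and "w \<in> (f \<otimes>\<^bsub>?C\<^esub> g) (K N)"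
      then have "w \<in> f (K N) <#> g (K N)"
        using K[OF N] by (simp add: pro2_completion_eq)
      then obtain u v where uv: "u \<in> f (K N)" "v \<in> g (K N)" "w = u \<otimes> v"
        by (auto simp: set_mult_def)
      have uvc: "u \<in> carrier G" "v \<in> carrier G"
        using f_carrier fg N uv by blast+
      have 1: "\<Phi> f \<otimes>\<^bsub>Q\<^esub> inv\<^bsub>Q\<^esub> \<phi> u \<in> N" and 2: "\<Phi> g \<otimes>\<^bsub>Q\<^esub> inv\<^bsub>Q\<^esub> \<phi> v \<in> N"
        using \<Phi> fg N uv by (auto simp: R_def)
      have "N \<lhd> Q" using N by (simp add: I_def)
      \<comment> \<open>Normality of \<open>N\<close> enters here: the factor coming from
        \<open>g\<close> is conjugated by \<open>\<Phi> f\<close> before it is combined with the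
        factor coming from \<open>f\<close>.\<close>
      then have "\<Phi> f \<otimes>\<^bsub>Q\<^esub> (\<Phi> g \<otimes>\<^bsub>Q\<^esub> inv\<^bsub>Q\<^esub> \<phi> v) \<otimes>\<^bsub>Q\<^esub> inv\<^bsub>Q\<^esub> \<Phi> f \<otimes>\<^bsub>Q\<^esub> (\<Phi> f \<otimes>\<^bsub>Q\<^esub> inv\<^bsub>Q\<^esub> \<phi> u) \<in> N"
        using 1 2 c Q.normal_inv_iff subgroup.m_closed by metis
      also have "\<Phi> f \<otimes>\<^bsub>Q\<^esub> (\<Phi> g \<otimes>\<^bsub>Q\<^esub> inv\<^bsub>Q\<^esub> \<phi> v) \<otimes>\<^bsub>Q\<^esub> inv\<^bsub>Q\<^esub> \<Phi> f \<otimes>\<^bsub>Q\<^esub> (\<Phi> f \<otimes>\<^bsub>Q\<^esub> inv\<^bsub>Q\<^esub> \<phi> u)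
          = \<Phi> f \<otimes>\<^bsub>Q\<^esub> \<Phi> g \<otimes>\<^bsub>Q\<^esub> inv\<^bsub>Q\<^esub> \<phi> w"
        using c uvc uv(3) by (simp add: Q.inv_mult_group Q.m_assoc) (simp flip: Q.m_assoc)
      finally show "\<Phi> f \<otimes>\<^bsub>Q\<^esub> \<Phi> g \<otimes>\<^bsub>Q\<^esub> inv\<^bsub>Q\<^esub> \<phi> w \<in> N" .
    qed (use c in simp)
    then show "\<Phi> (f \<otimes>\<^bsub>?C\<^esub> g) = \<Phi> f \<otimes>\<^bsub>Q\<^esub> \<Phi> g"
      using \<Phi>_eq fg(3) by blast
  qed
  have "\<Phi> \<in> continuous_hom ?C Q"
  proof (rule continuous_homI[OF C.topological_group_axioms assms(2) hom])
    fix N assume N: "N \<lhd> Q" "openin (topo Q) N"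
    then have NI: "N \<in> I" by (simp add: I_def)
    \<comment> \<open>For a point whose coordinate at \<open>K N\<close> is trivial,
      \<open>w = \<one>\<close> is a permitted choice in \<open>R\<close>, and it puts
      \<open>\<Phi> f\<close> itself into \<open>N\<close>.\<close>
    let ?V = "{f \<in> (\<Pi>\<^sub>E N\<in>normal_2power G. carrier (G Mod N)) \<inter> completion_carrier G. f (K N) \<in> {K N}}"
    have "openin (topo ?C) ?V"
      unfolding pro2_completion_eq product_subgroup_simps by (intro openin_coordinate K NI)
    moreover have "\<one>\<^bsub>?C\<^esub> \<in> ?V"
      using C.one_closed K[OF NI] by (simp add: carrier_pro2_completion) (simp add: pro2_completion_eq completion_carrier_def)
    moreover have "\<Phi> f \<in> N" if "f \<in> ?V" for f
    proof -
      have f: "f \<in> completion_carrier G" "f (K N) = K N" using that by auto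
      have "\<one> \<in> f (K N)"
        using f(2) subgroup.one_closed[OF normal_imp_subgroup[OF N(1)]] by (simp add: K_def)
      moreover have "\<forall>w\<in>f (K N). \<Phi> f \<otimes>\<^bsub>Q\<^esub> inv\<^bsub>Q\<^esub> \<phi> w \<in> N" "\<Phi> f \<in> carrier Q"
        using \<Phi>[OF f(1)] NI by (auto simp: R_def)
      ultimately have "\<Phi> f \<otimes>\<^bsub>Q\<^esub> inv\<^bsub>Q\<^esub> \<phi> \<one> \<in> N"
        by blast
      then show ?thesis
        using \<open>\<Phi> f \<in> carrier Q\<close> by simp
    qed
    ultimately show "\<exists>V. openin (topo ?C) V \<and> \<one>\<^bsub>?C\<^esub> \<in> V \<and> \<Phi> ` V \<subseteq> N"
      by blast
  qed
  moreover have "\<Phi> (completion_map G x) = \<phi> x" if x: "x \<in> carrier G" for x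
  proof (rule \<Phi>_eq)
    show "completion_map G x \<in> completion_carrier G"
      using completion_map_hom[OF assms(1)] x by (auto simp: hom_def carrier_pro2_completion)
    show "R (completion_map G x) (\<phi> x)"
      unfolding R_def
    proof (intro conjI ballI)
      fix N w assume N: "N \<in> I" and "w \<in> completion_map G x (K N)"
      then obtain m where m: "m \<in> K N" "w = m \<otimes> x"
        using K[OF N] by (auto simp: completion_map_def r_coset_def)
      then have "m \<in> carrier G" "\<phi> m \<in> N" by (auto simp: K_def)
      moreover from this have "\<phi> x \<otimes>\<^bsub>Q\<^esub> inv\<^bsub>Q\<^esub> \<phi> w = inv\<^bsub>Q\<^esub> \<phi> m"
        using m(2) x by (simp add: Q.inv_mult_group) (simp flip: Q.m_assoc)
      ultimately show "\<phi> x \<otimes>\<^bsub>Q\<^esub> inv\<^bsub>Q\<^esub> \<phi> w \<in> N"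
        using N normal_imp_subgroup subgroup.m_inv_closed by (fastforce simp: I_def)
    qed (use x in simp)
  qed
  ultimately show ?thesis by blast
qed

lemma continuous_homD:
  assumes "f \<in> continuous_hom G H"
  shows "f \<in> hom G H" "continuous_map (topo G) (topo H) f"
  using assms by (auto simp: continuous_hom_def)

lemma group_hom_continuous_hom:
  "f \<in> continuous_hom G H \<Longrightarrow> group G \<Longrightarrow> group H \<Longrightarrow> group_hom G H f"
  by (simp add: continuous_hom_def group_hom_def group_hom_axioms_def)

lemma pro2_group_free_pro2: "pro2_group (free_pro2 d)"
  unfolding free_pro2_def by (rule pro2_group_pro2_completion[OF group_free_group])

lemma free_pro2_gen_closed: "i \<in> {1..d} \<Longrightarrow> free_pro2_gen d i \<in> carrier (free_pro2 d)"
  using completion_map_hom[OF group_free_group, of d]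
  by (auto simp: free_pro2_def free_pro2_gen_def hom_def)

text \<open>The words mapped into \<open>S\<close> form a subgroup of the free group containing its
  generators, so \<open>S\<close> contains the dense image of the free group.\<close>

lemma free_pro2_generated:
  assumes S: "subgroup S (free_pro2 d)" "closedin (topo (free_pro2 d)) S"
    and gen: "\<And>i. i \<in> {1..d} \<Longrightarrow> free_pro2_gen d i \<in> S"
  shows "S = carrier (free_pro2 d)"
proof -
  interpret c: group_hom "free_group d" "pro2_completion (free_group d)" "completion_map (free_group d)"
    using completion_map_hom[OF group_free_group] group_free_group
      pro2_group_pro2_completion[OF group_free_group]
    by (simp add: group_hom_def group_hom_axioms_def pro2_group_def topological_group_def)
  have "subgroup {w \<in> carrier (free_group d). completion_map (free_group d) w \<in> S} (free_group d)"
    using S(1) by (intro c.subgroup_vimage) (simp add: free_pro2_def)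
  then have "completion_map (free_group d) w \<in> S" if "w \<in> carrier (free_group d)" for w
    using free_group_generated[OF _ _ that] gen by (force simp: free_pro2_gen_def)
  then show ?thesis
    unfolding free_pro2_def
    by (intro completion_map_dense group_free_group) (use S(2) in \<open>auto simp: free_pro2_def\<close>)
qed

lemma free_pro2_universal:
  assumes "pro2_group Q" "q \<in> {1..d} \<rightarrow> carrier Q"
  shows "\<exists>\<Phi>\<in>continuous_hom (free_pro2 d) Q. \<forall>i\<in>{1..d}. \<Phi> (free_pro2_gen d i) = q i"
proof -
  interpret Q: pro2_group Q by fact
  obtain h where h: "h \<in> hom (free_group d) Q" "\<forall>i\<in>{1..d}. h [(i, True)] = q i"
    using free_group_hom[OF Q.group_axioms assms(2)] by blast
  obtain \<Phi> where \<Phi>: "\<Phi> \<in> continuous_hom (pro2_completion (free_group d)) Q"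
    "\<forall>x\<in>carrier (free_group d). \<Phi> (completion_map (free_group d) x) = h x"
    using completion_universal[OF group_free_group assms(1) h(1)] by blast
  have "\<Phi> (free_pro2_gen d i) = q i" if "i \<in> {1..d}" for i
  proof -
    have "[(i, True)] \<in> carrier (free_group d)"
      using that by simp
    then show ?thesis
      using \<Phi>(2) h(2) that by (simp add: free_pro2_gen_def del: free_group_simps)
  qed
  then show ?thesis
    using \<Phi>(1) unfolding free_pro2_def by blast
qed

section \<open>The universal property of pro-2 right-angled Artin groups\<close>

lemma edge_vertices:
  assumes "is_graph \<Gamma>" "{i, j} \<in> edges \<Gamma>"
  shows "i \<in> {1..nverts \<Gamma>}" "j \<in> {1..nverts \<Gamma>}"
proof -
  have "{i, j} \<in> pairs (nverts \<Gamma>)"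
    using assms unfolding is_graph_def by blast
  then show "i \<in> {1..nverts \<Gamma>}" "j \<in> {1..nverts \<Gamma>}"
    by (auto simp: pairs_def doubleton_eq_iff)
qed

lemma (in group) comm_closed: "x \<in> carrier G \<Longrightarrow> y \<in> carrier G \<Longrightarrow> comm G x y \<in> carrier G"
  by (simp add: comm_def)

lemma (in group) comm_eq_one_iff:
  assumes "x \<in> carrier G" "y \<in> carrier G"
  shows "comm G x y = \<one> \<longleftrightarrow> x \<otimes> y = y \<otimes> x"
proof -
  have "comm G x y = inv (y \<otimes> x) \<otimes> (x \<otimes> y)"
    using assms by (simp add: comm_def inv_mult_group m_assoc)
  then show ?thesis
    using assms by (metis inv_closed inv_equality inv_inv l_inv m_closed)
qed

text \<open>An edge of a graph has its endpoints among the vertices, so the relators lie in the free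
  pro-2 group and their closed normal closure is a proper instance of a closed normal
  subgroup.\<close>

lemma pro2_quotient_raag:
  assumes "is_graph \<Gamma>"
  shows "pro2_quotient (free_pro2 (nverts \<Gamma>))
    (closed_normal_closure (free_pro2 (nverts \<Gamma>)) (raag_relations \<Gamma>))"
proof -
  interpret pro2_group "free_pro2 (nverts \<Gamma>)"
    by (rule pro2_group_free_pro2)
  have "raag_relations \<Gamma> \<subseteq> carrier (free_pro2 (nverts \<Gamma>))"
    using edge_vertices[OF assms] by (auto simp: raag_relations_def intro!: comm_closed free_pro2_gen_closed)
  then show ?thesis
    using closed_normal_closure pro2_group_axioms
    by (simp add: pro2_quotient_def pro2_quotient_axioms_def)
qed

lemma pro2_group_raag: "is_graph \<Gamma> \<Longrightarrow> pro2_group (raag \<Gamma>)"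
  unfolding raag_def by (intro pro2_quotient.pro2_group_quotient pro2_quotient_raag)

lemma raag_gen_closed:
  assumes "is_graph \<Gamma>" "i \<in> {1..nverts \<Gamma>}"
  shows "raag_gen \<Gamma> i \<in> carrier (raag \<Gamma>)"
proof -
  interpret pro2_quotient "free_pro2 (nverts \<Gamma>)"
    "closed_normal_closure (free_pro2 (nverts \<Gamma>)) (raag_relations \<Gamma>)"
    by (rule pro2_quotient_raag) fact
  show ?thesis
    using q.hom_closed[OF free_pro2_gen_closed[OF assms(2)]] by (simp add: raag_def raag_gen_def)
qed

lemma raag_gen_commute:
  assumes "is_graph \<Gamma>" "{i, j} \<in> edges \<Gamma>"
  shows "raag_gen \<Gamma> i \<otimes>\<^bsub>raag \<Gamma>\<^esub> raag_gen \<Gamma> j = raag_gen \<Gamma> j \<otimes>\<^bsub>raag \<Gamma>\<^esub> raag_gen \<Gamma> i"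
proof -
  let ?F = "free_pro2 (nverts \<Gamma>)" and ?x = "free_pro2_gen (nverts \<Gamma>)"
  interpret pro2_quotient ?F "closed_normal_closure ?F (raag_relations \<Gamma>)"
    by (rule pro2_quotient_raag) fact
  have c: "?x i \<in> carrier ?F" "?x j \<in> carrier ?F"
    using edge_vertices[OF assms] free_pro2_gen_closed by blast+
  have "comm ?F (?x i) (?x j) \<in> raag_relations \<Gamma>"
    using assms(2) by (auto simp: raag_relations_def)
  then have "comm ?F (?x i) (?x j) \<in> closed_normal_closure ?F (raag_relations \<Gamma>)"
    by (rule subsetD[OF closed_normal_closure_supset])
  then have "closed_normal_closure ?F (raag_relations \<Gamma>) #>\<^bsub>?F\<^esub> comm ?F (?x i) (?x j) = \<one>\<^bsub>Q\<^esub>"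
    using N.rcos_const by simp
  moreover have "closed_normal_closure ?F (raag_relations \<Gamma>) #>\<^bsub>?F\<^esub> comm ?F (?x i) (?x j)
      = comm Q (raag_gen \<Gamma> i) (raag_gen \<Gamma> j)"
    unfolding raag_gen_def comm_def using c by (simp del: quotient_tgroup_simps)
  ultimately show ?thesis
    using Q.comm_eq_one_iff[of "raag_gen \<Gamma> i" "raag_gen \<Gamma> j"] q.hom_closed[OF c(1)] q.hom_closed[OF c(2)]
    by (simp add: raag_def raag_gen_def)
qed

text \<open>Pulled back along the quotient map, \<open>S\<close> becomes a closed subgroup of the
  free pro-2 group that contains the free generators.\<close>

lemma raag_generated:
  assumes "is_graph \<Gamma>" and S: "subgroup S (raag \<Gamma>)" "closedin (topo (raag \<Gamma>)) S"
    and gen: "\<And>i. i \<in> {1..nverts \<Gamma>} \<Longrightarrow> raag_gen \<Gamma> i \<in> S"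
  shows "S = carrier (raag \<Gamma>)"
proof -
  let ?F = "free_pro2 (nverts \<Gamma>)"
  let ?N = "closed_normal_closure ?F (raag_relations \<Gamma>)"
  interpret pro2_quotient ?F ?N
    by (rule pro2_quotient_raag) fact
  let ?S = "{x \<in> carrier ?F. ?N #>\<^bsub>?F\<^esub> x \<in> S}"
  have "subgroup ?S ?F"
    using q.subgroup_vimage S(1) by (simp add: raag_def)
  moreover have "closedin (topo ?F) ?S"
    using closedin_continuous_map_preimage[OF proj_continuous] S(2) by (simp add: raag_def topspace_topo)
  moreover have "free_pro2_gen (nverts \<Gamma>) i \<in> ?S" if "i \<in> {1..nverts \<Gamma>}" for i
    using gen[OF that] free_pro2_gen_closed[OF that] by (simp add: raag_gen_def)
  ultimately have "?S = carrier ?F"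
    by (rule free_pro2_generated)
  then have "carrier (raag \<Gamma>) \<subseteq> S"
    by (auto simp: raag_def elim!: rcosetsE)
  then show ?thesis
    using subgroup.subset[OF S(1)] by blast
qed

text \<open>The kernel of the map from the free pro-2 group is normal, it is closed because
  \<open>Q\<close> is Hausdorff, and it contains the relators. Hence it contains their closed normal
  closure.\<close>

theorem raag_universal:
  assumes "is_graph \<Gamma>" "pro2_group Q" and q: "q \<in> {1..nverts \<Gamma>} \<rightarrow> carrier Q"
    and commute: "\<And>i j. {i, j} \<in> edges \<Gamma> \<Longrightarrow> q i \<otimes>\<^bsub>Q\<^esub> q j = q j \<otimes>\<^bsub>Q\<^esub> q i"
  shows "\<exists>\<Phi>\<in>continuous_hom (raag \<Gamma>) Q. \<forall>i\<in>{1..nverts \<Gamma>}. \<Phi> (raag_gen \<Gamma> i) = q i"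
proof -
  let ?F = "free_pro2 (nverts \<Gamma>)"
  let ?N = "closed_normal_closure ?F (raag_relations \<Gamma>)"
  interpret F: pro2_quotient ?F ?N
    by (rule pro2_quotient_raag) fact
  interpret Q: pro2_group Q by fact
  obtain f where f: "f \<in> continuous_hom ?F Q"
    and fq: "\<forall>i\<in>{1..nverts \<Gamma>}. f (free_pro2_gen (nverts \<Gamma>) i) = q i"
    using free_pro2_universal[OF assms(2) q] by blast
  interpret f: group_hom ?F Q f
    using f by (intro group_hom_continuous_hom F.group_axioms Q.group_axioms)
  have "?N \<subseteq> {x \<in> carrier ?F. f x \<in> {\<one>\<^bsub>Q\<^esub>}}"
  proof (rule closed_normal_closure_subset)
    show "{x \<in> carrier ?F. f x \<in> {\<one>\<^bsub>Q\<^esub>}} \<lhd> ?F"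
      using Q.one_is_normal by (rule f.normal_vimage)
    have "closedin (topo Q) {\<one>\<^bsub>Q\<^esub>}"
      using Q.Hausdorff Q.topspace_topo closedin_Hausdorff_singleton Q.one_closed by metis
    from closedin_continuous_map_preimage[OF continuous_homD(2)[OF f] this]
    show "closedin (topo ?F) {x \<in> carrier ?F. f x \<in> {\<one>\<^bsub>Q\<^esub>}}"
      unfolding F.topspace_topo .
    show "raag_relations \<Gamma> \<subseteq> {x \<in> carrier ?F. f x \<in> {\<one>\<^bsub>Q\<^esub>}}"
    proof
      fix r assume "r \<in> raag_relations \<Gamma>"
      then obtain i j where ij: "{i, j} \<in> edges \<Gamma>"
        "r = comm ?F (free_pro2_gen (nverts \<Gamma>) i) (free_pro2_gen (nverts \<Gamma>) j)"
        by (auto simp: raag_relations_def)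
      have v: "i \<in> {1..nverts \<Gamma>}" "j \<in> {1..nverts \<Gamma>}"
        using edge_vertices[OF assms(1) ij(1)] by auto
      note c = v[THEN free_pro2_gen_closed]
      have "f r = comm Q (q i) (q j)"
        using c fq v unfolding ij(2) comm_def by simp
      also have "\<dots> = \<one>\<^bsub>Q\<^esub>"
        using Q.comm_eq_one_iff[of "q i" "q j"] commute[OF ij(1)] q v by (auto simp: Pi_iff)
      finally show "r \<in> {x \<in> carrier ?F. f x \<in> {\<one>\<^bsub>Q\<^esub>}}"
        using F.comm_closed c ij(2) by simp
    qed
  qed
  then obtain g where g: "g \<in> continuous_hom (quotient_tgroup ?F ?N) Q" "\<forall>x\<in>carrier ?F. g (?N #>\<^bsub>?F\<^esub> x) = f x"
    using F.quotient_universal[OF f Q.group_axioms] by blast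
  have "g (raag_gen \<Gamma> i) = q i" if "i \<in> {1..nverts \<Gamma>}" for i
    using g(2) fq that free_pro2_gen_closed[OF that] by (simp add: raag_gen_def)
  then show ?thesis
    using g(1) unfolding raag_def by blast
qed

lemma subgroup_equalizer:
  assumes "group_hom G H f" "group_hom G H g"
  shows "subgroup {x \<in> carrier G. f x = g x} G"
proof -
  interpret f: group_hom G H f by fact
  interpret g: group_hom G H g by fact
  show ?thesis
    by (rule f.G.subgroupI) auto
qed

text \<open>Two continuous homomorphisms to a Hausdorff group agree on a closed subgroup, which here
  contains the generators.\<close>

lemma raag_hom_eq:
  assumes "is_graph \<Gamma>" "pro2_group Q" and f: "f \<in> continuous_hom (raag \<Gamma>) Q" and g: "g \<in> continuous_hom (raag \<Gamma>) Q"
    and eq: "\<And>i. i \<in> {1..nverts \<Gamma>} \<Longrightarrow> f (raag_gen \<Gamma> i) = g (raag_gen \<Gamma> i)"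
    and x: "x \<in> carrier (raag \<Gamma>)"
  shows "f x = g x"
proof -
  interpret A: pro2_group "raag \<Gamma>" by (rule pro2_group_raag) fact
  interpret Q: pro2_group Q by fact
  have "{x \<in> carrier (raag \<Gamma>). f x = g x} = carrier (raag \<Gamma>)"
  proof (rule raag_generated[OF assms(1)])
    show "subgroup {x \<in> carrier (raag \<Gamma>). f x = g x} (raag \<Gamma>)"
      using f g by (intro subgroup_equalizer[of _ Q] group_hom_continuous_hom A.group_axioms Q.group_axioms)
    show "closedin (topo (raag \<Gamma>)) {x \<in> carrier (raag \<Gamma>). f x = g x}"
      using closedin_continuous_maps_eq[OF Q.Hausdorff continuous_homD(2)[OF f] continuous_homD(2)[OF g]]
      by (simp add: A.topspace_topo)
  qed (use eq raag_gen_closed[OF assms(1)] in auto)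
  then show ?thesis
    using x by blast
qed

text \<open>Commuting with \<open>y\<close> means that \<open>f\<close> agrees with its conjugate by
  \<open>y\<close>. The conjugate is again a continuous homomorphism, so the comparison on
  generators suffices.\<close>

lemma raag_hom_commute:
  assumes "is_graph \<Gamma>" "pro2_group Q" and f: "f \<in> continuous_hom (raag \<Gamma>) Q" and y: "y \<in> carrier Q"
    and commute: "\<And>i. i \<in> {1..nverts \<Gamma>} \<Longrightarrow> f (raag_gen \<Gamma> i) \<otimes>\<^bsub>Q\<^esub> y = y \<otimes>\<^bsub>Q\<^esub> f (raag_gen \<Gamma> i)"
    and x: "x \<in> carrier (raag \<Gamma>)"
  shows "f x \<otimes>\<^bsub>Q\<^esub> y = y \<otimes>\<^bsub>Q\<^esub> f x"
proof -
  interpret A: pro2_group "raag \<Gamma>" by (rule pro2_group_raag) fact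
  interpret Q: pro2_group Q by fact
  interpret f: group_hom "raag \<Gamma>" Q f
    using f by (intro group_hom_continuous_hom A.group_axioms Q.group_axioms)
  define g where "g x = y \<otimes>\<^bsub>Q\<^esub> f x \<otimes>\<^bsub>Q\<^esub> inv\<^bsub>Q\<^esub> y" for x
  have commute_iff: "f x = g x \<longleftrightarrow> f x \<otimes>\<^bsub>Q\<^esub> y = y \<otimes>\<^bsub>Q\<^esub> f x" if "x \<in> carrier (raag \<Gamma>)" for x
    using that y Q.inv_solve_right[of "f x" "y \<otimes>\<^bsub>Q\<^esub> f x" y] by (auto simp: g_def)
  have "g \<in> hom (raag \<Gamma>) Q"
  proof (rule homI)
    fix a b assume ab: "a \<in> carrier (raag \<Gamma>)" "b \<in> carrier (raag \<Gamma>)"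
    have "inv\<^bsub>Q\<^esub> y \<otimes>\<^bsub>Q\<^esub> (y \<otimes>\<^bsub>Q\<^esub> c) = c" if "c \<in> carrier Q" for c
      using y that by (simp flip: Q.m_assoc)
    then show "g (a \<otimes>\<^bsub>raag \<Gamma>\<^esub> b) = g a \<otimes>\<^bsub>Q\<^esub> g b"
      using ab y by (simp add: g_def Q.m_assoc)
  qed (use y in \<open>simp add: g_def\<close>)
  moreover have "continuous_map (topo (raag \<Gamma>)) (topo Q) g"
    unfolding g_def
    by (intro Q.continuous_map_mult Q.continuous_map_const_carrier Q.inv_closed y continuous_homD(2)[OF f])
  ultimately have "g \<in> continuous_hom (raag \<Gamma>) Q"
    by (simp add: continuous_hom_def)
  moreover have "f (raag_gen \<Gamma> i) = g (raag_gen \<Gamma> i)" if "i \<in> {1..nverts \<Gamma>}" for i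
    using commute_iff[OF raag_gen_closed[OF assms(1) that]] commute[OF that] by blast
  ultimately have "f x = g x"
    by (rule raag_hom_eq[OF assms(1,2) f _ _ x])
  then show ?thesis
    using commute_iff[OF x] by simp
qed

section \<open>Semidirect products of pro-2 groups\<close>

text \<open>The inverse of \<open>\<phi> h\<close> is \<open>\<phi>\<close> at the inverse of
  \<open>h\<close>, so bijectivity follows from the action laws. Extensionality is asked for because
  \<open>AutoGroup\<close> consists of functions that are \<open>undefined\<close> outside the
  carrier.\<close>

lemma continuous_actionI:
  assumes "group H" "group N"
    and closed: "\<And>h v. h \<in> carrier H \<Longrightarrow> v \<in> carrier N \<Longrightarrow> \<phi> h v \<in> carrier N"
    and ext: "\<And>h. h \<in> carrier H \<Longrightarrow> \<phi> h \<in> extensional (carrier N)"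
    and mult: "\<And>h v w. h \<in> carrier H \<Longrightarrow> v \<in> carrier N \<Longrightarrow> w \<in> carrier N \<Longrightarrow>
      \<phi> h (v \<otimes>\<^bsub>N\<^esub> w) = \<phi> h v \<otimes>\<^bsub>N\<^esub> \<phi> h w"
    and one: "\<And>v. v \<in> carrier N \<Longrightarrow> \<phi> \<one>\<^bsub>H\<^esub> v = v"
    and act: "\<And>g h v. g \<in> carrier H \<Longrightarrow> h \<in> carrier H \<Longrightarrow> v \<in> carrier N \<Longrightarrow>
      \<phi> (g \<otimes>\<^bsub>H\<^esub> h) v = \<phi> g (\<phi> h v)"
    and cont: "continuous_map (prod_topology (topo H) (topo N)) (topo N) (\<lambda>(h, v). \<phi> h v)"
  shows "continuous_action H N \<phi>"
proof -
  interpret H: group H by fact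
  have auto: "\<phi> h \<in> auto N" if h: "h \<in> carrier H" for h
  proof -
    have "bij_betw (\<phi> h) (carrier N) (carrier N)"
      using act[OF h H.inv_closed[OF h]] act[OF H.inv_closed[OF h] h] one closed h
      by (intro bij_betwI[of _ _ _ "\<phi> (inv\<^bsub>H\<^esub> h)"]) auto
    then show ?thesis
      using closed mult ext h by (simp add: auto_def Bij_def hom_def)
  qed
  have "\<phi> \<in> hom H (AutoGroup N)"
  proof (rule homI)
    fix g h assume gh: "g \<in> carrier H" "h \<in> carrier H"
    have "\<phi> (g \<otimes>\<^bsub>H\<^esub> h) = compose (carrier N) (\<phi> g) (\<phi> h)"
      using gh ext[of "g \<otimes>\<^bsub>H\<^esub> h"] act
      by (intro extensionalityI[of _ "carrier N"]) (auto simp: compose_eq)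
    then show "\<phi> (g \<otimes>\<^bsub>H\<^esub> h) = \<phi> g \<otimes>\<^bsub>AutoGroup N\<^esub> \<phi> h"
      using auto[OF gh(1)] auto[OF gh(2)] by (simp add: AutoGroup_def BijGroup_def auto_def)
  qed (use auto in \<open>simp add: AutoGroup_def\<close>)
  then show ?thesis
    using cont by (simp add: continuous_action_def)
qed

lemma continuous_actionD:
  assumes "continuous_action H N \<phi>" "group H" "group N"
  shows "h \<in> carrier H \<Longrightarrow> v \<in> carrier N \<Longrightarrow> \<phi> h v \<in> carrier N"
    and "h \<in> carrier H \<Longrightarrow> v \<in> carrier N \<Longrightarrow> w \<in> carrier N \<Longrightarrow> \<phi> h (v \<otimes>\<^bsub>N\<^esub> w) = \<phi> h v \<otimes>\<^bsub>N\<^esub> \<phi> h w"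
    and "v \<in> carrier N \<Longrightarrow> \<phi> \<one>\<^bsub>H\<^esub> v = v"
    and "g \<in> carrier H \<Longrightarrow> h \<in> carrier H \<Longrightarrow> v \<in> carrier N \<Longrightarrow> \<phi> (g \<otimes>\<^bsub>H\<^esub> h) v = \<phi> g (\<phi> h v)"
    and "continuous_map (prod_topology (topo H) (topo N)) (topo N) (\<lambda>(h, v). \<phi> h v)"
proof -
  interpret N: group N by fact
  have hom: "\<phi> \<in> hom H (AutoGroup N)"
    using assms(1) by (simp add: continuous_action_def)
  then interpret \<phi>: group_hom H "AutoGroup N" \<phi>
    using assms(2) N.AutoGroup by (simp add: group_hom_def group_hom_axioms_def)
  have auto: "\<phi> h \<in> auto N" if "h \<in> carrier H" for h
    using \<phi>.hom_closed[OF that] by (simp add: AutoGroup_def)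
  show "h \<in> carrier H \<Longrightarrow> v \<in> carrier N \<Longrightarrow> \<phi> h v \<in> carrier N"
    using auto by (auto simp: auto_def hom_def)
  show "h \<in> carrier H \<Longrightarrow> v \<in> carrier N \<Longrightarrow> w \<in> carrier N \<Longrightarrow> \<phi> h (v \<otimes>\<^bsub>N\<^esub> w) = \<phi> h v \<otimes>\<^bsub>N\<^esub> \<phi> h w"
    using auto by (auto simp: auto_def hom_def)
  show "v \<in> carrier N \<Longrightarrow> \<phi> \<one>\<^bsub>H\<^esub> v = v"
    using \<phi>.hom_one by (simp add: AutoGroup_def BijGroup_def)
  show "\<phi> (g \<otimes>\<^bsub>H\<^esub> h) v = \<phi> g (\<phi> h v)" if "g \<in> carrier H" "h \<in> carrier H" "v \<in> carrier N"
    using \<phi>.hom_mult[OF that(1,2)] auto[OF that(1)] auto[OF that(2)] that(3)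
    by (simp add: AutoGroup_def BijGroup_def auto_def compose_eq)
  show "continuous_map (prod_topology (topo H) (topo N)) (topo N) (\<lambda>(h, v). \<phi> h v)"
    using assms(1) by (simp add: continuous_action_def)
qed

lemma semidirect_simps [simp]:
  "carrier (semidirect N H \<phi>) = carrier N \<times> carrier H"
  "x \<otimes>\<^bsub>semidirect N H \<phi>\<^esub> y = (fst x \<otimes>\<^bsub>N\<^esub> \<phi> (snd x) (fst y), snd x \<otimes>\<^bsub>H\<^esub> snd y)"
  "\<one>\<^bsub>semidirect N H \<phi>\<^esub> = (\<one>\<^bsub>N\<^esub>, \<one>\<^bsub>H\<^esub>)"
  "topo (semidirect N H \<phi>) = prod_topology (topo N) (topo H)"
  by (simp_all add: semidirect_def case_prod_unfold)

locale pro2_semidirect = N: pro2_group N + H: pro2_group H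
  for N :: "'n tgroup" and H :: "'h tgroup" +
  fixes \<phi> :: "'h \<Rightarrow> 'n \<Rightarrow> 'n"
  assumes action: "continuous_action H N \<phi>"
begin

lemmas act_simps [simp] = continuous_actionD(1-3)[OF action H.group_axioms N.group_axioms]
lemmas act_mult = continuous_actionD(4)[OF action H.group_axioms N.group_axioms]
lemmas act_continuous = continuous_actionD(5)[OF action H.group_axioms N.group_axioms]

lemma act_one [simp]: "h \<in> carrier H \<Longrightarrow> \<phi> h \<one>\<^bsub>N\<^esub> = \<one>\<^bsub>N\<^esub>"
  using act_simps(2)[of h "\<one>\<^bsub>N\<^esub>" "\<one>\<^bsub>N\<^esub>"] act_simps(1)[of h "\<one>\<^bsub>N\<^esub>"]
  by (metis N.l_cancel_one' N.one_closed N.l_one)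

lemma act_m_inv: "h \<in> carrier H \<Longrightarrow> v \<in> carrier N \<Longrightarrow> \<phi> h (inv\<^bsub>N\<^esub> v) = inv\<^bsub>N\<^esub> \<phi> h v"
  using act_simps(2)[of h "inv\<^bsub>N\<^esub> v" v] by (intro N.inv_equality[symmetric]) auto

abbreviation "G \<equiv> semidirect N H \<phi>"

lemma inverse:
  assumes "v \<in> carrier N" "h \<in> carrier H"
  shows "(\<phi> (inv\<^bsub>H\<^esub> h) (inv\<^bsub>N\<^esub> v), inv\<^bsub>H\<^esub> h) \<otimes>\<^bsub>G\<^esub> (v, h) = \<one>\<^bsub>G\<^esub>"
  using assms by (simp add: act_m_inv)

sublocale G: group G
proof (rule groupI)
  fix x assume "x \<in> carrier G"
  then show "\<exists>y\<in>carrier G. y \<otimes>\<^bsub>G\<^esub> x = \<one>\<^bsub>G\<^esub>"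
    using inverse[of "fst x" "snd x"]
    by (intro bexI[of _ "(\<phi> (inv\<^bsub>H\<^esub> snd x) (inv\<^bsub>N\<^esub> fst x), inv\<^bsub>H\<^esub> snd x)"]) auto
qed (auto simp: N.m_assoc H.m_assoc act_mult)

lemma inv_semidirect:
  assumes "x \<in> carrier G"
  shows "inv\<^bsub>G\<^esub> x = (\<phi> (inv\<^bsub>H\<^esub> snd x) (inv\<^bsub>N\<^esub> fst x), inv\<^bsub>H\<^esub> snd x)"
  using assms inverse[of "fst x" "snd x"] by (intro G.inv_equality) auto

lemma continuous_map_act:
  assumes "continuous_map T (topo H) f" "continuous_map T (topo N) g"
  shows "continuous_map T (topo N) (\<lambda>x. \<phi> (f x) (g x))"
  using continuous_map_compose[OF continuous_map_pairedI[OF assms] act_continuous] by (simp add: o_def)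

sublocale G: topological_group G
proof
  have T: "topspace (topo G) = carrier G"
    by (simp add: N.topspace_topo H.topspace_topo)
  then show "topspace (topo G) = carrier G" .
  let ?T = "prod_topology (topo G) (topo G)"
  have "continuous_map ?T (topo N) (\<lambda>z. fst (fst z))" "continuous_map ?T (topo H) (\<lambda>z. snd (fst z))"
    "continuous_map ?T (topo N) (\<lambda>z. fst (snd z))" "continuous_map ?T (topo H) (\<lambda>z. snd (snd z))"
    using continuous_map_compose[OF continuous_map_fst continuous_map_fst]
      continuous_map_compose[OF continuous_map_fst continuous_map_snd]
      continuous_map_compose[OF continuous_map_snd continuous_map_fst]
      continuous_map_compose[OF continuous_map_snd continuous_map_snd]
    by (simp_all add: o_def)
  then have "continuous_map ?T (topo G)
      (\<lambda>z. (fst (fst z) \<otimes>\<^bsub>N\<^esub> \<phi> (snd (fst z)) (fst (snd z)), snd (fst z) \<otimes>\<^bsub>H\<^esub> snd (snd z)))"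
    unfolding semidirect_simps(4)[of N H \<phi>]
    by (intro continuous_map_pairedI N.continuous_map_mult H.continuous_map_mult continuous_map_act)
  then show "continuous_map ?T (topo G) (\<lambda>(x, y). x \<otimes>\<^bsub>G\<^esub> y)"
    by (simp add: case_prod_unfold)
  have "continuous_map (topo G) (topo G) (\<lambda>x. (\<phi> (inv\<^bsub>H\<^esub> snd x) (inv\<^bsub>N\<^esub> fst x), inv\<^bsub>H\<^esub> snd x))"
    unfolding semidirect_simps(4)
    by (intro continuous_map_pairedI N.continuous_map_m_inv H.continuous_map_m_inv continuous_map_act
        continuous_map_fst continuous_map_snd)
  then show "continuous_map (topo G) (topo G) (\<lambda>x. inv\<^bsub>G\<^esub> x)"
    by (rule continuous_map_eq) (use T inv_semidirect in auto)
qed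

text \<open>\<open>W\<close> is the largest \<open>H\<close>-invariant subset of \<open>V\<close>.
  Its complement is the projection to \<open>N\<close> of a closed subset of the product of
  \<open>H\<close> and \<open>N\<close>, and projecting along a compact factor is a closed
  map.\<close>

lemma invariant_open_subgroup:
  assumes "subgroup V N" "openin (topo N) V"
  defines "W \<equiv> {v \<in> carrier N. \<forall>h\<in>carrier H. \<phi> h v \<in> V}"
  shows "subgroup W N" "openin (topo N) W" "W \<subseteq> V" "\<And>h v. h \<in> carrier H \<Longrightarrow> v \<in> W \<Longrightarrow> \<phi> h v \<in> W"
proof -
  interpret V: subgroup V N by fact
  show "subgroup W N"
    by (rule N.subgroupI) (auto simp: W_def act_m_inv V.m_inv_closed)
  show "W \<subseteq> V"
  proof
    fix v assume "v \<in> W"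
    then have "\<forall>h\<in>carrier H. \<phi> h v \<in> V" and v: "v \<in> carrier N"
      by (auto simp: W_def)
    then have "\<phi> \<one>\<^bsub>H\<^esub> v \<in> V" by blast
    then show "v \<in> V" using v by simp
  qed
  show "\<phi> h v \<in> W" if "h \<in> carrier H" "v \<in> W" for h v
    using that by (auto simp: W_def act_mult[symmetric])
  let ?P = "prod_topology (topo H) (topo N)"
  have "openin (topo N) V" by fact
  then have "closedin (topo N) (topspace (topo N) - V)"
    by blast
  with act_continuous have "closedin ?P {z \<in> topspace ?P. (case z of (h, v) \<Rightarrow> \<phi> h v) \<in> topspace (topo N) - V}"
    by (rule closedin_continuous_map_preimage)
  with closed_map_snd[OF H.compact, of "topo N"]
  have "closedin (topo N) (snd ` {z \<in> topspace ?P. (case z of (h, v) \<Rightarrow> \<phi> h v) \<in> topspace (topo N) - V})"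
    unfolding closed_map_def by blast
  moreover have "W = topspace (topo N) - snd ` {z \<in> topspace ?P. (case z of (h, v) \<Rightarrow> \<phi> h v) \<in> topspace (topo N) - V}"
    by (auto simp: W_def N.topspace_topo H.topspace_topo image_iff)
  ultimately show "openin (topo N) W"
    by (simp only: openin_diff openin_topspace)
qed

text \<open>An invariant open subgroup of \<open>N\<close> times an open subgroup of
  \<open>H\<close> is again a subgroup, and such products are a base at the identity.\<close>

lemma pro2_group_semidirect: "pro2_group G"
proof (rule G.pro2_groupI)
  show "compact_space (topo G)"
    by (simp add: compact_space_prod_topology N.compact H.compact)
  show "Hausdorff_space (topo G)"
    by (simp add: Hausdorff_space_prod_topology N.Hausdorff H.Hausdorff)
next
  fix U assume U: "openin (topo G) U" "\<one>\<^bsub>G\<^esub> \<in> U"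
  then obtain V W where VW: "openin (topo N) V" "openin (topo H) W" "\<one>\<^bsub>N\<^esub> \<in> V" "\<one>\<^bsub>H\<^esub> \<in> W" "V \<times> W \<subseteq> U"
    unfolding semidirect_simps openin_prod_topology_alt by meson
  obtain V' where V': "subgroup V' N" "openin (topo N) V'" "V' \<subseteq> V"
    using N.open_subgroups_base[OF VW(1,3)] by blast
  obtain W' where W': "subgroup W' H" "openin (topo H) W'" "W' \<subseteq> W"
    using H.open_subgroups_base[OF VW(2,4)] by blast
  obtain V'' where V'': "subgroup V'' N" "openin (topo N) V''" "V'' \<subseteq> V'"
    "\<And>h v. h \<in> carrier H \<Longrightarrow> v \<in> V'' \<Longrightarrow> \<phi> h v \<in> V''"
    using invariant_open_subgroup[OF V'(1,2)] by blast
  interpret V'': subgroup V'' N by fact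
  interpret W': subgroup W' H by fact
  have "subgroup (V'' \<times> W') G"
  proof (rule G.subgroupI)
    fix x assume "x \<in> V'' \<times> W'"
    then show "inv\<^bsub>G\<^esub> x \<in> V'' \<times> W'"
      using V''(4) by (subst inv_semidirect) auto
  next
    fix x y assume "x \<in> V'' \<times> W'" "y \<in> V'' \<times> W'"
    then show "x \<otimes>\<^bsub>G\<^esub> y \<in> V'' \<times> W'"
      using V''(4) by auto
  next
    show "V'' \<times> W' \<noteq> {}"
      using V''.one_closed W'.one_closed by blast
  qed auto
  moreover have "openin (topo G) (V'' \<times> W')"
    using V''(2) W'(2) by (simp add: openin_prod_Times_iff)
  moreover have "V'' \<times> W' \<subseteq> V \<times> W"
    using V'(3) V''(3) W'(3) by auto
  ultimately show "\<exists>H. subgroup H G \<and> openin (topo G) H \<and> H \<subseteq> U"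
    using VW(5) by blast
next
  fix M x assume M: "M \<lhd> G" "openin (topo G) M" and x: "x \<in> carrier G"
  interpret M: normal M G by fact
  interpret q: group_hom G "G Mod M" "\<lambda>x. M #>\<^bsub>G\<^esub> x"
    using M.r_coset_hom_Mod M.factorgroup_is_group G.group_axioms
    by (simp add: group_hom_def group_hom_axioms_def)
  interpret i: group_hom N G "\<lambda>v. (v, \<one>\<^bsub>H\<^esub>)"
    by unfold_locales (auto simp: hom_def)
  interpret j: group_hom H G "\<lambda>h. (\<one>\<^bsub>N\<^esub>, h)"
    by unfold_locales (auto simp: hom_def)
  interpret p: group_hom G H snd
    by unfold_locales (auto simp: hom_def)
  have "continuous_map (topo N) (topo G) (\<lambda>v. (v, \<one>\<^bsub>H\<^esub>))" "continuous_map (topo H) (topo G) (\<lambda>h. (\<one>\<^bsub>N\<^esub>, h))"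
    unfolding semidirect_simps
    by (auto intro!: continuous_map_pairedI N.continuous_map_const_carrier H.continuous_map_const_carrier
        continuous_map_id[unfolded id_def])
  then have "openin (topo N) {v \<in> topspace (topo N). (v, \<one>\<^bsub>H\<^esub>) \<in> M}"
    "openin (topo H) {h \<in> topspace (topo H). (\<one>\<^bsub>N\<^esub>, h) \<in> M}"
    using M(2) by (auto intro: openin_continuous_map_preimage)
  then have open_N: "openin (topo N) {v \<in> carrier N. (v, \<one>\<^bsub>H\<^esub>) \<in> M}"
    and open_H: "openin (topo H) {h \<in> carrier H. (\<one>\<^bsub>N\<^esub>, h) \<in> M}"
    by (simp_all add: N.topspace_topo H.topspace_topo)
  have "snd x \<in> carrier H" using x by auto
  then obtain a where a: "snd x [^]\<^bsub>H\<^esub> ((2::nat) ^ a) \<in> {h \<in> carrier H. (\<one>\<^bsub>N\<^esub>, h) \<in> M}"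
    using H.open_subgroup_two_power[OF j.subgroup_vimage[OF M.subgroup_axioms] open_H] by blast
  \<comment> \<open>After the 2^a-th power the \<open>H\<close>-part lies in \<open>M\<close>.
    Modulo \<open>M\<close> the element \<open>y\<close> then equals its \<open>N\<close>-part, for
    which a further 2^b-th power suffices.\<close>
  define y where "y = x [^]\<^bsub>G\<^esub> ((2::nat) ^ a)"
  have y: "y \<in> carrier G" using x by (simp add: y_def del: semidirect_simps)
  have "snd y = snd x [^]\<^bsub>H\<^esub> ((2::nat) ^ a)"
    unfolding y_def by (rule p.hom_nat_pow[OF x])
  then have snd_y: "snd y \<in> carrier H" "(\<one>\<^bsub>N\<^esub>, snd y) \<in> M" using a by auto
  have fst_y: "fst y \<in> carrier N" using y by auto
  obtain b where "fst y [^]\<^bsub>N\<^esub> ((2::nat) ^ b) \<in> {v \<in> carrier N. (v, \<one>\<^bsub>H\<^esub>) \<in> M}"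
    using N.open_subgroup_two_power[OF i.subgroup_vimage[OF M.subgroup_axioms] open_N fst_y] by blast
  then have b: "(fst y, \<one>\<^bsub>H\<^esub>) [^]\<^bsub>G\<^esub> ((2::nat) ^ b) \<in> M"
    using i.hom_nat_pow[OF fst_y] by simp
  have iy: "(fst y, \<one>\<^bsub>H\<^esub>) \<in> carrier G" and jy: "(\<one>\<^bsub>N\<^esub>, snd y) \<in> carrier G"
    using fst_y snd_y by auto
  have "y = (fst y, \<one>\<^bsub>H\<^esub>) \<otimes>\<^bsub>G\<^esub> (\<one>\<^bsub>N\<^esub>, snd y)"
    using fst_y snd_y by simp
  then have "M #>\<^bsub>G\<^esub> y = (M #>\<^bsub>G\<^esub> (fst y, \<one>\<^bsub>H\<^esub>)) \<otimes>\<^bsub>G Mod M\<^esub> (M #>\<^bsub>G\<^esub> (\<one>\<^bsub>N\<^esub>, snd y))"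
    using q.hom_mult[OF iy jy] by metis
  also have "M #>\<^bsub>G\<^esub> (\<one>\<^bsub>N\<^esub>, snd y) = \<one>\<^bsub>G Mod M\<^esub>"
    using M.rcos_const[OF G.group_axioms snd_y(2)] by simp
  finally have "M #>\<^bsub>G\<^esub> y = M #>\<^bsub>G\<^esub> (fst y, \<one>\<^bsub>H\<^esub>)"
    using q.hom_closed[OF iy] by (metis q.H.r_one)
  then have "M #>\<^bsub>G\<^esub> (y [^]\<^bsub>G\<^esub> ((2::nat) ^ b)) = M #>\<^bsub>G\<^esub> ((fst y, \<one>\<^bsub>H\<^esub>) [^]\<^bsub>G\<^esub> ((2::nat) ^ b))"
    using q.hom_nat_pow[OF y] q.hom_nat_pow[OF iy] by metis
  also have "\<dots> = M"
    using M.rcos_const[OF G.group_axioms b] .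
  finally have "y [^]\<^bsub>G\<^esub> ((2::nat) ^ b) \<in> M"
    using G.coset_join1[OF _ _ M.subgroup_axioms] M.subset G.nat_pow_closed[OF y] by metis
  then have "x [^]\<^bsub>G\<^esub> ((2::nat) ^ (a + b)) \<in> M"
    using x by (simp add: y_def G.nat_pow_pow power_add del: semidirect_simps)
  then show "\<exists>k. x [^]\<^bsub>G\<^esub> ((2::nat) ^ k) \<in> M" ..
qed

end

section \<open>The semi-trivial action\<close>

lemma x0_cases:
  assumes "t \<in> carrier Delta"
  obtains "t = 0" "t \<noteq> x0" | "t = 1" "t = x0"
  using assms by (auto simp: carrier_Delta x0_def)

text \<open>The two cases hold on complementary clopen sets, since \<open>p\<close> maps
  continuously to a discrete space. The proof uses \<open>{c} \<inter> S\<close> because only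
  subsets of \<open>S\<close> are open there, and \<open>c\<close> may lie outside.\<close>

lemma continuous_map_if_discrete:
  assumes "continuous_map T (discrete_topology S) p" "continuous_map T Y f" "continuous_map T Y g"
  shows "continuous_map T Y (\<lambda>x. if p x = c then f x else g x)"
proof -
  have "continuous_map T Y (\<lambda>x. if p x \<in> {c} \<inter> S then f x else g x)"
    using assms by (intro continuous_map_cases_function[OF assms(1)] continuous_map_from_subtopology) auto
  then show ?thesis
    by (rule continuous_map_eq) (use continuous_map_image_subset_topspace[OF assms(1)] in auto)
qed

lemma semi_trivial_apply:
  "g \<in> carrier P \<Longrightarrow> v \<in> carrier A \<Longrightarrow>
    semi_trivial P A g v = (if snd g = x0 then inv\<^bsub>A\<^esub> v else v)"
  by (simp add: semi_trivial_def)

text \<open>Commutativity makes inversion an endomorphism, and being an involution it respects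
  addition modulo 2. Continuity is piecewise, over the two values of the \<Delta>-component.\<close>

lemma continuous_action_semi_trivial:
  assumes "pro2_semidirect N Delta \<delta>" "topological_group A"
    and abelian: "\<And>v w. v \<in> carrier A \<Longrightarrow> w \<in> carrier A \<Longrightarrow> v \<otimes>\<^bsub>A\<^esub> w = w \<otimes>\<^bsub>A\<^esub> v"
  shows "continuous_action (semidirect N Delta \<delta>) A (semi_trivial (semidirect N Delta \<delta>) A)"
proof -
  let ?P = "semidirect N Delta \<delta>"
  interpret P: pro2_semidirect N Delta \<delta> by fact
  interpret A: topological_group A by fact
  note [simp] = semi_trivial_apply
  show ?thesis
  proof (rule continuous_actionI[OF P.G.group_axioms A.group_axioms])
    fix h v w assume h: "h \<in> carrier ?P" and v: "v \<in> carrier A"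
    show "semi_trivial ?P A h v \<in> carrier A"
      using h v by (simp del: semidirect_simps)
    show "semi_trivial ?P A h (v \<otimes>\<^bsub>A\<^esub> w) = semi_trivial ?P A h v \<otimes>\<^bsub>A\<^esub> semi_trivial ?P A h w"
      if w: "w \<in> carrier A"
      using h v w abelian[of "inv\<^bsub>A\<^esub> v" "inv\<^bsub>A\<^esub> w"] by (simp add: A.inv_mult_group del: semidirect_simps)
  next
    fix h assume "h \<in> carrier ?P"
    then show "semi_trivial ?P A h \<in> extensional (carrier A)"
      by (simp add: semi_trivial_def)
  next
    fix v assume "v \<in> carrier A"
    then show "semi_trivial ?P A \<one>\<^bsub>?P\<^esub> v = v"
      using P.G.one_closed by (simp del: semidirect_simps(1)) (simp add: x0_def)
  next
    fix g h v assume g: "g \<in> carrier ?P" and h: "h \<in> carrier ?P" and v: "v \<in> carrier A"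
    have "snd (g \<otimes>\<^bsub>?P\<^esub> h) = (snd g + snd h) mod 2" by simp
    moreover have "snd g \<in> carrier Delta" "snd h \<in> carrier Delta"
      using g h by auto
    ultimately show "semi_trivial ?P A (g \<otimes>\<^bsub>?P\<^esub> h) v = semi_trivial ?P A g (semi_trivial ?P A h v)"
      using P.G.m_closed[OF g h] g h v
      by (auto simp del: semidirect_simps elim!: x0_cases)
  next
    let ?T = "prod_topology (topo ?P) (topo A)"
    have fst: "continuous_map ?T (topo Delta) (\<lambda>z. snd (fst z))"
      using continuous_map_compose[OF continuous_map_fst continuous_map_snd]
      by (simp add: o_def del: Delta_simps)
    have "continuous_map ?T (topo A) (\<lambda>z. if snd (fst z) = x0 then inv\<^bsub>A\<^esub> snd z else snd z)"
      using fst unfolding Delta_simps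
      by (rule continuous_map_if_discrete) (intro A.continuous_map_m_inv continuous_map_snd)+
    then show "continuous_map ?T (topo A) (\<lambda>(h, v). semi_trivial ?P A h v)"
      by (rule continuous_map_eq) (auto simp: P.G.topspace_topo A.topspace_topo simp del: semidirect_simps)
  qed
qed

section \<open>Complete graphs and commutativity\<close>

lemma is_graph_complete_graph: "is_graph (complete_graph n)"
  by (simp add: is_graph_def complete_graph_def)

lemma complete_graph_simps [simp]:
  "nverts (complete_graph n) = n" "edges (complete_graph n) = pairs n"
  by (simp_all add: complete_graph_def)

lemma id_continuous_hom: "group G \<Longrightarrow> (\<lambda>x. x) \<in> continuous_hom G G"
  by (simp add: continuous_hom_def hom_def continuous_map_id[unfolded id_def] group.is_monoid monoid.m_closed)

text \<open>\<open>raag_hom_commute\<close> is applied twice to the identity map: a generator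
  commutes with all generators, hence with every element; so a given element commutes with all
  generators, hence with every element. Equal generators are a separate case, as a graph has no
  loops.\<close>

lemma raag_complete_graph_commute:
  assumes "x \<in> carrier (raag (complete_graph n))" "y \<in> carrier (raag (complete_graph n))"
  shows "x \<otimes>\<^bsub>raag (complete_graph n)\<^esub> y = y \<otimes>\<^bsub>raag (complete_graph n)\<^esub> x"
proof -
  let ?K = "complete_graph n"
  note K = is_graph_complete_graph[of n]
  interpret pro2_group "raag ?K" by (rule pro2_group_raag[OF K])
  have gens: "raag_gen ?K i \<otimes>\<^bsub>raag ?K\<^esub> raag_gen ?K j = raag_gen ?K j \<otimes>\<^bsub>raag ?K\<^esub> raag_gen ?K i"
    if "i \<in> {1..n}" "j \<in> {1..n}" for i j
  proof (cases "i = j")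
    case False
    then have "{i, j} \<in> edges ?K"
      using that by (auto simp: pairs_def)
    then show ?thesis by (rule raag_gen_commute[OF K])
  qed simp
  have "z \<otimes>\<^bsub>raag ?K\<^esub> raag_gen ?K j = raag_gen ?K j \<otimes>\<^bsub>raag ?K\<^esub> z"
    if "z \<in> carrier (raag ?K)" "j \<in> {1..n}" for z j
    using raag_hom_commute[OF K pro2_group_axioms id_continuous_hom[OF group_axioms] _ _ that(1)]
      raag_gen_closed[OF K] gens that(2) by simp
  then show ?thesis
    using raag_hom_commute[OF K pro2_group_axioms id_continuous_hom[OF group_axioms] assms(2) _ assms(1)] assms(2)
    by simp
qed

text \<open>The subgroup is the union of the translates of \<open>U\<close> by its own
  elements.\<close>

lemma (in topological_group) openin_subgroup_if_nbhd:
  assumes "subgroup S G" "openin (topo G) U" "\<one> \<in> U" "U \<subseteq> S"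
  shows "openin (topo G) S"
proof -
  interpret S: subgroup S G by fact
  have "S = (\<Union>s\<in>S. U #> s)"
  proof (intro equalityI subsetI)
    fix s assume "s \<in> S"
    then have "s \<in> U #> s"
      using assms(3) by (force simp: r_coset_def)
    then show "s \<in> (\<Union>s\<in>S. U #> s)"
      using \<open>s \<in> S\<close> by blast
  qed (use assms(4) in \<open>auto simp: r_coset_def\<close>)
  moreover have "openin (topo G) (\<Union>s\<in>S. U #> s)"
  proof (rule openin_Union)
    fix V assume "V \<in> (\<lambda>s. U #> s) ` S"
    then show "openin (topo G) V"
      using assms(2) openin_r_coset S.mem_carrier by auto
  qed
  ultimately show ?thesis by metis
qed

section \<open>The right-angled Artin group of a complete graph\<close>

text \<open>The residues of the integer 1; the entry at \<open>k = 0\<close> is 0, because the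
  modulus is 1.\<close>

definition Z2_one :: "nat \<Rightarrow> int" where
  "Z2_one = (\<lambda>k. 1 mod 2 ^ k)"

lemma Z2_one_carrier: "Z2_one \<in> Z2_carrier"
  unfolding Z2_carrier_iff Z2_one_def mod_2power_mod by simp

interpretation Z2: pro2_group Z2
  by (rule pro2_group_Z2)

lemma Z2_simps [simp]:
  "carrier Z2 = Z2_carrier"
  "(a \<otimes>\<^bsub>Z2\<^esub> b) k = (a k + b k) mod 2 ^ k"
  "\<one>\<^bsub>Z2\<^esub> k = 0"
  by (simp_all add: Z2_eq)

locale complete_raag =
  fixes n :: nat
begin

abbreviation "C \<equiv> raag (complete_graph n)"
abbreviation "gen \<equiv> raag_gen (complete_graph n)"

sublocale C: pro2_group C
  by (rule pro2_group_raag[OF is_graph_complete_graph])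

sublocale C: comm_group C
  using raag_complete_graph_commute by (intro C.group_comm_groupI)

lemma gen_closed [simp]: "i \<in> {1..n} \<Longrightarrow> gen i \<in> carrier C"
  using raag_gen_closed[OF is_graph_complete_graph] by simp

text \<open>The homomorphism dual to the generator \<open>j\<close>, which reads off its 2-adic
  exponent. It exists by the universal property, \<open>Z2\<close> being abelian, and its values on
  the carrier do not depend on the choice by \<open>SOME\<close>.\<close>

definition coord :: "nat \<Rightarrow> raag_elem \<Rightarrow> nat \<Rightarrow> int" where
  "coord j = (SOME f. f \<in> continuous_hom C Z2 \<and>
     (\<forall>i\<in>{1..n}. f (gen i) = (if i = j then Z2_one else \<one>\<^bsub>Z2\<^esub>)))"

lemma coord: "coord j \<in> continuous_hom C Z2"
  "i \<in> {1..n} \<Longrightarrow> coord j (gen i) = (if i = j then Z2_one else \<one>\<^bsub>Z2\<^esub>)"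
proof -
  have comm: "(if i = j then Z2_one else \<one>\<^bsub>Z2\<^esub>) \<otimes>\<^bsub>Z2\<^esub> (if i' = j then Z2_one else \<one>\<^bsub>Z2\<^esub>)
      = (if i' = j then Z2_one else \<one>\<^bsub>Z2\<^esub>) \<otimes>\<^bsub>Z2\<^esub> (if i = j then Z2_one else \<one>\<^bsub>Z2\<^esub>)" for i i'
    by (auto simp: fun_eq_iff add.commute)
  have "\<exists>f\<in>continuous_hom C Z2. \<forall>i\<in>{1..nverts (complete_graph n)}.
      f (gen i) = (if i = j then Z2_one else \<one>\<^bsub>Z2\<^esub>)"
    using Z2_one_carrier Z2.one_closed
    by (intro raag_universal is_graph_complete_graph pro2_group_Z2 comm) auto
  then have "\<exists>f. f \<in> continuous_hom C Z2 \<and>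
      (\<forall>i\<in>{1..n}. f (gen i) = (if i = j then Z2_one else \<one>\<^bsub>Z2\<^esub>))"
    by (auto simp only: complete_graph_simps)
  then have "coord j \<in> continuous_hom C Z2 \<and>
      (\<forall>i\<in>{1..n}. coord j (gen i) = (if i = j then Z2_one else \<one>\<^bsub>Z2\<^esub>))"
    unfolding coord_def by (rule someI_ex)
  then show "coord j \<in> continuous_hom C Z2"
    "i \<in> {1..n} \<Longrightarrow> coord j (gen i) = (if i = j then Z2_one else \<one>\<^bsub>Z2\<^esub>)"
    by auto
qed

lemma coord_hom: "group_hom C Z2 (coord j)"
  by (intro group_hom_continuous_hom coord C.group_axioms Z2.group_axioms)

lemma coord_closed: "x \<in> carrier C \<Longrightarrow> coord j x \<in> Z2_carrier"
  using group_hom.hom_closed[OF coord_hom] by simp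

lemma residue_hom: "group_hom C (integer_mod_group (2 ^ k)) (\<lambda>x. coord j x k)"
proof -
  interpret c: group_hom C Z2 "coord j" by (rule coord_hom)
  show ?thesis
  proof (unfold group_hom_def group_hom_axioms_def, intro conjI C.group_axioms group_integer_mod_group homI)
    fix x assume "x \<in> carrier C"
    then show "coord j x k \<in> carrier (integer_mod_group (2 ^ k))"
      using coord_closed[of x j] by (simp add: Z2_carrier_iff carrier_integer_mod_2power)
  qed simp
qed

lemma residue_continuous:
  "continuous_map (topo C) (discrete_topology (carrier (integer_mod_group (2 ^ k)))) (\<lambda>x. coord j x k)"
proof -
  have "continuous_map (topo Z2) (discrete_topology (carrier (integer_mod_group (2 ^ k)))) (\<lambda>a. a k)"
    unfolding Z2_eq product_subgroup_simps
    by (auto intro!: continuous_map_from_subtopology continuous_map_product_projection)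
  from continuous_map_compose[OF continuous_homD(2)[OF coord(1)] this] show ?thesis
    by (simp add: o_def)
qed

text \<open>The exponents are integers and not 2-adic integers: ordinary monomials already meet
  every coset of an open subgroup.\<close>

definition monomial :: "(nat \<Rightarrow> int) \<Rightarrow> raag_elem" where
  "monomial m = finprod C (\<lambda>j. gen j [^]\<^bsub>C\<^esub> m j) {1..n}"

lemma monomial_closed [simp]: "monomial m \<in> carrier C"
  unfolding monomial_def by (intro C.finprod_closed) auto

lemma monomial_add: "monomial (\<lambda>j. m j + m' j) = monomial m \<otimes>\<^bsub>C\<^esub> monomial m'"
proof -
  have "monomial (\<lambda>j. m j + m' j) = finprod C (\<lambda>j. gen j [^]\<^bsub>C\<^esub> m j \<otimes>\<^bsub>C\<^esub> gen j [^]\<^bsub>C\<^esub> m' j) {1..n}"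
    unfolding monomial_def by (rule C.finprod_cong') (auto simp: C.int_pow_mult)
  then show ?thesis
    unfolding monomial_def by (subst (asm) C.finprod_multf) auto
qed

lemma monomial_zero: "monomial (\<lambda>j. 0) = \<one>\<^bsub>C\<^esub>"
  unfolding monomial_def by (intro C.finprod_one_eqI) simp

lemma monomial_gen: "i \<in> {1..n} \<Longrightarrow> monomial (\<lambda>j. if j = i then 1 else 0) = gen i"
proof -
  assume i: "i \<in> {1..n}"
  have "monomial (\<lambda>j. if j = i then 1 else 0) = finprod C (\<lambda>j. if i = j then gen j else \<one>\<^bsub>C\<^esub>) {1..n}"
    unfolding monomial_def by (rule C.finprod_cong') auto
  also have "\<dots> = gen i"
    using i by (intro C.finprod_singleton) auto
  finally show ?thesis .
qed

text \<open>\<open>coord i\<close> is dual to the generators, so only the factor with index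
  \<open>i\<close> contributes.\<close>

lemma residue_monomial:
  assumes "i \<in> {1..n}"
  shows "coord i (monomial m) k = m i mod 2 ^ k"
proof -
  interpret c: group_hom C "integer_mod_group (2 ^ k)" "\<lambda>x. coord i x k" by (rule residue_hom)
  have "coord i (finprod C (\<lambda>j. gen j [^]\<^bsub>C\<^esub> m j) J) k = (if i \<in> J then m i mod 2 ^ k else 0)"
    if "finite J" "J \<subseteq> {1..n}" for J
    using that
  proof (induction J)
    case empty
    then show ?case using c.hom_one by simp
  next
    case (insert j J)
    then have j: "j \<in> {1..n}" and J: "J \<subseteq> {1..n}" by auto
    have "coord i (gen j [^]\<^bsub>C\<^esub> m j) k = (m j * coord i (gen j) k) mod 2 ^ k"
      using c.hom_int_pow[OF gen_closed[OF j]] by (simp add: int_pow_integer_mod_group)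
    also have "\<dots> = (if i = j then m i mod 2 ^ k else 0)"
      using coord(2)[OF j] by (simp add: Z2_one_def mod_mult_right_eq)
    finally have gen: "coord i (gen j [^]\<^bsub>C\<^esub> m j) k = (if i = j then m i mod 2 ^ k else 0)" .
    have "finprod C (\<lambda>j. gen j [^]\<^bsub>C\<^esub> m j) J \<in> carrier C"
      using J by (intro C.finprod_closed) auto
    moreover have "finprod C (\<lambda>j. gen j [^]\<^bsub>C\<^esub> m j) (insert j J)
        = gen j [^]\<^bsub>C\<^esub> m j \<otimes>\<^bsub>C\<^esub> finprod C (\<lambda>j. gen j [^]\<^bsub>C\<^esub> m j) J"
      using insert.hyps j J by (intro C.finprod_insert) auto
    moreover have "gen j [^]\<^bsub>C\<^esub> m j \<in> carrier C"
      using j by simp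
    ultimately show ?case
      using insert.IH[OF J] insert.hyps(2) gen by (auto simp: c.hom_mult)
  qed
  then show ?thesis
    unfolding monomial_def using assms by simp
qed

text \<open>Modulo an open normal subgroup \<open>N\<close> of index \<open>2 ^ k\<close>, every element is a monomial in the
  generators, and the exponents modulo \<open>2 ^ k\<close>, which are all that matters, are its coordinates.\<close>

lemma eq_one_if_coords_zero:
  assumes x: "x \<in> carrier C" and zero: "\<And>j. j \<in> {1..n} \<Longrightarrow> coord j x = \<one>\<^bsub>Z2\<^esub>"
  shows "x = \<one>\<^bsub>C\<^esub>"
proof (rule C.in_all_open_normal[OF x])
  fix N assume N: "N \<lhd> C" "openin (topo C) N"
  interpret N: normal N C by fact
  obtain k where k: "card (rcosets\<^bsub>C\<^esub> N) = 2 ^ k"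
    using C.open_normal_index[OF N] by blast
  \<comment> \<open>By Lagrange's theorem in the quotient, the exponent \<open>k\<close> of the
    index works for every element. The same \<open>k\<close> then serves as the precision to which
    coordinates are read.\<close>
  have pow: "y [^]\<^bsub>C\<^esub> ((2::nat) ^ k) \<in> N" if y: "y \<in> carrier C" for y
  proof -
    interpret Q: group "C Mod N" by (rule N.factorgroup_is_group)
    have "N #>\<^bsub>C\<^esub> y \<in> carrier (C Mod N)"
      using y by (auto simp: carrier_FactGroup)
    from Q.pow_order_eq_1[OF this] have "N #>\<^bsub>C\<^esub> (y [^]\<^bsub>C\<^esub> ((2::nat) ^ k)) = N"
      using k by (simp add: order_def N.FactGroup_pow[OF y]) (simp add: FactGroup_def N.FactGroup_pow[OF y, unfolded FactGroup_def])
    then show ?thesis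
      using C.coset_join1[OF _ _ N.subgroup_axioms] y by (metis C.nat_pow_closed N.subset)
  qed
  \<comment> \<open>\<open>N\<close> is cut down so that the coordinates of its elements vanish
    modulo 2^k. Multiplying a monomial by an element of \<open>M\<close> then leaves its coordinates
    modulo 2^k unchanged.\<close>
  define M where "M = N \<inter> (\<Inter>j\<in>{1..n}. {y \<in> carrier C. coord j y k \<in> {0}})"
  have MD: "y \<in> N" "j \<in> {1..n} \<Longrightarrow> coord j y k = 0" if "y \<in> M" for y j
    using that unfolding M_def by blast+
  \<comment> \<open>\<open>S\<close> turns out to be an open, hence closed, subgroup that contains
    the generators, and so the whole group.\<close>
  define S where "S = {v \<otimes>\<^bsub>C\<^esub> monomial m | v m. v \<in> M}"
  have M: "subgroup M C"
  \<comment> \<open>For \<open>n = 0\<close> the intersection over the coordinates is the whole type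
    and not a subgroup, so \<open>M\<close> has to be treated directly as \<open>N\<close>.\<close>
  proof (cases "n = 0")
    case False
    have "subgroup {y \<in> carrier C. coord j y k \<in> {0}} C" for j
    proof -
      interpret c: group_hom C "integer_mod_group (2 ^ k)" "\<lambda>x. coord j x k" by (rule residue_hom)
      show ?thesis
        using c.subgroup_vimage[OF c.H.triv_subgroup] by simp
    qed
    then have "subgroup (\<Inter>j\<in>{1..n}. {y \<in> carrier C. coord j y k \<in> {0}}) C"
      using False by (intro C.subgroups_Inter) auto
    then show ?thesis
      unfolding M_def by (intro C.subgroups_Inter_pair N.subgroup_axioms)
  next
    case True
    then have "M = N" by (simp add: M_def)
    then show ?thesis by (simp only: N.subgroup_axioms)
  qed
  interpret M: subgroup M C by fact
  have "openin (topo C) {y \<in> topspace (topo C). coord j y k \<in> {0}}" for j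
    by (rule openin_continuous_map_preimage[OF residue_continuous]) (simp add: carrier_integer_mod_2power)
  then have "openin (topo C) ((\<Inter>j\<in>{1..n}. {y \<in> carrier C. coord j y k \<in> {0}}) \<inter> topspace (topo C))"
    unfolding C.topspace_topo[symmetric] by (intro openin_INT) auto
  moreover have "M = N \<inter> ((\<Inter>j\<in>{1..n}. {y \<in> carrier C. coord j y k \<in> {0}}) \<inter> topspace (topo C))"
    unfolding M_def C.topspace_topo using N.subset by blast
  ultimately have M_open: "openin (topo C) M"
    by (simp only: openin_Int N(2))
  have S_sub: "S \<subseteq> carrier C"
    by (auto simp: S_def)
  have SI: "v \<otimes>\<^bsub>C\<^esub> monomial m \<in> S" if "v \<in> M" for v m
    using that by (auto simp: S_def)
  have MS: "M \<subseteq> S"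
  proof
    fix v assume "v \<in> M"
    then show "v \<in> S"
      using SI[of v "\<lambda>j. 0"] by (simp add: monomial_zero)
  qed
  have S: "subgroup S C"
  proof (rule C.subgroupI)
    show "S \<noteq> {}" using MS M.one_closed by blast
    fix a assume "a \<in> S"
    then obtain v m where a: "a = v \<otimes>\<^bsub>C\<^esub> monomial m" "v \<in> M" by (auto simp: S_def)
    have "monomial m \<otimes>\<^bsub>C\<^esub> monomial (\<lambda>j. - m j) = \<one>\<^bsub>C\<^esub>"
      using monomial_add[of m "\<lambda>j. - m j"] by (simp add: monomial_zero)
    then have "inv\<^bsub>C\<^esub> monomial m = monomial (\<lambda>j. - m j)"
      by (metis C.inv_equality C.m_comm monomial_closed)
    then have "inv\<^bsub>C\<^esub> a = inv\<^bsub>C\<^esub> v \<otimes>\<^bsub>C\<^esub> monomial (\<lambda>j. - m j)"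
      using a by (simp add: C.inv_mult)
    then show "inv\<^bsub>C\<^esub> a \<in> S"
      using SI a by simp
    fix b assume "b \<in> S"
    then obtain w m' where b: "b = w \<otimes>\<^bsub>C\<^esub> monomial m'" "w \<in> M" by (auto simp: S_def)
    have "a \<otimes>\<^bsub>C\<^esub> b = (v \<otimes>\<^bsub>C\<^esub> w) \<otimes>\<^bsub>C\<^esub> monomial (\<lambda>j. m j + m' j)"
      using a b by (simp add: monomial_add C.m_ac)
    then show "a \<otimes>\<^bsub>C\<^esub> b \<in> S"
      using SI a b by simp
  qed (rule S_sub)
  have "gen i \<in> S" if "i \<in> {1..n}" for i
    using SI[OF M.one_closed, of "\<lambda>j. if j = i then 1 else 0"] that by (simp add: monomial_gen)
  moreover have "closedin (topo C) S"
    using C.closedin_open_subgroup[OF C.openin_subgroup_if_nbhd[OF S M_open M.one_closed MS] S] .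
  ultimately have "S = carrier C"
    using raag_generated[OF is_graph_complete_graph S] by simp
  then have "x \<in> S" using x by simp
  then obtain v m where v: "x = v \<otimes>\<^bsub>C\<^esub> monomial m" "v \<in> M"
    by (auto simp: S_def)
  \<comment> \<open>\<open>x\<close> and \<open>v\<close> have trivial \<open>j\<close>-th
    coordinate modulo 2^k, so 2^k divides \<open>m j\<close>, and the 2^k-th power of the generator
    lies in \<open>N\<close>.\<close>
  have "gen j [^]\<^bsub>C\<^esub> m j \<in> N" if j: "j \<in> {1..n}" for j
  proof -
    interpret c: group_hom C "integer_mod_group (2 ^ k)" "\<lambda>x. coord j x k" by (rule residue_hom)
    have "coord j v k = 0" by (rule MD(2)[OF v(2) j])
    moreover have "coord j (v \<otimes>\<^bsub>C\<^esub> monomial m) k = 0"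
      using zero[OF j] by (simp flip: v(1))
    ultimately have "m j mod 2 ^ k = 0"
      using c.hom_mult[of v "monomial m"] v(2) residue_monomial[OF j, of m k] by simp
    then obtain l where l: "m j = int (2 ^ k) * l"
      by auto
    have "gen j [^]\<^bsub>C\<^esub> m j = (gen j [^]\<^bsub>C\<^esub> int (2 ^ k)) [^]\<^bsub>C\<^esub> l"
      unfolding l using gen_closed[OF j] by (simp add: C.int_pow_pow)
    also have "gen j [^]\<^bsub>C\<^esub> int (2 ^ k) = gen j [^]\<^bsub>C\<^esub> ((2::nat) ^ k)"
      by (rule int_pow_int)
    finally show ?thesis
      using pow[OF gen_closed[OF j]] C.subgroup_int_pow_closed[OF N.subgroup_axioms] by simp
  qed
  moreover have "finprod C (\<lambda>j. gen j [^]\<^bsub>C\<^esub> m j) J \<in> N"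
    if "finite J" "J \<subseteq> {1..n}" "\<And>j. j \<in> {1..n} \<Longrightarrow> gen j [^]\<^bsub>C\<^esub> m j \<in> N" for J
    using that(1,2)
  proof (induction J)
    case (insert j J)
    have "finprod C (\<lambda>j. gen j [^]\<^bsub>C\<^esub> m j) (insert j J)
        = gen j [^]\<^bsub>C\<^esub> m j \<otimes>\<^bsub>C\<^esub> finprod C (\<lambda>j. gen j [^]\<^bsub>C\<^esub> m j) J"
      using insert.hyps insert.prems by (intro C.finprod_insert) auto
    then show ?case
      using insert that(3) by simp
  qed simp
  ultimately have "monomial m \<in> N"
    unfolding monomial_def by blast
  then show "x \<in> N"
    using v MD(1)[OF v(2)] by simp
qed

text \<open>\<open>A k\<close> is the set of solutions modulo 2^k. It is nonempty, since the
  residues \<open>a j k\<close> are integers and can be used as exponents of a monomial; the sets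
  are closed and decrease with \<open>k\<close>, so compactness gives a common point.\<close>

lemma coords_surj:
  assumes a: "\<And>j. j \<in> {1..n} \<Longrightarrow> a j \<in> Z2_carrier"
  shows "\<exists>x\<in>carrier C. \<forall>j\<in>{1..n}. coord j x = a j"
proof -
  define A where "A k = {x \<in> carrier C. \<forall>j\<in>{1..n}. coord j x k = a j k}" for k
  have "closedin (topo C) (A k)" for k
  proof (cases "n = 0")
    case False
    have "closedin (topo C) {x \<in> topspace (topo C). coord j x k \<in> {a j k}}" if "j \<in> {1..n}" for j
      by (rule closedin_continuous_map_preimage[OF residue_continuous])
        (use a[OF that] in \<open>simp add: carrier_integer_mod_2power Z2_carrier_iff\<close>)
    moreover have "1 \<in> {1..n}" using False by simp
    then have "A k = (\<Inter>j\<in>{1..n}. {x \<in> topspace (topo C). coord j x k \<in> {a j k}})"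
      unfolding A_def C.topspace_topo by blast
    ultimately show ?thesis
      using False by (auto intro!: closedin_INT)
  next
    case True
    then have "{1..n} = {}" by simp
    then have "A k = topspace (topo C)"
      unfolding A_def C.topspace_topo by blast
    then show ?thesis by (simp only: closedin_topspace)
  qed
  moreover have "A k \<noteq> {}" for k
  proof -
    have "coord j (monomial (\<lambda>j. a j k)) k = a j k" if "j \<in> {1..n}" for j
      using residue_monomial[OF that] a[OF that] by (simp add: Z2_carrier_iff)
    then have "monomial (\<lambda>j. a j k) \<in> A k"
      by (simp add: A_def)
    then show ?thesis by blast
  qed
  moreover have "decseq A"
  proof (rule decseq_SucI, rule subsetI)
    fix k x assume x: "x \<in> A (Suc k)"
    then have xC: "x \<in> carrier C" by (simp add: A_def)
    have "coord j x k = a j k" if j: "j \<in> {1..n}" for j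
    proof -
      have "coord j x (Suc k) mod 2 ^ k = a j (Suc k) mod 2 ^ k"
        using x j by (simp add: A_def)
      then show ?thesis
        using coord_closed[OF xC, of j] a[OF j] by (simp add: Z2_carrier_iff)
    qed
    then show "x \<in> A k"
      using xC by (simp add: A_def)
  qed
  ultimately have "(\<Inter>k. A k) \<noteq> {}"
    by (intro compact_space_imp_nest[OF C.compact])
  then obtain x where "x \<in> (\<Inter>k. A k)" by blast
  then show ?thesis
    by (auto simp: A_def fun_eq_iff intro!: bexI[of _ x])
qed

lemma Z2_power_simps [simp]:
  "carrier (Z2_power n) = (\<Pi>\<^sub>E j\<in>{1..n}. Z2_carrier)"
  "f \<otimes>\<^bsub>Z2_power n\<^esub> g = (\<lambda>j\<in>{1..n}. f j \<otimes>\<^bsub>Z2\<^esub> g j)"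
  "topo (Z2_power n) = product_topology (\<lambda>_. topo Z2) {1..n}"
  by (simp_all add: Z2_power_def)

text \<open>A continuous bijection from a compact space to a Hausdorff space is a homeomorphism, so
  no continuous inverse has to be constructed.\<close>

theorem raag_complete_graph_iso: "C \<simeq>\<^sub>t Z2_power n"
proof -
  define F where "F x = (\<lambda>j\<in>{1..n}. coord j x)" for x
  have group_Z2_power: "group (Z2_power n)"
    unfolding Z2_power_def by (intro group_with_topology product_group Z2.group_axioms)
  have F_closed: "F x \<in> carrier (Z2_power n)" if "x \<in> carrier C" for x
    using coord_closed[OF that] by (simp add: F_def)
  have "F \<in> hom C (Z2_power n)"
  proof (rule homI)
    fix x y assume "x \<in> carrier C" "y \<in> carrier C"
    then have "coord j (x \<otimes>\<^bsub>C\<^esub> y) = coord j x \<otimes>\<^bsub>Z2\<^esub> coord j y" for j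
      using group_hom.hom_mult[OF coord_hom] by blast
    then show "F (x \<otimes>\<^bsub>C\<^esub> y) = F x \<otimes>\<^bsub>Z2_power n\<^esub> F y"
      by (simp add: F_def) (rule restrict_ext, simp)
  qed (rule F_closed)
  then interpret F: group_hom C "Z2_power n" F
    using group_Z2_power by (simp add: group_hom_def group_hom_axioms_def C.group_axioms)
  have inj: "inj_on F (carrier C)"
    unfolding F.inj_iff_trivial_ker
  proof (intro equalityI subsetI)
    fix x assume "x \<in> kernel C (Z2_power n) F"
    then have x: "x \<in> carrier C" "F x = F \<one>\<^bsub>C\<^esub>"
      by (auto simp: kernel_def F.hom_one)
    have "coord j x = \<one>\<^bsub>Z2\<^esub>" if "j \<in> {1..n}" for j
      using fun_cong[OF x(2), of j] that group_hom.hom_one[OF coord_hom] by (simp add: F_def)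
    then show "x \<in> {\<one>\<^bsub>C\<^esub>}"
      using eq_one_if_coords_zero[OF x(1)] by blast
  qed (auto simp: kernel_def F.hom_one)
  have surj: "F ` carrier C = carrier (Z2_power n)"
  proof (intro equalityI subsetI)
    fix a assume a: "a \<in> carrier (Z2_power n)"
    then have "\<And>j. j \<in> {1..n} \<Longrightarrow> a j \<in> Z2_carrier"
      by (auto simp: PiE_iff)
    then obtain x where "x \<in> carrier C" "\<forall>j\<in>{1..n}. coord j x = a j"
      using coords_surj by blast
    moreover have "a \<in> extensional {1..n}"
      using a by (simp add: PiE_iff)
    ultimately have "F x = a"
      unfolding F_def by (metis restrict_ext extensional_restrict)
    then show "a \<in> F ` carrier C"
      using \<open>x \<in> carrier C\<close> by blast
  qed (use F_closed in blast)
  have T: "topspace (topo (Z2_power n)) = carrier (Z2_power n)"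
    by (simp add: Z2.topspace_topo)
  have "continuous_map (topo C) (topo (Z2_power n)) F"
    using continuous_homD(2)[OF coord(1)]
    by (simp add: continuous_map_componentwise F_def image_subset_iff)
  moreover have "Hausdorff_space (topo (Z2_power n))"
    by (simp add: Hausdorff_space_product_topology Z2.Hausdorff)
  ultimately have "homeomorphic_map (topo C) (topo (Z2_power n)) F"
    using C.compact inj surj T by (intro continuous_imp_homeomorphic_map) (simp_all only: C.topspace_topo)
  moreover have "F \<in> iso C (Z2_power n)"
    using F.homh inj surj by (simp add: iso_def bij_betw_def)
  ultimately show ?thesis
    by (auto simp: tgroup_iso_def)
qed

end

text \<open>The topological inverse also supplies the bijectivity that \<open>iso\<close> asks for,
  since the spaces live on the carriers.\<close>

lemma tgroup_isoI:
  assumes hom: "f \<in> hom G H" and maps: "homeomorphic_maps (topo G) (topo H) f g"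
    and T: "topspace (topo G) = carrier G" "topspace (topo H) = carrier H"
  shows "G \<simeq>\<^sub>t H"
proof -
  have "homeomorphic_map (topo G) (topo H) f"
    using maps homeomorphic_maps_map by blast
  then have "bij_betw f (carrier G) (carrier H)"
    unfolding T[symmetric] homeomorphic_eq_everything_map by (simp add: bij_betw_def)
  then show ?thesis
    using hom \<open>homeomorphic_map (topo G) (topo H) f\<close> by (auto simp: tgroup_iso_def iso_def)
qed

text \<open>An isomorphism commutes with inversion, so \<open>f\<close> on the first factor respects
  the twisted multiplication. This carries the iterated semidirect product over to
  \<open>Z2_power n\<close>.\<close>

lemma semidirect_semi_trivial_iso:
  assumes "A \<simeq>\<^sub>t B" "group A" "group B" "group P"
    and T: "topspace (topo A) = carrier A" "topspace (topo B) = carrier B" "topspace (topo P) = carrier P"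
  shows "semidirect A P (semi_trivial P A) \<simeq>\<^sub>t semidirect B P (semi_trivial P B)"
proof -
  obtain f where f: "f \<in> iso A B" "homeomorphic_map (topo A) (topo B) f"
    using assms(1) by (auto simp: tgroup_iso_def)
  then obtain g where g: "homeomorphic_maps (topo A) (topo B) f g"
    using homeomorphic_map_maps by blast
  interpret f: group_hom A B f
    using f(1) assms(2,3) by (simp add: group_hom_def group_hom_axioms_def iso_def)
  interpret P: group P by fact
  show ?thesis
  proof (rule tgroup_isoI)
    show "homeomorphic_maps (topo (semidirect A P (semi_trivial P A))) (topo (semidirect B P (semi_trivial P B)))
        (\<lambda>z. (f (fst z), snd z)) (\<lambda>z. (g (fst z), snd z))"
      using g unfolding semidirect_simps homeomorphic_maps_def
      by (auto intro!: continuous_map_pairedI continuous_map_snd continuous_map_compose[OF continuous_map_fst, unfolded o_def])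
    show "(\<lambda>z. (f (fst z), snd z)) \<in> hom (semidirect A P (semi_trivial P A)) (semidirect B P (semi_trivial P B))"
      by (rule homI) (auto simp: semi_trivial_apply)
  qed (simp_all add: T)
qed

section \<open>Joins and direct products\<close>

text \<open>An internal direct product, given by inclusions and projections instead of an
  isomorphism with a group of pairs: these are the maps that the universal property
  provides.\<close>

locale pro2_direct_product =
  A: pro2_group A + C: pro2_group C + R: pro2_group R
  for A :: "'a tgroup" and C :: "'c tgroup" and R :: "'r tgroup" +
  fixes \<iota> :: "'a \<Rightarrow> 'r" and \<kappa> :: "'c \<Rightarrow> 'r" and \<pi> :: "'r \<Rightarrow> 'a" and \<rho> :: "'r \<Rightarrow> 'c"
  assumes \<iota>: "\<iota> \<in> continuous_hom A R" and \<kappa>: "\<kappa> \<in> continuous_hom C R"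
    and \<pi>: "\<pi> \<in> continuous_hom R A" and \<rho>: "\<rho> \<in> continuous_hom R C"
    and \<pi>_\<iota> [simp]: "a \<in> carrier A \<Longrightarrow> \<pi> (\<iota> a) = a" and \<rho>_\<iota> [simp]: "a \<in> carrier A \<Longrightarrow> \<rho> (\<iota> a) = \<one>\<^bsub>C\<^esub>"
    and \<rho>_\<kappa> [simp]: "c \<in> carrier C \<Longrightarrow> \<rho> (\<kappa> c) = c" and \<pi>_\<kappa> [simp]: "c \<in> carrier C \<Longrightarrow> \<pi> (\<kappa> c) = \<one>\<^bsub>A\<^esub>"
    and \<iota>_\<kappa>_commute: "a \<in> carrier A \<Longrightarrow> c \<in> carrier C \<Longrightarrow> \<iota> a \<otimes>\<^bsub>R\<^esub> \<kappa> c = \<kappa> c \<otimes>\<^bsub>R\<^esub> \<iota> a"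
    and decomposition: "x \<in> carrier R \<Longrightarrow> \<iota> (\<pi> x) \<otimes>\<^bsub>R\<^esub> \<kappa> (\<rho> x) = x"
begin

sublocale \<iota>: group_hom A R \<iota>
  by (intro group_hom_continuous_hom \<iota> A.group_axioms R.group_axioms)
sublocale \<kappa>: group_hom C R \<kappa>
  by (intro group_hom_continuous_hom \<kappa> C.group_axioms R.group_axioms)
sublocale \<pi>: group_hom R A \<pi>
  by (intro group_hom_continuous_hom \<pi> R.group_axioms A.group_axioms)
sublocale \<rho>: group_hom R C \<rho>
  by (intro group_hom_continuous_hom \<rho> R.group_axioms C.group_axioms)

lemma continuous_comp:
  "continuous_map T (topo A) f \<Longrightarrow> continuous_map T (topo R) (\<lambda>x. \<iota> (f x))"
  "continuous_map T (topo C) g \<Longrightarrow> continuous_map T (topo R) (\<lambda>x. \<kappa> (g x))"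
  "continuous_map T (topo R) h \<Longrightarrow> continuous_map T (topo A) (\<lambda>x. \<pi> (h x))"
  "continuous_map T (topo R) h \<Longrightarrow> continuous_map T (topo C) (\<lambda>x. \<rho> (h x))"
  using continuous_map_compose[OF _ continuous_homD(2)[OF \<iota>]] continuous_map_compose[OF _ continuous_homD(2)[OF \<kappa>]]
    continuous_map_compose[OF _ continuous_homD(2)[OF \<pi>]] continuous_map_compose[OF _ continuous_homD(2)[OF \<rho>]]
  by (simp_all add: o_def)

lemma product_mult:
  assumes "a \<in> carrier A" "a' \<in> carrier A" "c \<in> carrier C" "c' \<in> carrier C"
  shows "(\<iota> a \<otimes>\<^bsub>R\<^esub> \<kappa> c) \<otimes>\<^bsub>R\<^esub> (\<iota> a' \<otimes>\<^bsub>R\<^esub> \<kappa> c') = \<iota> (a \<otimes>\<^bsub>A\<^esub> a') \<otimes>\<^bsub>R\<^esub> \<kappa> (c \<otimes>\<^bsub>C\<^esub> c')"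
proof -
  have "\<kappa> c \<otimes>\<^bsub>R\<^esub> (\<iota> a' \<otimes>\<^bsub>R\<^esub> \<kappa> c') = \<iota> a' \<otimes>\<^bsub>R\<^esub> (\<kappa> c \<otimes>\<^bsub>R\<^esub> \<kappa> c')"
    using assms \<iota>_\<kappa>_commute[of a' c] by (simp flip: R.m_assoc)
  then show ?thesis
    using assms by (simp add: R.m_assoc)
qed

end

text \<open>\<open>C\<close> is abelian in order that inversion on it be an automorphism.\<close>

locale Delta_direct_product = pro2_direct_product A C R \<iota> \<kappa> \<pi> \<rho>
  for A :: "'a tgroup" and C :: "'c tgroup" and R :: "'r tgroup" and \<iota> \<kappa> \<pi> \<rho> +
  fixes \<delta> :: "int \<Rightarrow> 'a \<Rightarrow> 'a"
  assumes action: "continuous_action Delta A \<delta>"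
    and abelian: "c \<in> carrier C \<Longrightarrow> c' \<in> carrier C \<Longrightarrow> c \<otimes>\<^bsub>C\<^esub> c' = c' \<otimes>\<^bsub>C\<^esub> c"
begin

sublocale P: pro2_semidirect A Delta \<delta>
  by (intro pro2_semidirect.intro A.pro2_group_axioms pro2_group_Delta pro2_semidirect_axioms.intro action)

abbreviation sgn :: "int \<Rightarrow> 'c \<Rightarrow> 'c" where
  "sgn t c \<equiv> if t = x0 then inv\<^bsub>C\<^esub> c else c"

text \<open>The projections turn a formula in components into one in \<open>x\<close>, from which
  continuity can be read off. It is restricted to the carrier because \<open>AutoGroup\<close>
  consists of extensional functions.\<close>

definition ext_action :: "int \<Rightarrow> 'r \<Rightarrow> 'r" where
  "ext_action t = (\<lambda>x\<in>carrier R. \<iota> (\<delta> t (\<pi> x)) \<otimes>\<^bsub>R\<^esub> \<kappa> (sgn t (\<rho> x)))"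

lemma ext_action_product:
  "t \<in> carrier Delta \<Longrightarrow> a \<in> carrier A \<Longrightarrow> c \<in> carrier C \<Longrightarrow>
    ext_action t (\<iota> a \<otimes>\<^bsub>R\<^esub> \<kappa> c) = \<iota> (\<delta> t a) \<otimes>\<^bsub>R\<^esub> \<kappa> (sgn t c)"
  by (simp add: ext_action_def)

lemma sgn_closed: "c \<in> carrier C \<Longrightarrow> sgn t c \<in> carrier C"
  by simp

lemma sgn_mult: "c \<in> carrier C \<Longrightarrow> c' \<in> carrier C \<Longrightarrow> sgn t (c \<otimes>\<^bsub>C\<^esub> c') = sgn t c \<otimes>\<^bsub>C\<^esub> sgn t c'"
  using abelian[of "inv\<^bsub>C\<^esub> c'" "inv\<^bsub>C\<^esub> c"] by (simp add: C.inv_mult_group)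

lemma sgn_sgn:
  "s \<in> carrier Delta \<Longrightarrow> t \<in> carrier Delta \<Longrightarrow> c \<in> carrier C \<Longrightarrow> sgn (s \<otimes>\<^bsub>Delta\<^esub> t) c = sgn s (sgn t c)"
  by (auto elim!: x0_cases)

lemma productE:
  assumes "x \<in> carrier R"
  obtains a c where "a \<in> carrier A" "c \<in> carrier C" "x = \<iota> a \<otimes>\<^bsub>R\<^esub> \<kappa> c"
  using assms decomposition[OF assms] \<pi>.hom_closed \<rho>.hom_closed by metis

text \<open>The algebraic laws are checked on products
  \<open>\<iota> a \<otimes> \<kappa> c\<close>, where both the action and the multiplication work
  by components.\<close>

lemma continuous_ext_action: "continuous_action Delta R ext_action"
proof (rule continuous_actionI[OF P.H.group_axioms R.group_axioms])
  fix t x y assume t: "t \<in> carrier Delta" and x: "x \<in> carrier R"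
  obtain a c where ac: "a \<in> carrier A" "c \<in> carrier C" "x = \<iota> a \<otimes>\<^bsub>R\<^esub> \<kappa> c"
    using x by (rule productE)
  show "ext_action t x \<in> carrier R"
    using t ac by (simp add: ext_action_product)
  assume "y \<in> carrier R"
  then obtain b d where bd: "b \<in> carrier A" "d \<in> carrier C" "y = \<iota> b \<otimes>\<^bsub>R\<^esub> \<kappa> d"
    by (rule productE)
  show "ext_action t (x \<otimes>\<^bsub>R\<^esub> y) = ext_action t x \<otimes>\<^bsub>R\<^esub> ext_action t y"
  proof -
    have "ext_action t (x \<otimes>\<^bsub>R\<^esub> y) = \<iota> (\<delta> t a \<otimes>\<^bsub>A\<^esub> \<delta> t b) \<otimes>\<^bsub>R\<^esub> \<kappa> (sgn t c \<otimes>\<^bsub>C\<^esub> sgn t d)"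
      unfolding ac(3) bd(3) product_mult[OF ac(1) bd(1) ac(2) bd(2)]
        ext_action_product[OF t A.m_closed[OF ac(1) bd(1)] C.m_closed[OF ac(2) bd(2)]]
        sgn_mult[OF ac(2) bd(2)] P.act_simps(2)[OF t ac(1) bd(1)] ..
    also have "\<dots> = ext_action t x \<otimes>\<^bsub>R\<^esub> ext_action t y"
      unfolding ac(3) bd(3) ext_action_product[OF t ac(1,2)] ext_action_product[OF t bd(1,2)]
      using t ac bd by (intro product_mult[symmetric] sgn_closed P.act_simps(1))
    finally show ?thesis .
  qed
next
  fix t show "ext_action t \<in> extensional (carrier R)"
    by (simp add: ext_action_def)
next
  fix x assume "x \<in> carrier R"
  then obtain a c where ac: "a \<in> carrier A" "c \<in> carrier C" "x = \<iota> a \<otimes>\<^bsub>R\<^esub> \<kappa> c"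
    by (rule productE)
  have "\<one>\<^bsub>Delta\<^esub> \<noteq> x0" by (simp add: x0_def)
  then show "ext_action \<one>\<^bsub>Delta\<^esub> x = x"
    unfolding ac(3) ext_action_product[OF P.H.one_closed ac(1,2)] P.act_simps(3)[OF ac(1)] by simp
next
  fix s t x assume s: "s \<in> carrier Delta" and t: "t \<in> carrier Delta" and "x \<in> carrier R"
  then obtain a c where ac: "a \<in> carrier A" "c \<in> carrier C" "x = \<iota> a \<otimes>\<^bsub>R\<^esub> \<kappa> c"
    by (elim productE)
  show "ext_action (s \<otimes>\<^bsub>Delta\<^esub> t) x = ext_action s (ext_action t x)"
    unfolding ac(3) ext_action_product[OF P.H.m_closed[OF s t] ac(1,2)] ext_action_product[OF t ac(1,2)]
      ext_action_product[OF s P.act_simps(1)[OF t ac(1)] sgn_closed[OF ac(2)]]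
      P.act_mult[OF s t ac(1)] sgn_sgn[OF s t ac(2)] ..
next
  let ?T = "prod_topology (topo Delta) (topo R)"
  have "continuous_map ?T (topo R) (\<lambda>z. \<iota> (\<delta> (fst z) (\<pi> (snd z))) \<otimes>\<^bsub>R\<^esub> \<kappa> (sgn (fst z) (\<rho> (snd z))))"
  proof (intro R.continuous_map_mult continuous_comp P.continuous_map_act continuous_map_fst continuous_map_snd)
    show "continuous_map ?T (topo C) (\<lambda>z. sgn (fst z) (\<rho> (snd z)))"
    proof (rule continuous_map_if_discrete)
      show "continuous_map ?T (discrete_topology {0, 1}) fst"
        using continuous_map_fst[of "topo Delta" "topo R"] by simp
    qed (intro C.continuous_map_m_inv continuous_comp continuous_map_snd)+
  qed
  then show "continuous_map ?T (topo R) (\<lambda>(t, x). ext_action t x)"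
    by (rule continuous_map_eq) (auto simp: ext_action_def R.topspace_topo)
qed

text \<open>The first equation transports the formula for \<open>\<delta>\<close> to the larger
  group; the second is that formula for a trivial conjugating element.\<close>

lemma ext_action_generator:
  "a \<in> carrier A \<Longrightarrow> ext_action x0 (\<iota> a) = \<iota> (\<delta> x0 a)"
  "c \<in> carrier C \<Longrightarrow> ext_action x0 (\<kappa> c) = inv\<^bsub>R\<^esub> \<kappa> c"
proof -
  have x0: "x0 \<in> carrier Delta" by (simp add: carrier_Delta x0_def)
  show "a \<in> carrier A \<Longrightarrow> ext_action x0 (\<iota> a) = \<iota> (\<delta> x0 a)"
    using ext_action_product[OF x0 _ C.one_closed, of a] x0 by simp
  show "c \<in> carrier C \<Longrightarrow> ext_action x0 (\<kappa> c) = inv\<^bsub>R\<^esub> \<kappa> c"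
    using ext_action_product[OF x0 A.one_closed, of c] x0 by simp
qed

lemma semi_trivial_action: "continuous_action P.G C (semi_trivial P.G C)"
  using P.pro2_semidirect_axioms C.topological_group_axioms abelian
  by (rule continuous_action_semi_trivial)

sublocale S: pro2_semidirect C P.G "semi_trivial P.G C"
  by (intro pro2_semidirect.intro C.pro2_group_axioms P.pro2_group_semidirect
      pro2_semidirect_axioms.intro semi_trivial_action)

sublocale E: pro2_semidirect R Delta ext_action
  by (intro pro2_semidirect.intro R.pro2_group_axioms pro2_group_Delta
      pro2_semidirect_axioms.intro continuous_ext_action)

text \<open>In both groups the \<open>C\<close>-components multiply as
  \<open>c \<otimes> sgn t c'\<close>: on the left because \<open>A\<close> acts trivially on
  \<open>C\<close>, on the right because the images of \<open>A\<close> and \<open>C\<close> commute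
  in \<open>R\<close>. The two projections give the continuous inverse.\<close>

theorem semidirect_reassociate: "S.G \<simeq>\<^sub>t E.G"
proof (rule tgroup_isoI)
  let ?f = "\<lambda>z. (\<iota> (fst (snd z)) \<otimes>\<^bsub>R\<^esub> \<kappa> (fst z), snd (snd z))"
  let ?g = "\<lambda>w. (\<rho> (fst w), \<pi> (fst w), snd w)"
  show "homeomorphic_maps (topo S.G) (topo E.G) ?f ?g"
    unfolding homeomorphic_maps_def
  proof (intro conjI ballI)
    have "continuous_map (topo S.G) (topo A) (\<lambda>z. fst (snd z))" "continuous_map (topo S.G) (topo Delta) (\<lambda>z. snd (snd z))"
      using continuous_map_compose[OF continuous_map_snd continuous_map_fst]
        continuous_map_compose[OF continuous_map_snd continuous_map_snd]
      by (simp_all add: o_def del: Delta_simps)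
    moreover have "continuous_map (topo S.G) (topo C) fst"
      by (simp only: semidirect_simps continuous_map_fst)
    ultimately show "continuous_map (topo S.G) (topo E.G) ?f"
      unfolding semidirect_simps(4)[of R Delta]
      by (intro continuous_map_pairedI R.continuous_map_mult continuous_comp)
    have "continuous_map (topo E.G) (topo R) fst" "continuous_map (topo E.G) (topo Delta) snd"
      by (simp_all only: semidirect_simps continuous_map_fst continuous_map_snd)
    then show "continuous_map (topo E.G) (topo S.G) ?g"
      unfolding semidirect_simps(4)[of C] semidirect_simps(4)[of A]
      by (intro continuous_map_pairedI continuous_comp)
    fix z assume "z \<in> topspace (topo S.G)"
    then show "?g (?f z) = z"
      by (auto simp: C.topspace_topo A.topspace_topo)
  next
    fix w assume "w \<in> topspace (topo E.G)"
    then show "?f (?g w) = w"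
      by (auto simp: R.topspace_topo decomposition)
  qed
  show "?f \<in> hom S.G E.G"
  proof (rule homI)
    fix z assume "z \<in> carrier S.G"
    then show "?f z \<in> carrier E.G" by auto
    fix w assume w: "w \<in> carrier S.G"
    obtain c a t where z: "z = (c, a, t)" "c \<in> carrier C" "a \<in> carrier A" "t \<in> carrier Delta"
      using \<open>z \<in> carrier S.G\<close> by auto
    obtain c' a' t' where w: "w = (c', a', t')" "c' \<in> carrier C" "a' \<in> carrier A" "t' \<in> carrier Delta"
      using w by auto
    have "semi_trivial P.G C (a, t) c' = sgn t c'"
      using z w by (simp add: semi_trivial_apply)
    then have "?f (z \<otimes>\<^bsub>S.G\<^esub> w) = (\<iota> (a \<otimes>\<^bsub>A\<^esub> \<delta> t a') \<otimes>\<^bsub>R\<^esub> \<kappa> (c \<otimes>\<^bsub>C\<^esub> sgn t c'), t \<otimes>\<^bsub>Delta\<^esub> t')"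
      unfolding z(1) w(1) by (simp del: Delta_simps)
    also have "\<dots> = ((\<iota> a \<otimes>\<^bsub>R\<^esub> \<kappa> c) \<otimes>\<^bsub>R\<^esub> ext_action t (\<iota> a' \<otimes>\<^bsub>R\<^esub> \<kappa> c'), t \<otimes>\<^bsub>Delta\<^esub> t')"
      unfolding ext_action_product[OF z(4) w(3,2)]
      using product_mult[OF z(3) P.act_simps(1)[OF z(4) w(3)] z(2) sgn_closed[OF w(2)]] by simp
    also have "\<dots> = ?f z \<otimes>\<^bsub>E.G\<^esub> ?f w"
      unfolding z(1) w(1) by (simp del: Delta_simps)
    finally show "?f (z \<otimes>\<^bsub>S.G\<^esub> w) = ?f z \<otimes>\<^bsub>E.G\<^esub> ?f w" .
  qed
  show "topspace (topo S.G) = carrier S.G" by (rule S.G.topspace_topo)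
  show "topspace (topo E.G) = carrier E.G" by (rule E.G.topspace_topo)
qed

end

section \<open>The group of a join\<close>

lemma nverts_join [simp]: "nverts (\<Gamma> \<nabla> \<Gamma>') = nverts \<Gamma> + nverts \<Gamma>'"
  by (simp add: join_def)

lemma is_graph_join:
  assumes "is_graph \<Gamma>" "is_graph \<Gamma>'"
  shows "is_graph (\<Gamma> \<nabla> \<Gamma>')"
  unfolding is_graph_def
proof
  let ?d = "nverts \<Gamma>" and ?n = "nverts \<Gamma>'"
  fix e assume "e \<in> edges (\<Gamma> \<nabla> \<Gamma>')"
  then consider "e \<in> edges \<Gamma>" | e' where "e' \<in> edges \<Gamma>'" "e = (\<lambda>j. ?d + j) ` e'"
    | i j where "i \<in> {1..?d}" "j \<in> {1..?n}" "e = {i, ?d + j}"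
    by (auto simp: join_def)
  then show "e \<in> pairs (nverts (\<Gamma> \<nabla> \<Gamma>'))"
  proof cases
    case 1
    then obtain i j where "e = {i, j}" "i \<in> {1..?d}" "j \<in> {1..?d}" "i \<noteq> j"
      using assms(1) unfolding is_graph_def pairs_def by blast
    then show ?thesis by (force simp: pairs_def)
  next
    case 2
    then obtain i j where "e' = {i, j}" "i \<in> {1..?n}" "j \<in> {1..?n}" "i \<noteq> j"
      using assms(2) unfolding is_graph_def pairs_def by blast
    then have "e = {?d + i, ?d + j}" "?d + i \<in> {1..?d + ?n}" "?d + j \<in> {1..?d + ?n}" "?d + i \<noteq> ?d + j"
      using 2(2) by auto
    then show ?thesis unfolding pairs_def nverts_join by blast
  next
    case 3
    then have "i \<in> {1..?d + ?n}" "?d + j \<in> {1..?d + ?n}" "i \<noteq> ?d + j"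
      by auto
    then show ?thesis using 3(3) unfolding pairs_def nverts_join by blast
  qed
qed

text \<open>Each projection kills the generators of the other graph. It respects the relations
  because an edge inside one part is an edge of that graph, and an edge meeting the other part has
  an endpoint with trivial image.\<close>

lemma raag_join_direct_product:
  assumes \<Gamma>: "is_graph \<Gamma>" and \<Gamma>': "is_graph \<Gamma>'"
  shows "\<exists>\<iota> \<kappa> \<pi> \<rho>. pro2_direct_product (raag \<Gamma>) (raag \<Gamma>') (raag (\<Gamma> \<nabla> \<Gamma>')) \<iota> \<kappa> \<pi> \<rho> \<and>
    (\<forall>i\<in>{1..nverts \<Gamma>}. \<iota> (raag_gen \<Gamma> i) = raag_gen (\<Gamma> \<nabla> \<Gamma>') i) \<and>
    (\<forall>j\<in>{1..nverts \<Gamma>'}. \<kappa> (raag_gen \<Gamma>' j) = raag_gen (\<Gamma> \<nabla> \<Gamma>') (nverts \<Gamma> + j))"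
proof -
  let ?d = "nverts \<Gamma>" and ?n = "nverts \<Gamma>'" and ?J = "\<Gamma> \<nabla> \<Gamma>'"
  let ?A = "raag \<Gamma>" and ?C = "raag \<Gamma>'" and ?R = "raag (\<Gamma> \<nabla> \<Gamma>')"
  have J: "is_graph ?J" by (rule is_graph_join[OF assms])
  interpret A: pro2_group ?A by (rule pro2_group_raag[OF \<Gamma>])
  interpret C: pro2_group ?C by (rule pro2_group_raag[OF \<Gamma>'])
  interpret R: pro2_group ?R by (rule pro2_group_raag[OF J])
  have edge1: "{i, j} \<in> edges ?J" if "{i, j} \<in> edges \<Gamma>" for i j
    using that by (simp add: join_def)
  have edge2: "{?d + i, ?d + j} \<in> edges ?J" if "{i, j} \<in> edges \<Gamma>'" for i j
    using imageI[OF that, of "\<lambda>e. (\<lambda>j. ?d + j) ` e"] by (simp add: join_def)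
  have edge3: "{i, ?d + j} \<in> edges ?J" if "i \<in> {1..?d}" "j \<in> {1..?n}" for i j
    using that by (auto simp: join_def)
  \<comment> \<open>Edges are sorted by the positions of their endpoints. Since
    \<open>{i, j}\<close> carries no order, a mixed edge shows up in two ways.\<close>
  have edgeE: "{i, j} \<in> edges \<Gamma> \<and> i \<le> ?d \<and> j \<le> ?d \<or> {i - ?d, j - ?d} \<in> edges \<Gamma>' \<and> ?d < i \<and> ?d < j
      \<or> i \<le> ?d \<and> ?d < j \<or> ?d < i \<and> j \<le> ?d"
    if ij: "{i, j} \<in> edges ?J" for i j
  proof -
    consider "{i, j} \<in> edges \<Gamma>" | e where "e \<in> edges \<Gamma>'" "{i, j} = (\<lambda>j. ?d + j) ` e"
      | k l where "k \<in> {1..?d}" "l \<in> {1..?n}" "{i, j} = {k, ?d + l}"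
      using ij by (auto simp: join_def)
    then show ?thesis
    proof cases
      case 1
      then show ?thesis using edge_vertices[OF \<Gamma> 1] by simp
    next
      case 2
      then obtain k l where kl: "e = {k, l}" "k \<in> {1..?n}" "l \<in> {1..?n}"
        using \<Gamma>' unfolding is_graph_def pairs_def by blast
      then have "{i, j} = {?d + k, ?d + l}" using 2(2) by simp
      then have "i = ?d + k \<and> j = ?d + l \<or> i = ?d + l \<and> j = ?d + k"
        by (simp add: doubleton_eq_iff)
      then show ?thesis
        using kl 2(1) by (auto simp: insert_commute)
    next
      case 3
      then show ?thesis by (auto simp: doubleton_eq_iff)
    qed
  qed
  have gen_split: "i \<in> {1..?d} \<or> (\<exists>j\<in>{1..?n}. i = ?d + j)" if "i \<in> {1..nverts ?J}" for i
  proof (cases "i \<le> ?d")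
    case False
    then have "i - ?d \<in> {1..?n}" "i = ?d + (i - ?d)" using that by auto
    then show ?thesis by blast
  qed (use that in auto)
  note genA = raag_gen_closed[OF \<Gamma>] and genC = raag_gen_closed[OF \<Gamma>'] and genR = raag_gen_closed[OF J]
  obtain \<iota> where \<iota>: "\<iota> \<in> continuous_hom ?A ?R" "\<forall>i\<in>{1..?d}. \<iota> (raag_gen \<Gamma> i) = raag_gen ?J i"
    using raag_universal[OF \<Gamma> R.pro2_group_axioms, of "raag_gen ?J"] genR raag_gen_commute[OF J edge1] by auto
  obtain \<kappa> where \<kappa>: "\<kappa> \<in> continuous_hom ?C ?R" "\<forall>j\<in>{1..?n}. \<kappa> (raag_gen \<Gamma>' j) = raag_gen ?J (?d + j)"
    using raag_universal[OF \<Gamma>' R.pro2_group_axioms, of "\<lambda>j. raag_gen ?J (?d + j)"] genR raag_gen_commute[OF J edge2] by auto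
  define p where "p i = (if i \<le> ?d then raag_gen \<Gamma> i else \<one>\<^bsub>?A\<^esub>)" for i
  have p: "p \<in> {1..nverts ?J} \<rightarrow> carrier ?A"
    using genA by (auto simp: p_def)
  have p_commute: "p i \<otimes>\<^bsub>?A\<^esub> p j = p j \<otimes>\<^bsub>?A\<^esub> p i" if e: "{i, j} \<in> edges ?J" for i j
    using edgeE[OF e] raag_gen_commute[OF \<Gamma>, of i j] genA edge_vertices[OF J e] by (auto simp: p_def)
  obtain \<pi> where \<pi>: "\<pi> \<in> continuous_hom ?R ?A" "\<forall>i\<in>{1..nverts ?J}. \<pi> (raag_gen ?J i) = p i"
    using raag_universal[OF J A.pro2_group_axioms p p_commute] by blast
  \<comment> \<open>The subtraction matters only for \<open>?d < i\<close>, where it recovers the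
    vertex of the second graph.\<close>
  define q where "q i = (if i \<le> ?d then \<one>\<^bsub>?C\<^esub> else raag_gen \<Gamma>' (i - ?d))" for i
  have genC': "raag_gen \<Gamma>' (i - ?d) \<in> carrier ?C" if "i \<in> {1..nverts ?J}" "?d < i" for i
    using that by (intro genC) auto
  have q: "q \<in> {1..nverts ?J} \<rightarrow> carrier ?C"
    using genC' by (auto simp: q_def)
  have q_commute: "q i \<otimes>\<^bsub>?C\<^esub> q j = q j \<otimes>\<^bsub>?C\<^esub> q i" if e: "{i, j} \<in> edges ?J" for i j
    using edgeE[OF e] raag_gen_commute[OF \<Gamma>', of "i - ?d" "j - ?d"] genC' edge_vertices[OF J e] by (auto simp: q_def)
  obtain \<rho> where \<rho>: "\<rho> \<in> continuous_hom ?R ?C" "\<forall>i\<in>{1..nverts ?J}. \<rho> (raag_gen ?J i) = q i"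
    using raag_universal[OF J C.pro2_group_axioms q q_commute] by blast
  have \<pi>_gen: "\<pi> (raag_gen ?J i) = raag_gen \<Gamma> i" "\<rho> (raag_gen ?J i) = \<one>\<^bsub>?C\<^esub>" if "i \<in> {1..?d}" for i
    using \<pi>(2) \<rho>(2) that by (auto simp: p_def q_def)
  have \<rho>_gen: "\<pi> (raag_gen ?J (?d + j)) = \<one>\<^bsub>?A\<^esub>" "\<rho> (raag_gen ?J (?d + j)) = raag_gen \<Gamma>' j" if "j \<in> {1..?n}" for j
    using \<pi>(2) \<rho>(2) that by (auto simp: p_def q_def)
  note group_homI = group_hom_continuous_hom[OF _ A.group_axioms] group_hom_continuous_hom[OF _ C.group_axioms]
    group_hom_continuous_hom[OF _ R.group_axioms]
  interpret \<iota>: group_hom ?A ?R \<iota> by (rule group_homI(1)[OF \<iota>(1) R.group_axioms])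
  interpret \<kappa>: group_hom ?C ?R \<kappa> by (rule group_homI(2)[OF \<kappa>(1) R.group_axioms])
  interpret \<pi>: group_hom ?R ?A \<pi> by (rule group_homI(3)[OF \<pi>(1) A.group_axioms])
  interpret \<rho>: group_hom ?R ?C \<rho> by (rule group_homI(3)[OF \<rho>(1) C.group_axioms])
  have comp: "(\<lambda>x. g (f x)) \<in> continuous_hom G K" if "f \<in> continuous_hom G H" "g \<in> continuous_hom H K"
    for f g and G H K :: "raag_elem tgroup"
    using that continuous_map_compose[of "topo G" "topo H" f "topo K" g]
    by (auto simp: continuous_hom_def hom_def o_def Pi_iff)
  have const: "(\<lambda>x. \<one>\<^bsub>H\<^esub>) \<in> continuous_hom G H" if "topological_group H" for G H :: "raag_elem tgroup"
  proof -
    interpret H: topological_group H by fact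
    show ?thesis
      by (simp add: continuous_hom_def hom_def H.topspace_topo)
  qed
  \<comment> \<open>Commutation is extended one variable at a time: for a fixed generator of
    \<open>?A\<close> to all of \<open>?C\<close>, and then to all of \<open>?A\<close>.\<close>
  have \<iota>\<kappa>: "\<iota> a \<otimes>\<^bsub>?R\<^esub> \<kappa> c = \<kappa> c \<otimes>\<^bsub>?R\<^esub> \<iota> a" if a: "a \<in> carrier ?A" and c: "c \<in> carrier ?C" for a c
  proof (rule raag_hom_commute[OF \<Gamma> R.pro2_group_axioms \<iota>(1) \<kappa>.hom_closed[OF c] _ a])
    fix i assume i: "i \<in> {1..?d}"
    have "\<kappa> c \<otimes>\<^bsub>?R\<^esub> \<iota> (raag_gen \<Gamma> i) = \<iota> (raag_gen \<Gamma> i) \<otimes>\<^bsub>?R\<^esub> \<kappa> c"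
    proof (rule raag_hom_commute[OF \<Gamma>' R.pro2_group_axioms \<kappa>(1) \<iota>.hom_closed[OF genA[OF i]] _ c])
      fix j assume j: "j \<in> {1..?n}"
      show "\<kappa> (raag_gen \<Gamma>' j) \<otimes>\<^bsub>?R\<^esub> \<iota> (raag_gen \<Gamma> i) = \<iota> (raag_gen \<Gamma> i) \<otimes>\<^bsub>?R\<^esub> \<kappa> (raag_gen \<Gamma>' j)"
        using raag_gen_commute[OF J edge3[OF i j]] \<iota>(2) \<kappa>(2) i j by simp
    qed
    then show "\<iota> (raag_gen \<Gamma> i) \<otimes>\<^bsub>?R\<^esub> \<kappa> c = \<kappa> c \<otimes>\<^bsub>?R\<^esub> \<iota> (raag_gen \<Gamma> i)" by simp
  qed
  have "pro2_direct_product ?A ?C ?R \<iota> \<kappa> \<pi> \<rho>"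
  proof (intro pro2_direct_product.intro A.pro2_group_axioms C.pro2_group_axioms R.pro2_group_axioms
      pro2_direct_product_axioms.intro \<iota>(1) \<kappa>(1) \<pi>(1) \<rho>(1) \<iota>\<kappa>)
    fix a assume a: "a \<in> carrier ?A"
    show "\<pi> (\<iota> a) = a"
      using raag_hom_eq[OF \<Gamma> A.pro2_group_axioms comp[OF \<iota>(1) \<pi>(1)] id_continuous_hom[OF A.group_axioms] _ a]
        \<iota>(2) \<pi>_gen by simp
    show "\<rho> (\<iota> a) = \<one>\<^bsub>?C\<^esub>"
      using raag_hom_eq[OF \<Gamma> C.pro2_group_axioms comp[OF \<iota>(1) \<rho>(1)] const[OF C.topological_group_axioms] _ a]
        \<iota>(2) \<pi>_gen by simp
  next
    fix c assume c: "c \<in> carrier ?C"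
    show "\<rho> (\<kappa> c) = c"
      using raag_hom_eq[OF \<Gamma>' C.pro2_group_axioms comp[OF \<kappa>(1) \<rho>(1)] id_continuous_hom[OF C.group_axioms] _ c]
        \<kappa>(2) \<rho>_gen by simp
    show "\<pi> (\<kappa> c) = \<one>\<^bsub>?A\<^esub>"
      using raag_hom_eq[OF \<Gamma>' A.pro2_group_axioms comp[OF \<kappa>(1) \<pi>(1)] const[OF A.topological_group_axioms] _ c]
        \<kappa>(2) \<rho>_gen by simp
  next
    fix x assume x: "x \<in> carrier ?R"
    \<comment> \<open>Recombining the two components is multiplicative because they commute, so it
      can be compared with the identity map on generators.\<close>
    let ?f = "\<lambda>x. \<iota> (\<pi> x) \<otimes>\<^bsub>?R\<^esub> \<kappa> (\<rho> x)"
    have "?f \<in> hom ?R ?R"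
    proof (rule homI)
      fix x y assume xy: "x \<in> carrier ?R" "y \<in> carrier ?R"
      have "\<kappa> (\<rho> x) \<otimes>\<^bsub>?R\<^esub> (\<iota> (\<pi> y) \<otimes>\<^bsub>?R\<^esub> \<kappa> (\<rho> y)) = \<iota> (\<pi> y) \<otimes>\<^bsub>?R\<^esub> (\<kappa> (\<rho> x) \<otimes>\<^bsub>?R\<^esub> \<kappa> (\<rho> y))"
        using xy \<iota>\<kappa>[of "\<pi> y" "\<rho> x"] by (simp flip: R.m_assoc)
      then show "?f (x \<otimes>\<^bsub>?R\<^esub> y) = ?f x \<otimes>\<^bsub>?R\<^esub> ?f y"
        using xy by (simp add: R.m_assoc)
    qed simp
    moreover have "continuous_map (topo ?R) (topo ?R) ?f"
      using continuous_homD(2)[OF comp[OF \<pi>(1) \<iota>(1)]] continuous_homD(2)[OF comp[OF \<rho>(1) \<kappa>(1)]]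
      by (rule R.continuous_map_mult)
    ultimately have f: "?f \<in> continuous_hom ?R ?R"
      by (simp add: continuous_hom_def)
    show "?f x = x"
    proof (rule raag_hom_eq[OF J R.pro2_group_axioms f id_continuous_hom[OF R.group_axioms] _ x])
      fix i assume i: "i \<in> {1..nverts ?J}"
      from gen_split[OF i] show "?f (raag_gen ?J i) = raag_gen ?J i"
      proof (elim disjE bexE)
        assume "i \<in> {1..?d}"
        then show ?thesis
          using \<pi>_gen \<iota>(2) genR[OF i] by simp
      next
        fix j assume "j \<in> {1..?n}" "i = ?d + j"
        then show ?thesis
          using \<rho>_gen \<kappa>(2) genR[OF i] by simp
      qed
    qed
  qed
  then show ?thesis
    using \<iota>(2) \<kappa>(2) by blast
qed

section \<open>The iterated semidirect product as a \<Delta>-RAAG\<close>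

theorem proposition2p11:
  fixes \<Gamma> :: graph and z :: "nat \<Rightarrow> raag_elem" and \<delta> :: "int \<Rightarrow> raag_elem \<Rightarrow> raag_elem" and n :: nat
  assumes "is_graph \<Gamma>" and "Delta_action \<Gamma> z \<delta>" and "n > 0"
  shows "let Gz = semidirect (raag \<Gamma>) Delta \<delta>;
             \<Gamma>c = complete_graph n;
             \<Gamma>' = \<Gamma> \<nabla> \<Gamma>c;
             G = semidirect (raag \<Gamma>c) Gz (semi_trivial Gz (raag \<Gamma>c))
         in raag \<Gamma>c \<simeq>\<^sub>t Z2_power n \<and>
            continuous_action Gz (raag \<Gamma>c) (semi_trivial Gz (raag \<Gamma>c)) \<and>
            G \<simeq>\<^sub>t semidirect (Z2_power n) Gz (semi_trivial Gz (Z2_power n)) \<and>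
            pro2_group G \<and>
            is_Delta_RAAG G \<and>
            (\<exists>\<iota> z' \<delta>'.
               raag_embedding \<Gamma> \<Gamma>' \<iota> \<and>
               (\<forall>i\<in>{1..nverts \<Gamma>}. z' i = \<iota> (z i)) \<and>
               (\<forall>i\<in>{nverts \<Gamma> + 1..nverts \<Gamma> + n}. z' i = \<one>\<^bsub>raag \<Gamma>'\<^esub>) \<and>
               Delta_action \<Gamma>' z' \<delta>' \<and>
               G \<simeq>\<^sub>t semidirect (raag \<Gamma>') Delta \<delta>')"
proof -
  let ?A = "raag \<Gamma>" and ?K = "complete_graph n"
  let ?C = "raag ?K" and ?J = "\<Gamma> \<nabla> ?K"
  let ?R = "raag ?J" and ?P = "semidirect (raag \<Gamma>) Delta \<delta>"
  let ?G = "semidirect ?C ?P (semi_trivial ?P ?C)"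
  have K: "is_graph ?K" by (rule is_graph_complete_graph)
  obtain \<iota> \<kappa> \<pi> \<rho> where product: "pro2_direct_product ?A ?C ?R \<iota> \<kappa> \<pi> \<rho>"
    and \<iota>: "\<forall>i\<in>{1..nverts \<Gamma>}. \<iota> (raag_gen \<Gamma> i) = raag_gen ?J i"
    and \<kappa>: "\<forall>j\<in>{1..n}. \<kappa> (raag_gen ?K j) = raag_gen ?J (nverts \<Gamma> + j)"
    using raag_join_direct_product[OF assms(1) K] by auto
  have action: "continuous_action Delta ?A \<delta>" and z: "z \<in> {1..nverts \<Gamma>} \<rightarrow> carrier ?A"
    and gen: "\<forall>i\<in>{1..nverts \<Gamma>}. \<delta> x0 (raag_gen \<Gamma> i) =
      inv\<^bsub>?A\<^esub> z i \<otimes>\<^bsub>?A\<^esub> inv\<^bsub>?A\<^esub> raag_gen \<Gamma> i \<otimes>\<^bsub>?A\<^esub> z i"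
    using assms(2) by (auto simp: Delta_action_def)
  interpret D: Delta_direct_product ?A ?C ?R \<iota> \<kappa> \<pi> \<rho> \<delta>
    using product action raag_complete_graph_commute
    by (simp add: Delta_direct_product_def Delta_direct_product_axioms_def)
  have iso: "?C \<simeq>\<^sub>t Z2_power n"
    by (rule complete_raag.raag_complete_graph_iso)
  have "group (Z2_power n)" "topspace (topo (Z2_power n)) = carrier (Z2_power n)"
    unfolding Z2_power_def with_topology_simps topspace_product_topology Z2.topspace_topo
    by (simp_all add: group_with_topology Z2.group_axioms)
  then have "?G \<simeq>\<^sub>t semidirect (Z2_power n) ?P (semi_trivial ?P (Z2_power n))"
    by (intro semidirect_semi_trivial_iso iso D.C.group_axioms D.P.G.group_axioms
        D.C.topspace_topo D.P.G.topspace_topo)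
  moreover have "pro2_group ?G"
    by (rule D.S.pro2_group_semidirect)
  \<comment> \<open>Injectivity holds because \<open>\<pi>\<close> is a left inverse of
    \<open>\<iota>\<close>.\<close>
  moreover have embedding: "raag_embedding \<Gamma> ?J \<iota>"
    unfolding raag_embedding_def using D.\<iota> \<iota> by (auto intro: inj_on_inverseI[of _ \<pi>])
  moreover define z' where "z' i = (if i \<in> {1..nverts \<Gamma>} then \<iota> (z i) else \<one>\<^bsub>?R\<^esub>)" for i
  have Delta_action: "Delta_action ?J z' D.ext_action"
    unfolding Delta_action_def
  proof (intro conjI ballI)
    show "z' \<in> {1..nverts ?J} \<rightarrow> carrier ?R"
      using z by (auto simp: z'_def Pi_iff)
    show "continuous_action Delta ?R D.ext_action"
      by (rule D.continuous_ext_action)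
    fix i assume i: "i \<in> {1..nverts ?J}"
    show "D.ext_action x0 (raag_gen ?J i) =
        inv\<^bsub>?R\<^esub> z' i \<otimes>\<^bsub>?R\<^esub> inv\<^bsub>?R\<^esub> raag_gen ?J i \<otimes>\<^bsub>?R\<^esub> z' i"
    \<comment> \<open>On the old generators the formula for \<open>\<delta>\<close> is carried over
      by \<open>\<iota>\<close>. On the new ones \<open>z' i\<close> is trivial and the formula
      reduces to inversion, which is how \<open>ext_action\<close> acts on the image of
      \<open>\<kappa>\<close>.\<close>
    proof (cases "i \<in> {1..nverts \<Gamma>}")
      case True
      then have "raag_gen \<Gamma> i \<in> carrier ?A" "z i \<in> carrier ?A"
        using raag_gen_closed[OF assms(1)] z by auto
      moreover from this have "D.ext_action x0 (\<iota> (raag_gen \<Gamma> i)) =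
          inv\<^bsub>?R\<^esub> \<iota> (z i) \<otimes>\<^bsub>?R\<^esub> inv\<^bsub>?R\<^esub> \<iota> (raag_gen \<Gamma> i) \<otimes>\<^bsub>?R\<^esub> \<iota> (z i)"
        using gen True by (simp add: D.ext_action_generator)
      ultimately show ?thesis
        using \<iota> True by (simp add: z'_def)
    next
      case False
      define j where "j = i - nverts \<Gamma>"
      have j: "j \<in> {1..n}" "i = nverts \<Gamma> + j"
        using i False by (auto simp: j_def)
      have c: "raag_gen ?K j \<in> carrier ?C"
        using raag_gen_closed[OF K] j(1) by simp
      have "raag_gen ?J i = \<kappa> (raag_gen ?K j)"
        using \<kappa> j by simp
      moreover have "z' i = \<one>\<^bsub>?R\<^esub>"
        using False by (simp only: z'_def if_False)
      ultimately show ?thesis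
        using D.ext_action_generator(2)[OF c] D.\<kappa>.hom_closed[OF c] by simp
    qed
  qed
  moreover have reassociate: "?G \<simeq>\<^sub>t semidirect ?R Delta D.ext_action"
    by (rule D.semidirect_reassociate)
  moreover have "is_Delta_RAAG ?G"
    unfolding is_Delta_RAAG_def using is_graph_join[OF assms(1) K] Delta_action reassociate by blast
  moreover have "\<forall>i\<in>{1..nverts \<Gamma>}. z' i = \<iota> (z i)"
    "\<forall>i\<in>{nverts \<Gamma> + 1..nverts \<Gamma> + n}. z' i = \<one>\<^bsub>?R\<^esub>"
    by (auto simp: z'_def)
  ultimately show ?thesis
    unfolding Let_def using iso D.semi_trivial_action by blast
qed

end
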